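(* Let $(R,\mathfrak m,k)$ be a local ring with Hilbert series $H_R(z)=1+ez+sz^2$. If $s=0$, or if $e^2-4s$ is not the square of an integer, then $R$ is Tor-friendly. If $s=0$, or if $e^2-4s\neq0$, then $R$ is Tor-persistent.
   Context: The Hilbert series of $R$ is $H_R(z)=\sum_{n\ge0}\operatorname{rank}_k(\mathfrak m^n/\mathfrak m^{n+1})z^n$. A local ring is Tor-friendly if for every pair $(M,N)$ of finitely generated modules with $\operatorname{Tor}_i(M,N)=0$ for $i\gg0$, $M$ or $N$ has finite projective dimension; it is Tor-persistent if every finitely generated module $M$ with $\operatorname{Tor}_i(M,M)=0$ for $i\gg0$ has finite projective dimension. *)

theory Defs
  imports "HOL-Algebra.Module" "HOL-Algebra.Ideal_Product" "HOL-Algebra.Ring_Divisibility"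
          "HOL-Computational_Algebra.Formal_Power_Series"
begin

definition local_ring :: "('a, 'b) ring_scheme \<Rightarrow> bool" where
  "local_ring R \<longleftrightarrow> cring R \<and> noetherian_ring R \<and> (\<exists>!m. maximalideal m R)"

definition max_ideal :: "('a, 'b) ring_scheme \<Rightarrow> 'a set" where
  "max_ideal R = (THE m. maximalideal m R)"

fun ideal_pow :: "('a, 'b) ring_scheme \<Rightarrow> 'a set \<Rightarrow> nat \<Rightarrow> 'a set" where
  "ideal_pow R I 0 = carrier R"
| "ideal_pow R I (Suc n) = ideal_prod R I (ideal_pow R I n)"

text \<open>S \<subseteq> m^n is a finite set whose residue classes form a basis of the
  k-vector space m^n / m^(n+1), k = R/m.\<close>
definition graded_basis :: "('a, 'b) ring_scheme \<Rightarrow> nat \<Rightarrow> 'a set \<Rightarrow> bool" where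
  "graded_basis R n S \<longleftrightarrow>
     (let m = max_ideal R in
      finite S \<and> S \<subseteq> ideal_pow R m n \<and>
      (\<forall>a \<in> S \<rightarrow> carrier R.
          finsum R (\<lambda>x. a x \<otimes>\<^bsub>R\<^esub> x) S \<in> ideal_pow R m (Suc n) \<longrightarrow> (\<forall>x\<in>S. a x \<in> m)) \<and>
      (\<forall>y \<in> ideal_pow R m n. \<exists>a \<in> S \<rightarrow> carrier R.
          y \<ominus>\<^bsub>R\<^esub> finsum R (\<lambda>x. a x \<otimes>\<^bsub>R\<^esub> x) S \<in> ideal_pow R m (Suc n)))"

definition hilbert_coeff :: "('a, 'b) ring_scheme \<Rightarrow> nat \<Rightarrow> nat" where
  "hilbert_coeff R n = (THE r. \<exists>S. graded_basis R n S \<and> card S = r)"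

definition hilbert_series :: "('a, 'b) ring_scheme \<Rightarrow> int fps" where
  "hilbert_series R = Abs_fps (\<lambda>n. int (hilbert_coeff R n))"

definition vecs :: "('c, 'd) ring_scheme \<Rightarrow> nat \<Rightarrow> (nat \<Rightarrow> 'c) set" where
  "vecs M b = {x. (\<forall>i<b. x i \<in> carrier M) \<and> (\<forall>i\<ge>b. x i = \<zero>\<^bsub>M\<^esub>)}"

definition mat_R :: "('a, 'b) ring_scheme \<Rightarrow> (nat \<Rightarrow> nat \<Rightarrow> 'a) \<Rightarrow> nat \<Rightarrow> nat
                     \<Rightarrow> (nat \<Rightarrow> 'a) \<Rightarrow> (nat \<Rightarrow> 'a)" where
  "mat_R R A p q x = (\<lambda>j. if j < p then finsum R (\<lambda>k. A j k \<otimes>\<^bsub>R\<^esub> x k) {..<q} else \<zero>\<^bsub>R\<^esub>)"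

text \<open>The induced map A \<otimes> N : R^q \<otimes> N = N^q -> N^p = R^p \<otimes> N.\<close>
definition mat_N :: "('a, 'c) module \<Rightarrow> (nat \<Rightarrow> nat \<Rightarrow> 'a) \<Rightarrow> nat \<Rightarrow> nat
                     \<Rightarrow> (nat \<Rightarrow> 'c) \<Rightarrow> (nat \<Rightarrow> 'c)" where
  "mat_N N A p q y = (\<lambda>j. if j < p then finsum N (\<lambda>k. A j k \<odot>\<^bsub>N\<^esub> y k) {..<q} else \<zero>\<^bsub>N\<^esub>)"

text \<open>A free resolution ... -> R^(b 2) --d 2--> R^(b 1) --d 1--> R^(b 0) --g--> M -> 0,
  where d i is a (b (i-1)) x (b i) matrix (i >= 1) and the augmentation sends the
  k-th basis vector to g k.\<close>
definition augment :: "('a, 'c) module \<Rightarrow> nat \<Rightarrow> (nat \<Rightarrow> 'c) \<Rightarrow> (nat \<Rightarrow> 'a) \<Rightarrow> 'c" where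
  "augment M b0 g x = finsum M (\<lambda>k. x k \<odot>\<^bsub>M\<^esub> g k) {..<b0}"

definition free_resolution ::
  "('a, 'b) ring_scheme \<Rightarrow> ('a, 'c) module \<Rightarrow> (nat \<Rightarrow> nat) \<Rightarrow> (nat \<Rightarrow> nat \<Rightarrow> nat \<Rightarrow> 'a)
   \<Rightarrow> (nat \<Rightarrow> 'c) \<Rightarrow> bool" where
  "free_resolution R M b d g \<longleftrightarrow>
     (\<forall>k<b 0. g k \<in> carrier M) \<and>
     (\<forall>i\<ge>1. \<forall>j<b (i - 1). \<forall>k<b i. d i j k \<in> carrier R) \<and>
     augment M (b 0) g ` vecs R (b 0) = carrier M \<and>
     {x \<in> vecs R (b 0). augment M (b 0) g x = \<zero>\<^bsub>M\<^esub>}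
        = mat_R R (d 1) (b 0) (b 1) ` vecs R (b 1) \<and>
     (\<forall>i\<ge>1. {x \<in> vecs R (b i). mat_R R (d i) (b (i - 1)) (b i) x = (\<lambda>_. \<zero>\<^bsub>R\<^esub>)}
        = mat_R R (d (Suc i)) (b i) (b (Suc i)) ` vecs R (b (Suc i)))"

text \<open>Tor_i(M,N) = H_i(F \<otimes> N) for the free resolution F of M; it is zero iff
  ker (d_i \<otimes> N) \<subseteq> im (d_(i+1) \<otimes> N)  (with d_0 = 0).\<close>
definition tor_zero ::
  "('a, 'c) module \<Rightarrow> (nat \<Rightarrow> nat) \<Rightarrow> (nat \<Rightarrow> nat \<Rightarrow> nat \<Rightarrow> 'a) \<Rightarrow> nat \<Rightarrow> bool" where
  "tor_zero N b d i \<longleftrightarrow>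
     {y \<in> vecs N (b i). i = 0 \<or> mat_N N (d i) (b (i - 1)) (b i) y = (\<lambda>_. \<zero>\<^bsub>N\<^esub>)}
       \<subseteq> mat_N N (d (Suc i)) (b i) (b (Suc i)) ` vecs N (b (Suc i))"

definition tor_eventually_zero ::
  "('a, 'b) ring_scheme \<Rightarrow> ('a, 'c) module \<Rightarrow> ('a, 'e) module \<Rightarrow> bool" where
  "tor_eventually_zero R M N \<longleftrightarrow>
     (\<exists>b d g. free_resolution R M b d g \<and> (\<exists>n0. \<forall>i\<ge>n0. tor_zero N b d i))"

definition fin_gen_module :: "('a, 'b) ring_scheme \<Rightarrow> ('a, 'c) module \<Rightarrow> bool" where
  "fin_gen_module R M \<longleftrightarrow> module R M \<and>
     (\<exists>(n::nat) g. (\<forall>k<n. g k \<in> carrier M) \<and>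
        (\<forall>y\<in>carrier M. \<exists>a. (\<forall>k<n. a k \<in> carrier R) \<and>
           y = finsum M (\<lambda>k. a k \<odot>\<^bsub>M\<^esub> g k) {..<n}))"

text \<open>Finite projective dimension (over a local ring, f.g. projectives are free):
  M has a free resolution of finite length.\<close>
definition finite_proj_dim :: "('a, 'b) ring_scheme \<Rightarrow> ('a, 'c) module \<Rightarrow> bool" where
  "finite_proj_dim R M \<longleftrightarrow>
     (\<exists>b d g. free_resolution R M b d g \<and> (\<exists>n. \<forall>i>n. b i = 0))"

definition tor_friendly :: "('a, 'b) ring_scheme \<Rightarrow> ('c itself) \<Rightarrow> ('e itself) \<Rightarrow> bool" where
  "tor_friendly R _ _ \<longleftrightarrow>
     (\<forall>(M :: ('a, 'c) module) (N :: ('a, 'e) module).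
        fin_gen_module R M \<and> fin_gen_module R N \<and> tor_eventually_zero R M N
        \<longrightarrow> finite_proj_dim R M \<or> finite_proj_dim R N)"

definition tor_persistent :: "('a, 'b) ring_scheme \<Rightarrow> ('c itself) \<Rightarrow> bool" where
  "tor_persistent R _ \<longleftrightarrow>
     (\<forall>M :: ('a, 'c) module.
        fin_gen_module R M \<and> tor_eventually_zero R M M \<longrightarrow> finite_proj_dim R M)"

end

theory Submission
  imports Defs
begin

text \<open>
  The Hilbert series forces \<open>m\<^sup>3 = 0\<close> and length \<open>1 + e + s\<close> for \<open>R\<close>. Suppose \<open>Tor\<^sub>i(M,N) = 0\<close> for
  large \<open>i\<close> and neither module has finite projective dimension; let \<open>b\<^sub>i\<close>, \<open>c\<^sub>j\<close> be the (nonzero) Betti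
  numbers of \<open>M\<close>, \<open>N\<close> and \<open>Z \<subseteq> mG\<close>, with \<open>G = R\<^bsup>c\<^esup>\<close>, a minimal syzygy of \<open>N\<close>, so that \<open>m\<^sup>2Z = 0\<close>.
  For the minimal resolution \<open>F\<close> of \<open>M\<close>, exactness of \<open>F \<otimes> Z\<close> in high degrees makes the kernel of
  \<open>F\<^sub>i \<otimes> Z \<rightarrow> F\<^sub>i\<^sub>-\<^sub>1 \<otimes> Z\<close> equal to \<open>m(F\<^sub>i \<otimes> Z)\<close>, whence
  \<open>b\<^sub>i\<^sub>+\<^sub>1 (length Z - length mZ) = b\<^sub>i length mZ\<close>; it also gives \<open>mZ = m\<^sup>2G\<close>, because every \<open>x \<in> m\<^sup>2G\<close>
  yields a cycle \<open>e\<^sub>0 \<otimes> x\<close>. Counting lengths along the resolution of \<open>N\<close> then gives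
  \<open>c\<^sub>j\<^sub>+\<^sub>2 = e c\<^sub>j\<^sub>+\<^sub>1 - s c\<^sub>j\<close> and \<open>b\<^sub>i\<^sub>+\<^sub>1 c\<^sub>j\<^sub>+\<^sub>1 = s b\<^sub>i c\<^sub>j\<close>. Hence \<open>s \<noteq> 0\<close>, both sequences are
  geometric, and the ratios \<open>\<alpha>\<close>, \<open>\<beta>\<close> satisfy \<open>\<alpha> + \<beta> = e\<close> and \<open>\<alpha>\<beta> = s\<close>, so \<open>e\<^sup>2 - 4s = (\<alpha> - \<beta>)\<^sup>2\<close> is a
  square, and it vanishes when \<open>M = N\<close>.
\<close>

subsection \<open>Submodules\<close>

text \<open>Passing from \<open>N\<close> to a syzygy Z is what makes the count possible.
  \<open>N\<close> itself is only killed by m^3, whereas m^2 Z = 0 makes the differentials of F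
  \<otimes> Z, whose entries lie in m, vanish on m(F \<otimes> Z). So m(F \<otimes> Z) lies between
  the boundaries and the cycles, and vanishing Tor makes all three equal. A Tor of a syzygy is a Tor
  of \<open>N\<close> in a higher degree, so one bound serves all syzygies, and a fixed i can be
  compared with every j. The product relation then separates the variables: a ratio of consecutive c
  is s times an inverse ratio of consecutive b, hence constant. The recurrence makes it a root of
  t^2 - e t + s, and the ratio of the b is the other root. Two gaps between the definitions and this
  argument shape the rest. Vanishing of Tor is given for some resolution, which need not be minimal,
  so resolutions have to be compared. And \<open>Tor\<close> is written with matrices: R^q \<otimes>
  N is N^q, so each step must be turned into a statement about matrices acting on sequences.\<close>

lemma (in module) submodule_iff:
  "submodule H R M \<longleftrightarrow> H \<subseteq> carrier M \<and> \<zero>\<^bsub>M\<^esub> \<in> H \<and> (\<forall>x\<in>H. \<forall>y\<in>H. x \<oplus>\<^bsub>M\<^esub> y \<in> H) \<and>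
     (\<forall>a\<in>carrier R. \<forall>x\<in>H. a \<odot>\<^bsub>M\<^esub> x \<in> H)" (is "_ \<longleftrightarrow> ?r")
proof
  assume s: "submodule H R M"
  have "\<zero>\<^bsub>M\<^esub> \<in> H"
    using subgroup.one_closed[OF submodule.axioms(1)[OF s]] by simp
  then show ?r using submoduleE[OF s] by auto
next
  assume r: ?r
  show "submodule H R M"
  proof (rule submoduleI)
    fix a assume "a \<in> H"
    then have "(\<ominus> \<one>) \<odot>\<^bsub>M\<^esub> a \<in> H" "a \<in> carrier M" using r by auto
    then show "\<ominus>\<^bsub>M\<^esub> a \<in> H" by (simp add: smult_l_minus)
  qed (use r in auto)
qed

lemma (in module) submodule_minus:
  assumes "submodule H R M" "x \<in> H" "y \<in> H"
  shows "x \<ominus>\<^bsub>M\<^esub> y \<in> H"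
  using submoduleE[OF assms(1)] assms(2,3) by (auto simp: a_minus_def)

lemma (in module) submodule_inter:
  assumes "submodule A R M" "submodule B R M" shows "submodule (A \<inter> B) R M"
  using assms by (auto simp: submodule_iff)

lemma (in module) submodule_zero: "submodule {\<zero>\<^bsub>M\<^esub>} R M"
  by (auto simp: submodule_iff)

lemma (in module) submodule_finsum:
  assumes "submodule H R M" "finite S" "\<And>i. i \<in> S \<Longrightarrow> f i \<in> H"
  shows "finsum M f S \<in> H"
  using assms(2,3)
proof (induction S)
  case empty
  then show ?case using assms(1) by (simp add: submodule_iff)
next
  case (insert x F)
  have "f \<in> F \<rightarrow> carrier M" "f x \<in> carrier M" using insert.prems assms(1) by (auto simp: submodule_iff)
  then show ?case using insert assms(1) by (simp add: submodule_iff)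
qed

lemma (in module) minus_add_cancel:
  assumes "x \<in> carrier M" "y \<in> carrier M"
  shows "(x \<ominus>\<^bsub>M\<^esub> y) \<oplus>\<^bsub>M\<^esub> y = x"
  using assms by (simp add: a_minus_def M.a_assoc M.l_neg)

lemma (in module) minus_self: "x \<in> carrier M \<Longrightarrow> x \<ominus>\<^bsub>M\<^esub> x = \<zero>\<^bsub>M\<^esub>"
  by (simp add: a_minus_def M.r_neg)

subsection \<open>Linear maps\<close>

locale linear_map = V: module R V + W: module R W
  for R :: "('a, 'b) ring_scheme" (structure) and V :: "('a, 'c) module" (structure)
    and W :: "('a, 'd) module" (structure) +
  fixes T
  assumes map_closed [simp, intro]: "x \<in> carrier V \<Longrightarrow> T x \<in> carrier W"
    and map_add: "x \<in> carrier V \<Longrightarrow> y \<in> carrier V \<Longrightarrow> T (x \<oplus>\<^bsub>V\<^esub> y) = T x \<oplus>\<^bsub>W\<^esub> T y"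
    and map_smult: "a \<in> carrier R \<Longrightarrow> x \<in> carrier V \<Longrightarrow> T (a \<odot>\<^bsub>V\<^esub> x) = a \<odot>\<^bsub>W\<^esub> T x"
begin

lemma map_zero: "T \<zero>\<^bsub>V\<^esub> = \<zero>\<^bsub>W\<^esub>"
  using map_smult[of "\<zero>" "\<zero>\<^bsub>V\<^esub>"] by simp

lemma map_neg: "x \<in> carrier V \<Longrightarrow> T (\<ominus>\<^bsub>V\<^esub> x) = \<ominus>\<^bsub>W\<^esub> T x"
  using map_smult[of "\<ominus> \<one>" x] by (simp add: V.smult_l_minus W.smult_l_minus)

lemma map_minus: "x \<in> carrier V \<Longrightarrow> y \<in> carrier V \<Longrightarrow> T (x \<ominus>\<^bsub>V\<^esub> y) = T x \<ominus>\<^bsub>W\<^esub> T y"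
  by (simp add: a_minus_def map_add map_neg)

lemma map_finsum:
  assumes "finite S" "f \<in> S \<rightarrow> carrier V"
  shows "T (finsum V f S) = finsum W (\<lambda>i. T (f i)) S"
  using assms
proof (induction S)
  case (insert x F)
  have "f \<in> F \<rightarrow> carrier V" "f x \<in> carrier V" "(\<lambda>i. T (f i)) \<in> F \<rightarrow> carrier W" using insert.prems by auto
  then show ?case using insert by (simp add: map_add)
qed (simp add: map_zero)

lemma submodule_image:
  assumes "submodule A R V" shows "submodule (T ` A) R W"
  unfolding W.submodule_iff
proof (intro conjI ballI)
  have A: "A \<subseteq> carrier V" "\<zero>\<^bsub>V\<^esub> \<in> A" using assms by (auto simp: V.submodule_iff)
  show "T ` A \<subseteq> carrier W" using A by auto
  show "\<zero>\<^bsub>W\<^esub> \<in> T ` A" using A(2) map_zero by (metis imageI)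
  show "x \<oplus>\<^bsub>W\<^esub> y \<in> T ` A" if xy: "x \<in> T ` A" "y \<in> T ` A" for x y
  proof -
    obtain u v where "u \<in> A" "v \<in> A" "x = T u" "y = T v" using xy by auto
    moreover from this have "x \<oplus>\<^bsub>W\<^esub> y = T (u \<oplus>\<^bsub>V\<^esub> v)" using A by (subst map_add) auto
    ultimately show ?thesis using assms by (auto simp: V.submodule_iff)
  qed
  show "a \<odot>\<^bsub>W\<^esub> x \<in> T ` A" if ax: "a \<in> carrier R" "x \<in> T ` A" for a x
  proof -
    obtain u where "u \<in> A" "x = T u" using ax by auto
    moreover from this have "a \<odot>\<^bsub>W\<^esub> x = T (a \<odot>\<^bsub>V\<^esub> u)" using A ax by (subst map_smult) auto
    ultimately show ?thesis using assms ax by (auto simp: V.submodule_iff)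
  qed
qed

lemma submodule_preimage:
  assumes "submodule A R V" "submodule C R W" shows "submodule {x \<in> A. T x \<in> C} R V"
  using assms map_zero by (auto simp: V.submodule_iff W.submodule_iff map_add map_smult subset_iff)

lemma submodule_kernel:
  assumes "submodule A R V" shows "submodule {x \<in> A. T x = \<zero>\<^bsub>W\<^esub>} R V"
  using submodule_preimage[OF assms W.submodule_zero] by simp

end

subsection \<open>Length\<close>

text \<open>Chains are taken above a fixed \<open>B\<close>: the length of \<open>m\<^sup>n/m\<^sup>n\<^sup>+\<^sup>1\<close> is needed before \<open>R\<close> is known to have
  finite length, in order to see that the Hilbert coefficients are well defined.\<close>

primrec submodule_chain where
  "submodule_chain R V B 0 A \<longleftrightarrow> submodule A R V \<and> B \<subseteq> A"
| "submodule_chain R V B (Suc n) A \<longleftrightarrow> submodule A R V \<and> (\<exists>A'. submodule_chain R V B n A' \<and> A' \<subset> A)"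

text \<open>The length of A/B as a maximal chain length. The equivalence records at once that chains
  of every length up to n exist, that none is longer and, at k = 0, that A is a submodule containing
  B.\<close>

definition has_length where
  "has_length R V B A n \<longleftrightarrow> (\<forall>k. submodule_chain R V B k A \<longleftrightarrow> k \<le> n)"

lemma submodule_chainD:
  "submodule_chain R V B n A \<Longrightarrow> submodule A R V \<and> B \<subseteq> A"
  by (induction n arbitrary: A) auto

lemma submodule_chain_mono:
  "submodule_chain R V B n A \<Longrightarrow> A \<subseteq> A' \<Longrightarrow> submodule A' R V \<Longrightarrow> submodule_chain R V B n A'"
  by (cases n) (auto, blast)

lemma submodule_chain_SucD:
  "submodule_chain R V B (Suc n) A \<Longrightarrow> submodule_chain R V B n A"
  by (metis psubset_imp_subset submodule_chain.simps(2) submodule_chain_mono)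

lemma submodule_chain_le:
  "submodule_chain R V B n A \<Longrightarrow> k \<le> n \<Longrightarrow> submodule_chain R V B k A"
  by (induction n) (auto simp del: submodule_chain.simps simp: le_Suc_eq dest: submodule_chain_SucD)

lemma has_length_unique:
  "has_length R V B A n \<Longrightarrow> has_length R V B A n' \<Longrightarrow> n = n'"
  unfolding has_length_def by (metis le_antisym order_refl)

lemma has_lengthD:
  assumes "has_length R V B A n" shows "submodule A R V" "B \<subseteq> A" "submodule_chain R V B n A"
  using assms submodule_chainD unfolding has_length_def by blast+

lemma has_length_exists:
  assumes "submodule A R V" "B \<subseteq> A" and bd: "\<And>k. submodule_chain R V B k A \<Longrightarrow> k \<le> n"
  shows "\<exists>p\<le>n. has_length R V B A p"
proof -
  define p where "p = (GREATEST k. submodule_chain R V B k A)"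
  have 0: "submodule_chain R V B 0 A" using assms by simp
  have p: "submodule_chain R V B p A" unfolding p_def
    by (rule GreatestI_nat[of _ 0 n]) (use 0 bd in auto)
  have "k \<le> p" if "submodule_chain R V B k A" for k
    unfolding p_def by (rule Greatest_le_nat[of _ k n]) (use that bd in auto)
  then have "has_length R V B A p"
    using p submodule_chain_le unfolding has_length_def by blast
  with bd[OF p] show ?thesis by blast
qed

lemma has_length_refl:
  assumes "submodule A R V" shows "has_length R V A A 0"
proof -
  have "k = 0" if "submodule_chain R V A k A" for k
    using that submodule_chainD by (cases k) (auto, blast)
  then show ?thesis using assms by (auto simp: has_length_def)
qed

lemma has_length_mono:
  assumes "has_length R V B A n" "submodule A' R V" "A' \<subseteq> A" "B \<subseteq> A'"
  shows "\<exists>p\<le>n. has_length R V B A' p"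
proof (rule has_length_exists[OF assms(2,4)])
  fix k assume "submodule_chain R V B k A'"
  from submodule_chain_mono[OF this assms(3)] show "k \<le> n"
    using assms(1) has_lengthD(1)[OF assms(1)] unfolding has_length_def by blast
qed

lemma has_length_psubset:
  assumes "has_length R V B A n" "has_length R V B A' n'" "A' \<subset> A"
  shows "n' < n"
proof -
  have "submodule_chain R V B (Suc n') A"
    using has_lengthD(1)[OF assms(1)] has_lengthD(3)[OF assms(2)] assms(3) by auto
  then show ?thesis using assms(1) unfolding has_length_def by (metis Suc_le_eq)
qed

context linear_map
begin

text \<open>If A' is properly contained in A, then its kernel part or its image under T shrinks as
  well; so every strict step of a chain is charged to the kernel or to the image.\<close>

lemma submodule_chain_split:
  assumes "submodule_chain R V {\<zero>\<^bsub>V\<^esub>} n A"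
  shows "\<exists>p q. n \<le> p + q \<and> submodule_chain R V {\<zero>\<^bsub>V\<^esub>} p {x \<in> A. T x = \<zero>\<^bsub>W\<^esub>} \<and>
           submodule_chain R W {\<zero>\<^bsub>W\<^esub>} q (T ` A)"
  using assms
proof (induction n arbitrary: A)
  case 0
  then have A: "submodule A R V" by simp
  have "submodule_chain R V {\<zero>\<^bsub>V\<^esub>} 0 {x \<in> A. T x = \<zero>\<^bsub>W\<^esub>}" "submodule_chain R W {\<zero>\<^bsub>W\<^esub>} 0 (T ` A)"
    using submodule_kernel[OF A] submodule_image[OF A] map_zero
    by (auto simp: V.submodule_iff W.submodule_iff)
  then show ?case by blast
next
  case (Suc n)
  then obtain A' where A': "submodule A R V" "submodule_chain R V {\<zero>\<^bsub>V\<^esub>} n A'" "A' \<subset> A" by auto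
  let ?K = "\<lambda>A. {x \<in> A. T x = \<zero>\<^bsub>W\<^esub>}"
  obtain p q where pq: "n \<le> p + q" "submodule_chain R V {\<zero>\<^bsub>V\<^esub>} p (?K A')"
      "submodule_chain R W {\<zero>\<^bsub>W\<^esub>} q (T ` A')" using Suc.IH[OF A'(2)] by blast
  have sK: "submodule (?K A) R V" and sT: "submodule (T ` A) R W"
    using submodule_kernel submodule_image A'(1) by auto
  have K: "?K A' \<subseteq> ?K A" and TT: "T ` A' \<subseteq> T ` A" using A'(3) by auto
  have p': "submodule_chain R V {\<zero>\<^bsub>V\<^esub>} p (?K A)" and q': "submodule_chain R W {\<zero>\<^bsub>W\<^esub>} q (T ` A)"
    using submodule_chain_mono[OF pq(2) K sK] submodule_chain_mono[OF pq(3) TT sT] by auto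
  show ?case
  proof (cases "?K A' = ?K A")
    case False
    then have "submodule_chain R V {\<zero>\<^bsub>V\<^esub>} (Suc p) (?K A)" using pq(2) K sK by auto
    then show ?thesis using q' pq(1) by (metis Suc_le_mono add_Suc)
  next
    case True
    have "T ` A' \<noteq> T ` A"
    proof
      assume eq: "T ` A' = T ` A"
      obtain x where x: "x \<in> A" "x \<notin> A'" using A'(3) by auto
      obtain y where y: "y \<in> A'" "T y = T x" using eq x by (metis imageE imageI)
      have s': "submodule A' R V" using submodule_chainD[OF A'(2)] by simp
      have c: "x \<in> carrier V" "y \<in> carrier V" "y \<in> A"
        using x y A'(1,3) s' by (auto simp: V.submodule_iff)
      \<comment> \<open>Elements with equal images differ by a kernel element, and the kernel parts
        agree, so x would already lie in A'.\<close>
      have "x \<ominus>\<^bsub>V\<^esub> y \<in> ?K A" using x y c V.submodule_minus[OF A'(1)]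
        by (auto simp: map_minus W.minus_self)
      then have "x \<ominus>\<^bsub>V\<^esub> y \<in> A'" using True by auto
      then have "(x \<ominus>\<^bsub>V\<^esub> y) \<oplus>\<^bsub>V\<^esub> y \<in> A'" using y s' by (auto simp: V.submodule_iff)
      then show False using c x V.minus_add_cancel by auto
    qed
    then have "submodule_chain R W {\<zero>\<^bsub>W\<^esub>} (Suc q) (T ` A)" using pq(3) TT sT by auto
    then show ?thesis using p' pq(1) by (metis Suc_le_mono add_Suc_right)
  qed
qed

text \<open>A chain in the image is pulled back along T and stacked on a chain in the kernel; since
  C lies in the image of A, the preimages still increase strictly.\<close>

lemma submodule_chain_join:
  assumes "submodule A R V" "submodule_chain R V {\<zero>\<^bsub>V\<^esub>} p {x \<in> A. T x = \<zero>\<^bsub>W\<^esub>}"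
    and "submodule_chain R W {\<zero>\<^bsub>W\<^esub>} q C" "C \<subseteq> T ` A"
  shows "submodule_chain R V {\<zero>\<^bsub>V\<^esub>} (p + q) {x \<in> A. T x \<in> C}"
  using assms(3,4)
proof (induction q arbitrary: C)
  case 0
  then have "submodule C R W" by simp
  then have "submodule {x \<in> A. T x \<in> C} R V" "{x \<in> A. T x = \<zero>\<^bsub>W\<^esub>} \<subseteq> {x \<in> A. T x \<in> C}"
    using submodule_preimage assms(1) by (auto simp: W.submodule_iff)
  then show ?case using submodule_chain_mono[OF assms(2)] by simp
next
  case (Suc q)
  then obtain C' where C': "submodule C R W" "submodule_chain R W {\<zero>\<^bsub>W\<^esub>} q C'" "C' \<subset> C" by auto
  have "submodule_chain R V {\<zero>\<^bsub>V\<^esub>} (p + q) {x \<in> A. T x \<in> C'}" using Suc.IH[OF C'(2)] C'(3) Suc.prems by auto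
  moreover have "{x \<in> A. T x \<in> C'} \<subset> {x \<in> A. T x \<in> C}" using C'(3) Suc.prems(2) by auto
  moreover have "submodule {x \<in> A. T x \<in> C} R V" using submodule_preimage assms(1) C'(1) by auto
  ultimately show ?case by auto
qed

lemma has_length_exact:
  assumes A: "submodule A R V"
    and p: "has_length R V {\<zero>\<^bsub>V\<^esub>} {x \<in> A. T x = \<zero>\<^bsub>W\<^esub>} p" and q: "has_length R W {\<zero>\<^bsub>W\<^esub>} (T ` A) q"
  shows "has_length R V {\<zero>\<^bsub>V\<^esub>} A (p + q)"
proof -
  have "{x \<in> A. T x \<in> T ` A} = A" by auto
  then have c: "submodule_chain R V {\<zero>\<^bsub>V\<^esub>} (p + q) A"
    using submodule_chain_join[OF A has_lengthD(3)[OF p] has_lengthD(3)[OF q]] by simp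
  have "k \<le> p + q" if k: "submodule_chain R V {\<zero>\<^bsub>V\<^esub>} k A" for k
  proof -
    obtain p' q' where "k \<le> p' + q'" "submodule_chain R V {\<zero>\<^bsub>V\<^esub>} p' {x \<in> A. T x = \<zero>\<^bsub>W\<^esub>}"
      "submodule_chain R W {\<zero>\<^bsub>W\<^esub>} q' (T ` A)" using submodule_chain_split[of k A] k by blast
    then have "p' \<le> p" "q' \<le> q" "k \<le> p' + q'" using p q unfolding has_length_def by auto
    then show ?thesis by linarith
  qed
  then show ?thesis using c submodule_chain_le unfolding has_length_def by blast
qed

text \<open>Finite length passes to both ends: the kernel part is a submodule of A, and a chain in
  the image pulls back to a chain in A. Additivity then splits n.\<close>

lemma has_length_exactE:
  assumes "has_length R V {\<zero>\<^bsub>V\<^esub>} A n"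
  obtains p q where "n = p + q" "has_length R V {\<zero>\<^bsub>V\<^esub>} {x \<in> A. T x = \<zero>\<^bsub>W\<^esub>} p"
    "has_length R W {\<zero>\<^bsub>W\<^esub>} (T ` A) q"
proof -
  have A: "submodule A R V" using has_lengthD[OF assms] by simp
  have sK: "submodule {x \<in> A. T x = \<zero>\<^bsub>W\<^esub>} R V" and sT: "submodule (T ` A) R W"
    using A submodule_kernel submodule_image by auto
  obtain p where p: "has_length R V {\<zero>\<^bsub>V\<^esub>} {x \<in> A. T x = \<zero>\<^bsub>W\<^esub>} p"
    using has_length_mono[OF assms sK] sK by (auto simp: V.submodule_iff)
  have "\<exists>q\<le>n. has_length R W {\<zero>\<^bsub>W\<^esub>} (T ` A) q"
  proof (rule has_length_exists)
    fix k assume k: "submodule_chain R W {\<zero>\<^bsub>W\<^esub>} k (T ` A)"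
    have 0: "submodule_chain R V {\<zero>\<^bsub>V\<^esub>} 0 {x \<in> A. T x = \<zero>\<^bsub>W\<^esub>}"
      using submodule_chain_le[OF has_lengthD(3)[OF p]] by blast
    have "{x \<in> A. T x \<in> T ` A} = A" by auto
    then have "submodule_chain R V {\<zero>\<^bsub>V\<^esub>} k A" using submodule_chain_join[OF A 0 k] by simp
    then show "k \<le> n" using assms unfolding has_length_def by blast
  qed (use sT in \<open>auto simp: W.submodule_iff\<close>)
  then obtain q where q: "has_length R W {\<zero>\<^bsub>W\<^esub>} (T ` A) q" by blast
  show thesis using that[OF has_length_unique[OF assms has_length_exact[OF A p q]] p q] .
qed

end

subsection \<open>The ring as a module\<close>

text \<open>Regards R as a module over itself, so that ideals are submodules and one notion of
  length serves R, its ideals and all modules.\<close>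

definition ring_mod :: "('a, 'b) ring_scheme \<Rightarrow> ('a, 'a) module" where
  "ring_mod R = \<lparr>carrier = carrier R, monoid.mult = monoid.mult R, one = one R, zero = zero R, add = add R, smult = monoid.mult R\<rparr>"

lemma ring_mod_simps [simp]:
  "carrier (ring_mod R) = carrier R" "zero (ring_mod R) = zero R" "add (ring_mod R) = add R"
  "smult (ring_mod R) = monoid.mult R"
  by (auto simp: ring_mod_def)

lemma finsum_ring_mod: "finsum (ring_mod R) f A = finsum R f A"
  by (simp add: finsum_def finprod_def)

lemma a_inv_ring_mod: "a_inv (ring_mod R) x = a_inv R x"
  by (simp add: a_inv_def m_inv_def)

lemma a_minus_ring_mod: "a_minus (ring_mod R) x y = a_minus R x y"
  by (simp add: a_minus_def a_inv_ring_mod)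

lemma (in cring) ring_mod_module: "module R (ring_mod R)"
proof (rule moduleI)
  show "abelian_group (ring_mod R)"
  proof (rule abelian_groupI)
    fix x assume "x \<in> carrier (ring_mod R)"
    then show "\<exists>y\<in>carrier (ring_mod R). y \<oplus>\<^bsub>ring_mod R\<^esub> x = \<zero>\<^bsub>ring_mod R\<^esub>"
      by (intro bexI[of _ "\<ominus> x"]) (auto simp: l_neg)
  qed (auto simp: a_ac)
qed (auto simp: is_cring l_distr r_distr m_assoc)

lemma (in cring) ideal_iff_submodule: "ideal I R \<longleftrightarrow> submodule I R (ring_mod R)"
proof
  assume I: "ideal I R"
  interpret ideal I R by fact
  show "submodule I R (ring_mod R)"
    unfolding module.submodule_iff[OF ring_mod_module] using a_subset by (auto simp: I_l_closed)
next
  assume s: "submodule I R (ring_mod R)"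
  have sub: "I \<subseteq> carrier R" and z: "\<zero> \<in> I"
    and ad: "\<And>x y. x \<in> I \<Longrightarrow> y \<in> I \<Longrightarrow> x \<oplus> y \<in> I" and sm: "\<And>a x. a \<in> carrier R \<Longrightarrow> x \<in> I \<Longrightarrow> a \<otimes> x \<in> I"
    using s unfolding module.submodule_iff[OF ring_mod_module] by auto
  have neg: "\<ominus> x \<in> I" if "x \<in> I" for x
    using sm[of "\<ominus> \<one>" x] that sub by (auto simp: l_minus)
  show "ideal I R"
  proof (rule idealI)
    show "subgroup I (add_monoid R)"
      by (rule add.subgroupI) (use sub z ad neg in \<open>auto simp: a_inv_def\<close>)
    show "a \<otimes> x \<in> I" if "a \<in> I" "x \<in> carrier R" for a x
      using sm[of x a] that sub by (metis m_comm subsetD)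
  qed (use sm ring_axioms in auto)
qed

lemma (in cring) ideal_iff:
  "ideal I R \<longleftrightarrow> I \<subseteq> carrier R \<and> \<zero> \<in> I \<and> (\<forall>x\<in>I. \<forall>y\<in>I. x \<oplus> y \<in> I) \<and> (\<forall>a\<in>carrier R. \<forall>x\<in>I. a \<otimes> x \<in> I)"
  using ideal_iff_submodule module.submodule_iff[OF ring_mod_module] by simp

subsection \<open>Spans modulo an ideal\<close>

text \<open>For an ideal J and a finite T this is the ideal generated by J and T. The coefficient
  form matches \<open>graded_basis\<close>, whose spanning clause becomes an inclusion.\<close>

definition span_mod :: "('a, 'b) ring_scheme \<Rightarrow> 'a set \<Rightarrow> 'a set \<Rightarrow> 'a set" where
  "span_mod R J T = {y \<in> carrier R. \<exists>a \<in> T \<rightarrow> carrier R. y \<ominus>\<^bsub>R\<^esub> finsum R (\<lambda>x. a x \<otimes>\<^bsub>R\<^esub> x) T \<in> J}"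

context cring
begin

lemma finsum_neg_coeff:
  assumes "finite T" "a \<in> T \<rightarrow> carrier R" "T \<subseteq> carrier R"
  shows "finsum R (\<lambda>x. (\<ominus> a x) \<otimes> x) T = \<ominus> finsum R (\<lambda>x. a x \<otimes> x) T"
  using assms
proof (induction T)
  case (insert x F)
  have c: "a \<in> F \<rightarrow> carrier R" "a x \<in> carrier R" "x \<in> carrier R" "F \<subseteq> carrier R" using insert.prems by auto
  have "(\<lambda>x. (\<ominus> a x) \<otimes> x) \<in> F \<rightarrow> carrier R" "(\<lambda>x. a x \<otimes> x) \<in> F \<rightarrow> carrier R" using c by auto
  then show ?case using insert c by (simp add: minus_add l_minus)
qed simp

lemma span_mod_empty: "J \<subseteq> carrier R \<Longrightarrow> span_mod R J {} = J"
  by (auto simp: span_mod_def a_minus_def)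

text \<open>Lets generators be adjoined one at a time, which drives the arguments below: the ideal
  property, the length count and Nakayama's lemma.\<close>

lemma span_mod_insert:
  assumes "finite T" "x \<notin> T" "T \<subseteq> carrier R" "x \<in> carrier R"
  shows "span_mod R J (insert x T) = {y \<in> carrier R. \<exists>r\<in>carrier R. y \<ominus> r \<otimes> x \<in> span_mod R J T}"
proof -
  have sum: "y \<ominus> finsum R (\<lambda>x. a x \<otimes> x) (insert x T) = (y \<ominus> a x \<otimes> x) \<ominus> finsum R (\<lambda>x. a x \<otimes> x) T"
    if "y \<in> carrier R" "a \<in> insert x T \<rightarrow> carrier R" for y a
  proof -
    have c: "(\<lambda>x. a x \<otimes> x) \<in> T \<rightarrow> carrier R" "a x \<in> carrier R" using that assms by auto
    then have "finsum R (\<lambda>x. a x \<otimes> x) T \<in> carrier R" by simp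
    with c show ?thesis using that assms by (simp add: a_minus_def minus_add a_assoc)
  qed
  show ?thesis
  proof (intro equalityI subsetI)
    fix y assume "y \<in> span_mod R J (insert x T)"
    then obtain a where a: "y \<in> carrier R" "a \<in> insert x T \<rightarrow> carrier R"
      "y \<ominus> finsum R (\<lambda>x. a x \<otimes> x) (insert x T) \<in> J" by (auto simp: span_mod_def)
    then have "(y \<ominus> a x \<otimes> x) \<ominus> finsum R (\<lambda>x. a x \<otimes> x) T \<in> J" using sum by simp
    then have "y \<ominus> a x \<otimes> x \<in> span_mod R J T"
      unfolding span_mod_def using a assms by (auto intro!: bexI[of _ a])
    then show "y \<in> {y \<in> carrier R. \<exists>r\<in>carrier R. y \<ominus> r \<otimes> x \<in> span_mod R J T}"
      using a by auto
  next
    fix y assume "y \<in> {y \<in> carrier R. \<exists>r\<in>carrier R. y \<ominus> r \<otimes> x \<in> span_mod R J T}"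
    then obtain r a where r: "y \<in> carrier R" "r \<in> carrier R" "a \<in> T \<rightarrow> carrier R"
      "(y \<ominus> r \<otimes> x) \<ominus> finsum R (\<lambda>x. a x \<otimes> x) T \<in> J" by (auto simp: span_mod_def)
    let ?a = "a(x := r)"
    have a: "?a \<in> insert x T \<rightarrow> carrier R" using r by auto
    have "finsum R (\<lambda>x. ?a x \<otimes> x) T = finsum R (\<lambda>x. a x \<otimes> x) T"
      by (rule finsum_cong') (use assms r in auto)
    then have "y \<ominus> finsum R (\<lambda>x. ?a x \<otimes> x) (insert x T) \<in> J" using sum[OF r(1) a] r(4) by simp
    then show "y \<in> span_mod R J (insert x T)" using a r(1) unfolding span_mod_def by blast
  qed
qed

lemma span_mod_ideal:
  assumes "finite T" "T \<subseteq> carrier R" "ideal J R"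
  shows "ideal (span_mod R J T) R \<and> J \<subseteq> span_mod R J T \<and> T \<subseteq> span_mod R J T"
  using assms(1,2)
proof (induction T)
  case empty
  then show ?case using assms(3) span_mod_empty ideal.Icarr by (metis empty_subsetI subsetI order_refl)
next
  case (insert x T)
  let ?S = "span_mod R J T"
  have S: "ideal ?S R" "J \<subseteq> ?S" "T \<subseteq> ?S" and x: "x \<in> carrier R" using insert by auto
  have eq: "span_mod R J (insert x T) = {y \<in> carrier R. \<exists>r\<in>carrier R. y \<ominus> r \<otimes> x \<in> ?S}"
    using span_mod_insert insert by auto
  note i = S(1)[unfolded ideal_iff]
  have sub: "?S \<subseteq> span_mod R J (insert x T)"
  proof
    fix y assume y: "y \<in> ?S"
    then have "y \<in> carrier R" using i by blast
    then have "y \<ominus> \<zero> \<otimes> x = y" using x by (simp add: a_minus_def)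
    then show "y \<in> span_mod R J (insert x T)" unfolding eq using y \<open>y \<in> carrier R\<close> by (auto intro!: bexI[of _ \<zero>])
  qed
  have "x \<ominus> \<one> \<otimes> x = \<zero>" using x by (simp add: a_minus_def r_neg)
  then have "x \<ominus> \<one> \<otimes> x \<in> ?S" using i by metis
  then have xin: "x \<in> span_mod R J (insert x T)" unfolding eq using x by blast
  have "ideal (span_mod R J (insert x T)) R"
    unfolding ideal_iff
  proof (intro conjI ballI)
    show "span_mod R J (insert x T) \<subseteq> carrier R" unfolding eq by auto
    show "\<zero> \<in> span_mod R J (insert x T)" using sub i by blast
  next
    fix y z assume "y \<in> span_mod R J (insert x T)" "z \<in> span_mod R J (insert x T)"
    then obtain r q where h: "y \<in> carrier R" "z \<in> carrier R" "r \<in> carrier R" "q \<in> carrier R"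
      "y \<ominus> r \<otimes> x \<in> ?S" "z \<ominus> q \<otimes> x \<in> ?S" unfolding eq by blast
    have "(y \<ominus> r \<otimes> x) \<oplus> (z \<ominus> q \<otimes> x) = (y \<oplus> z) \<ominus> (r \<oplus> q) \<otimes> x"
      using h(1-4) x by (simp add: a_minus_def l_distr minus_add a_ac)
    then have "(y \<oplus> z) \<ominus> (r \<oplus> q) \<otimes> x \<in> ?S" using h i by metis
    then show "y \<oplus> z \<in> span_mod R J (insert x T)" unfolding eq using h by auto
  next
    fix a y assume a: "a \<in> carrier R" and "y \<in> span_mod R J (insert x T)"
    then obtain r where h: "y \<in> carrier R" "r \<in> carrier R" "y \<ominus> r \<otimes> x \<in> ?S" unfolding eq by blast
    have "a \<otimes> (y \<ominus> r \<otimes> x) = a \<otimes> y \<ominus> (a \<otimes> r) \<otimes> x"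
      using h(1-2) x a by (simp add: a_minus_def r_distr r_minus m_assoc)
    then have "a \<otimes> y \<ominus> (a \<otimes> r) \<otimes> x \<in> ?S" using h i a by metis
    then show "a \<otimes> y \<in> span_mod R J (insert x T)" unfolding eq using h a by auto
  qed
  then show ?case using sub xin S by blast
qed

lemma span_mod_least:
  assumes "finite T" "T \<subseteq> K" "J \<subseteq> K" "ideal K R"
  shows "span_mod R J T \<subseteq> K"
proof
  fix y assume "y \<in> span_mod R J T"
  then obtain a where a: "y \<in> carrier R" "a \<in> T \<rightarrow> carrier R" "y \<ominus> finsum R (\<lambda>x. a x \<otimes> x) T \<in> J"
    by (auto simp: span_mod_def)
  note K = assms(4)[unfolded ideal_iff_submodule]
  interpret M: module R "ring_mod R" by (rule ring_mod_module)
  let ?s = "finsum R (\<lambda>x. a x \<otimes> x) T"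
  have "a x \<otimes> x \<in> K" if "x \<in> T" for x
    using assms(2) a(2) that assms(4) unfolding ideal_iff by (metis Pi_mem subsetD)
  then have s: "?s \<in> K"
    using M.submodule_finsum[OF K assms(1), of "\<lambda>x. a x \<otimes> x"] unfolding finsum_ring_mod by blast
  have "?s \<in> carrier R" using s K by (auto simp: M.submodule_iff)
  then have "y = (y \<ominus> ?s) \<oplus> ?s" using a(1) by (simp add: a_minus_def a_assoc l_neg)
  moreover have "(y \<ominus> ?s) \<oplus> ?s \<in> K" using a(3) assms(3,4) s unfolding ideal_iff by blast
  ultimately show "y \<in> K" by metis
qed

end

subsection \<open>Local rings\<close>

text \<open>Locality in its working form: what lies outside m is invertible. Finite generation of
  ideals is supplied as a separate hypothesis of the lemmas that call for it.\<close>

locale local_cring = cring R for R (structure) +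
  fixes m
  assumes m_ideal: "ideal m R" and one_notin: "\<one> \<notin> m"
    and unitI: "a \<in> carrier R \<Longrightarrow> a \<notin> m \<Longrightarrow> a \<in> Units R"
begin

lemma m_carrier: "a \<in> m \<Longrightarrow> a \<in> carrier R"
  using m_ideal by (auto simp: ideal_iff)

text \<open>A' consists of multiples of x modulo A, and m x lies in A, so A'/A is simple or zero.
  Intersecting a chain with A therefore loses at most one step: once a member has left A, all larger
  members keep distinct intersections. At k = 0 the truncated \<open>k - 1\<close> is 0.\<close>

lemma simple_step_chain:
  assumes V: "module R V" and A: "submodule A R V" and x: "x \<in> carrier V" and B: "B \<subseteq> A"
    and mx: "\<And>r. r \<in> m \<Longrightarrow> r \<odot>\<^bsub>V\<^esub> x \<in> A"
    and gen: "\<And>y. y \<in> A' \<Longrightarrow> \<exists>r\<in>carrier R. y \<ominus>\<^bsub>V\<^esub> r \<odot>\<^bsub>V\<^esub> x \<in> A"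
    and c: "submodule_chain R V B k C" "C \<subseteq> A'"
  shows "submodule_chain R V B (k - 1) (C \<inter> A)"
  using c
proof (induction k arbitrary: C)
  case 0
  interpret V: module R V by fact
  show ?case using 0 A B V.submodule_inter by auto
next
  case (Suc j)
  interpret V: module R V by fact
  obtain C' where C: "submodule C R V" and C': "submodule_chain R V B j C'" "C' \<subset> C"
    using Suc.prems by auto
  have sC': "submodule C' R V" using submodule_chainD[OF C'(1)] by simp
  have sCA: "submodule (C \<inter> A) R V" using C A V.submodule_inter by auto
  show ?case
  proof (cases "C' \<subseteq> A")
    case True
    then show ?thesis using submodule_chain_mono[OF C'(1) _ sCA] C'(2) by auto
  next
    case False
    then obtain c' where c': "c' \<in> C'" "c' \<notin> A" by auto
    have IH: "submodule_chain R V B (j - 1) (C' \<inter> A)" using Suc.IH[OF C'(1)] C'(2) Suc.prems(2) by auto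
    have "C' \<inter> A \<noteq> C \<inter> A"
    proof
      assume eq: "C' \<inter> A = C \<inter> A"
      have "C \<subseteq> C'"
      proof
        fix c assume c: "c \<in> C"
        obtain r where r: "r \<in> carrier R" "c \<ominus>\<^bsub>V\<^esub> r \<odot>\<^bsub>V\<^esub> x \<in> A" using gen c Suc.prems(2) by blast
        obtain u where u: "u \<in> carrier R" "c' \<ominus>\<^bsub>V\<^esub> u \<odot>\<^bsub>V\<^esub> x \<in> A" using gen c' C'(2) Suc.prems(2) by blast
        have car: "c \<in> carrier V" "c' \<in> carrier V" using c c' C sC' by (auto simp: V.submodule_iff)
        \<comment> \<open>If u were in m, then u x and with it c' would lie in A. So u is a unit,
          and v = r / u below is the factor for which v c' cancels the x-part of c.\<close>
        have "u \<notin> m"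
        proof
          assume "u \<in> m"
          then have "(c' \<ominus>\<^bsub>V\<^esub> u \<odot>\<^bsub>V\<^esub> x) \<oplus>\<^bsub>V\<^esub> u \<odot>\<^bsub>V\<^esub> x \<in> A" using mx u A by (auto simp: V.submodule_iff)
          then show False using c' car u x V.minus_add_cancel by auto
        qed
        then have U: "u \<in> Units R" using unitI u by auto
        define v where "v = r \<otimes> inv u"
        have v: "v \<in> carrier R" "v \<otimes> u = r" using U u r by (auto simp: v_def m_assoc)
        have "v \<odot>\<^bsub>V\<^esub> (c' \<ominus>\<^bsub>V\<^esub> u \<odot>\<^bsub>V\<^esub> x) = v \<odot>\<^bsub>V\<^esub> c' \<ominus>\<^bsub>V\<^esub> r \<odot>\<^bsub>V\<^esub> x"
          using v u car x by (simp add: a_minus_def V.smult_r_distr V.smult_r_minus V.smult_assoc1[symmetric])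
        moreover have "v \<odot>\<^bsub>V\<^esub> (c' \<ominus>\<^bsub>V\<^esub> u \<odot>\<^bsub>V\<^esub> x) \<in> A" using u v A by (auto simp: V.submodule_iff)
        ultimately have "(c \<ominus>\<^bsub>V\<^esub> r \<odot>\<^bsub>V\<^esub> x) \<ominus>\<^bsub>V\<^esub> (v \<odot>\<^bsub>V\<^esub> c' \<ominus>\<^bsub>V\<^esub> r \<odot>\<^bsub>V\<^esub> x) \<in> A"
          using V.submodule_minus[OF A r(2)] by simp
        moreover have "(c \<ominus>\<^bsub>V\<^esub> r \<odot>\<^bsub>V\<^esub> x) \<ominus>\<^bsub>V\<^esub> (v \<odot>\<^bsub>V\<^esub> c' \<ominus>\<^bsub>V\<^esub> r \<odot>\<^bsub>V\<^esub> x) = c \<ominus>\<^bsub>V\<^esub> v \<odot>\<^bsub>V\<^esub> c'"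
          using v r car x by (simp add: a_minus_def V.minus_add V.a_ac V.r_neg1 V.r_neg2)
        ultimately have "c \<ominus>\<^bsub>V\<^esub> v \<odot>\<^bsub>V\<^esub> c' \<in> A" by simp
        moreover have vc': "v \<odot>\<^bsub>V\<^esub> c' \<in> C'" using v c' sC' by (auto simp: V.submodule_iff)
        moreover have "c \<ominus>\<^bsub>V\<^esub> v \<odot>\<^bsub>V\<^esub> c' \<in> C" using V.submodule_minus[OF C c] vc' C'(2) by auto
        ultimately have "c \<ominus>\<^bsub>V\<^esub> v \<odot>\<^bsub>V\<^esub> c' \<in> C'" using eq by auto
        then have "(c \<ominus>\<^bsub>V\<^esub> v \<odot>\<^bsub>V\<^esub> c') \<oplus>\<^bsub>V\<^esub> v \<odot>\<^bsub>V\<^esub> c' \<in> C'" using vc' sC' by (auto simp: V.submodule_iff)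
        then show "c \<in> C'" using car v V.minus_add_cancel by auto
      qed
      then show False using C'(2) by auto
    qed
    then have "C' \<inter> A \<subset> C \<inter> A" using C'(2) by auto
    then have "submodule_chain R V B (Suc (j - 1)) (C \<inter> A)" using IH sCA by auto
    then show ?thesis by (rule submodule_chain_le) simp
  qed
qed

text \<open>The quotient A'/A is a copy of the residue field: x generates it, m kills it, and x is
  not in A.\<close>

lemma has_length_simple_step:
  assumes V: "module R V" and n: "has_length R V B A n" and x: "x \<in> A'" "x \<notin> A"
    and A': "submodule A' R V" "A \<subseteq> A'"
    and mx: "\<And>r. r \<in> m \<Longrightarrow> r \<odot>\<^bsub>V\<^esub> x \<in> A"
    and gen: "\<And>y. y \<in> A' \<Longrightarrow> \<exists>r\<in>carrier R. y \<ominus>\<^bsub>V\<^esub> r \<odot>\<^bsub>V\<^esub> x \<in> A"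
  shows "has_length R V B A' (Suc n)"
proof -
  interpret V: module R V by fact
  have A: "submodule A R V" "B \<subseteq> A" using has_lengthD[OF n] by auto
  have "submodule_chain R V B (Suc n) A'" using has_lengthD(3)[OF n] A' x by auto
  moreover have "k \<le> Suc n" if "submodule_chain R V B k A'" for k
  proof -
    have "submodule_chain R V B (k - 1) (A' \<inter> A)"
      by (rule simple_step_chain[OF V A(1) _ A(2) mx gen that]) (use x A' in \<open>auto simp: V.submodule_iff\<close>)
    moreover have "A' \<inter> A = A" using A' by auto
    ultimately show ?thesis using n unfolding has_length_def by auto
  qed
  ultimately show ?thesis using submodule_chain_le unfolding has_length_def by blast
qed


text \<open>The members of S are adjoined to J one by one. Each step has a simple quotient: m x lies
  in J because mI does, and independence keeps x out of the ideal reached so far.\<close>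

lemma has_length_graded_basis:
  assumes J: "ideal J R" and I: "ideal I R" and S: "finite S" "S \<subseteq> I"
    and JI: "J \<subseteq> I" and mI: "\<And>r x. r \<in> m \<Longrightarrow> x \<in> I \<Longrightarrow> r \<otimes> x \<in> J"
    and indep: "\<And>a. a \<in> S \<rightarrow> carrier R \<Longrightarrow> finsum R (\<lambda>x. a x \<otimes> x) S \<in> J \<Longrightarrow> \<forall>x\<in>S. a x \<in> m"
    and span: "I \<subseteq> span_mod R J S"
    and len: "has_length R (ring_mod R) B J n"
  shows "has_length R (ring_mod R) B I (n + card S)"
proof -
  have Sc: "S \<subseteq> carrier R" using S(2) I by (auto simp: ideal_iff)
  have "has_length R (ring_mod R) B (span_mod R J T) (n + card T)" if "T \<subseteq> S" for T
    using finite_subset[OF that S(1)] that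
  proof (induction T)
    case empty
    then show ?case using len J span_mod_empty by (simp add: ideal_iff)
  next
    case (insert x T)
    let ?S = "span_mod R J T"
    have c: "T \<subseteq> carrier R" "x \<in> carrier R" "x \<in> S" "T \<subseteq> S" using insert.prems Sc by auto
    note e = span_mod_insert[OF insert.hyps(1,2) c(1,2), of J]
    have i: "ideal ?S R" "J \<subseteq> ?S" "T \<subseteq> ?S" using span_mod_ideal[OF insert.hyps(1) c(1) J] by auto
    have i': "ideal (span_mod R J (insert x T)) R" "J \<subseteq> span_mod R J (insert x T)" "insert x T \<subseteq> span_mod R J (insert x T)"
      using span_mod_ideal[of "insert x T" J] insert.hyps(1) c J by auto
    have "has_length R (ring_mod R) B (span_mod R J (insert x T)) (Suc (n + card T))"
    proof (rule has_length_simple_step[OF ring_mod_module])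
      show "has_length R (ring_mod R) B ?S (n + card T)" using insert.IH c by auto
      show "x \<in> span_mod R J (insert x T)" using i' by auto
      show "submodule (span_mod R J (insert x T)) R (ring_mod R)" using i' ideal_iff_submodule by auto
      show "?S \<subseteq> span_mod R J (insert x T)"
        by (rule span_mod_least) (use i' insert.hyps in auto)
      show "r \<odot>\<^bsub>ring_mod R\<^esub> x \<in> ?S" if "r \<in> m" for r
        using mI[OF that, of x] S(2) c i by auto
      show "\<exists>r\<in>carrier R. y \<ominus>\<^bsub>ring_mod R\<^esub> r \<odot>\<^bsub>ring_mod R\<^esub> x \<in> ?S" if "y \<in> span_mod R J (insert x T)" for y
        using that unfolding e by (auto simp: a_minus_ring_mod)
      show "x \<notin> ?S"
      proof
        assume "x \<in> ?S"
        then obtain a where a: "a \<in> T \<rightarrow> carrier R" "x \<ominus> finsum R (\<lambda>x. a x \<otimes> x) T \<in> J"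
          by (auto simp: span_mod_def)
        \<comment> \<open>A relation expressing x through T modulo J becomes a relation on all of S
          with coefficient \<one> at x; independence would put \<one> into m.\<close>
        define b where "b y = (if y = x then \<one> else if y \<in> T then \<ominus> a y else \<zero>)" for y
        have aT: "\<ominus> a y \<in> carrier R" if "y \<in> T" for y using a(1) that by auto
        then have b: "b \<in> S \<rightarrow> carrier R" by (auto simp: b_def)
        then have b': "(\<lambda>y. b y \<otimes> y) \<in> S \<rightarrow> carrier R" using Sc by auto
        have "finsum R (\<lambda>y. b y \<otimes> y) S = finsum R (\<lambda>y. b y \<otimes> y) (insert x T)"
          by (rule add.finprod_mono_neutral_cong_right) (use S(1) c b' Sc in \<open>auto simp: b_def\<close>)
        also have "\<dots> = b x \<otimes> x \<oplus> finsum R (\<lambda>y. b y \<otimes> y) T"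
          by (rule finsum_insert) (use insert.hyps c b in auto)
        also have "finsum R (\<lambda>y. b y \<otimes> y) T = finsum R (\<lambda>y. (\<ominus> a y) \<otimes> y) T"
          by (rule finsum_cong') (use insert.hyps c aT in \<open>auto simp: b_def\<close>)
        also have "\<dots> = \<ominus> finsum R (\<lambda>y. a y \<otimes> y) T"
          by (rule finsum_neg_coeff) (use insert.hyps c a in auto)
        also have "b x \<otimes> x = x" using c by (simp add: b_def)
        finally have "finsum R (\<lambda>y. b y \<otimes> y) S \<in> J" using a(2) by (simp add: a_minus_def)
        then have "b x \<in> m" using indep[OF b] c by blast
        then show False using one_notin by (simp add: b_def)
      qed
    qed
    then show ?case using insert.hyps by simp
  qed
  moreover have "span_mod R J S = I" using span span_mod_least[OF S JI I] by auto
  ultimately show ?thesis by (metis order_refl)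
qed

text \<open>A spanning set of least size is independent: a coefficient outside m is a unit and would
  make its generator redundant. Leastness is part of the conclusion because Nakayama's lemma uses
  it.\<close>

lemma basis_exists:
  assumes J: "ideal J R" and I: "ideal I R" and JI: "J \<subseteq> I"
    and A: "finite A" "I = Idl A" "A \<subseteq> carrier R"
  obtains S where "finite S" "S \<subseteq> I" "I \<subseteq> span_mod R J S"
    "\<And>a. a \<in> S \<rightarrow> carrier R \<Longrightarrow> finsum R (\<lambda>x. a x \<otimes> x) S \<in> J \<Longrightarrow> \<forall>x\<in>S. a x \<in> m"
    "\<And>T. finite T \<Longrightarrow> T \<subseteq> I \<Longrightarrow> I \<subseteq> span_mod R J T \<Longrightarrow> card S \<le> card T"
proof -
  let ?P = "\<lambda>S. finite S \<and> S \<subseteq> I \<and> I \<subseteq> span_mod R J S"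
  have "I \<subseteq> span_mod R J A" unfolding A(2)
    by (rule genideal_minimal) (use span_mod_ideal[OF A(1,3) J] in auto)
  then have "?P A" using A genideal_self by auto
  then obtain S where S: "?P S" and min: "\<And>T. ?P T \<Longrightarrow> card S \<le> card T"
    using ex_has_least_nat[of ?P A card] by auto
  have Sc: "S \<subseteq> carrier R" using S I by (auto simp: ideal_iff)
  have "a x \<in> m" if a: "a \<in> S \<rightarrow> carrier R" "finsum R (\<lambda>x. a x \<otimes> x) S \<in> J" and x: "x \<in> S" for a x
  proof (rule ccontr)
    assume "a x \<notin> m"
    then have U: "a x \<in> Units R" using unitI a x by auto
    define T where "T = S - {x}"
    have T: "S = insert x T" "x \<notin> T" "finite T" "T \<subseteq> carrier R" "x \<in> carrier R" "T \<subseteq> S"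
      using x S Sc by (auto simp: T_def)
    have i: "ideal (span_mod R J T) R" "J \<subseteq> span_mod R J T" "T \<subseteq> span_mod R J T"
      using span_mod_ideal T J by auto
    have ax: "a x \<in> carrier R" "a \<in> T \<rightarrow> carrier R" using a T by auto
    have fs: "finsum R (\<lambda>x. a x \<otimes> x) S = a x \<otimes> x \<oplus> finsum R (\<lambda>x. a x \<otimes> x) T"
      unfolding T(1) by (rule finsum_insert) (use T a ax in auto)
    have n: "finsum R (\<lambda>x. (\<ominus> a x) \<otimes> x) T = \<ominus> finsum R (\<lambda>x. a x \<otimes> x) T"
      by (rule finsum_neg_coeff) (use T ax in auto)
    have "finsum R (\<lambda>x. a x \<otimes> x) T \<in> carrier R" by (rule finsum_closed) (use T ax in auto)
    then have "a x \<otimes> x \<ominus> finsum R (\<lambda>x. (\<ominus> a x) \<otimes> x) T \<in> J"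
      using fs a(2) unfolding n by (simp add: a_minus_def)
    then have "a x \<otimes> x \<in> span_mod R J T" unfolding span_mod_def using ax T by (auto intro!: bexI[of _ "\<lambda>x. \<ominus> a x"])
    then have "inv (a x) \<otimes> (a x \<otimes> x) \<in> span_mod R J T" using i(1) U by (auto simp: ideal_iff)
    then have "x \<in> span_mod R J T" using U T ax by (simp add: m_assoc[symmetric])
    then have "S \<subseteq> span_mod R J T" using i T by auto
    then have "span_mod R J S \<subseteq> span_mod R J T" using span_mod_least[of S "span_mod R J T" J] i S by auto
    then have "?P T" using S T by auto
    then have "card S \<le> card T" using min by blast
    then show False using T by simp
  qed
  then show thesis using that[of S] S min by blast
qed

text \<open>A member x of a least generating set lies in mI, so it equals u x modulo the other
  generators for some u in m. As 1 - u is a unit, x would be redundant; hence the generating set is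
  empty.\<close>

lemma nakayama:
  assumes I: "ideal I R" and A: "finite A" "I = Idl A" "A \<subseteq> carrier R" and mI: "I \<subseteq> ideal_prod R m I"
  shows "I = {\<zero>}"
proof -
  have Z: "ideal {\<zero>} R" by (rule zeroideal)
  have "{\<zero>} \<subseteq> I" using I by (auto simp: ideal_iff)
  from basis_exists[OF Z I this A]
  obtain S where S: "finite S" "S \<subseteq> I" "I \<subseteq> span_mod R {\<zero>} S"
    and min: "\<And>T. finite T \<Longrightarrow> T \<subseteq> I \<Longrightarrow> I \<subseteq> span_mod R {\<zero>} T \<Longrightarrow> card S \<le> card T"
    by metis
  have "S = {}"
  proof (rule ccontr)
    assume "S \<noteq> {}"
    then obtain x T where T: "S = insert x T" "x \<notin> T" by (metis all_not_in_conv mk_disjoint_insert)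
    have Sc: "S \<subseteq> carrier R" using S I by (auto simp: ideal_iff)
    have c: "finite T" "T \<subseteq> carrier R" "x \<in> carrier R" "T \<subseteq> I" "x \<in> I" using S T Sc by auto
    let ?S = "span_mod R {\<zero>} T"
    have i: "ideal ?S R" "{\<zero>} \<subseteq> ?S" "T \<subseteq> ?S" using span_mod_ideal c Z by auto
    note e = span_mod_insert[OF c(1) T(2) c(2,3), of "{\<zero>}"]
    \<comment> \<open>Modulo the span of T, every element of mI is a multiple of x with coefficient
      in m; this is applied to x itself.\<close>
    have "\<exists>u\<in>m. y \<ominus> u \<otimes> x \<in> ?S \<and> y \<in> carrier R" if "y \<in> ideal_prod R m I" for y
      using that
    proof (induction y)
      case (prod u y)
      then have "y \<in> span_mod R {\<zero>} (insert x T)" using S T by auto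
      then obtain r where r: "r \<in> carrier R" "y \<ominus> r \<otimes> x \<in> ?S" "y \<in> carrier R" unfolding e by auto
      have u: "u \<in> carrier R" "u \<otimes> r \<in> m" using prod m_carrier m_ideal r
        by (auto intro: ideal.I_r_closed)
      have "u \<otimes> (y \<ominus> r \<otimes> x) \<in> ?S" using i(1) u r by (auto simp: ideal_iff)
      moreover have "u \<otimes> (y \<ominus> r \<otimes> x) = u \<otimes> y \<ominus> (u \<otimes> r) \<otimes> x"
        using u r c by (simp add: a_minus_def r_distr r_minus m_assoc)
      ultimately show ?case using u r by auto
    next
      case (sum y z)
      then obtain u v where h: "y \<in> carrier R" "z \<in> carrier R" "u \<in> m" "v \<in> m"
        "y \<ominus> u \<otimes> x \<in> ?S" "z \<ominus> v \<otimes> x \<in> ?S" by blast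
      have uv: "u \<in> carrier R" "v \<in> carrier R" "u \<oplus> v \<in> m" using h m_carrier m_ideal by (auto simp: ideal_iff)
      have "(y \<ominus> u \<otimes> x) \<oplus> (z \<ominus> v \<otimes> x) = (y \<oplus> z) \<ominus> (u \<oplus> v) \<otimes> x"
        using h(1-2) uv c(3) by (simp add: a_minus_def l_distr minus_add a_ac)
      then have "(y \<oplus> z) \<ominus> (u \<oplus> v) \<otimes> x \<in> ?S" using h i(1) unfolding ideal_iff by metis
      then show ?case using uv h by auto
    qed
    then obtain u where u: "u \<in> m" "x \<ominus> u \<otimes> x \<in> ?S" using mI c by blast
    have uc: "u \<in> carrier R" using u m_carrier by auto
    have "\<one> \<ominus> u \<notin> m"
    proof
      assume "\<one> \<ominus> u \<in> m"
      then have "(\<one> \<ominus> u) \<oplus> u \<in> m" using u m_ideal by (auto simp: ideal_iff)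
      then show False using uc one_notin by (simp add: a_minus_def a_assoc l_neg)
    qed
    then have U: "\<one> \<ominus> u \<in> Units R" using unitI uc by auto
    have "x \<ominus> u \<otimes> x = (\<one> \<ominus> u) \<otimes> x" using uc c by (simp add: a_minus_def l_distr l_minus)
    then have "inv (\<one> \<ominus> u) \<otimes> ((\<one> \<ominus> u) \<otimes> x) \<in> ?S" using u U i(1) by (auto simp: ideal_iff)
    then have "x \<in> ?S" using U uc c by (simp add: m_assoc[symmetric])
    then have "span_mod R {\<zero>} S \<subseteq> ?S" using span_mod_least[of S ?S "{\<zero>}"] i S T by auto
    then have "card S \<le> card T" using min[of T] c S by auto
    then show False using T c by simp
  qed
  then have "I \<subseteq> {\<zero>}" using S(3) span_mod_empty by auto
  then show ?thesis using I by (auto simp: ideal_iff)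
qed

end


section \<open>Hilbert coefficients and the lengths of the powers of the maximal ideal\<close>

context
  fixes R :: "('a, 'b) ring_scheme" (structure)
  assumes loc: "local_ring R"
begin

interpretation cring R using loc by (simp add: local_ring_def)

interpretation noetherian_ring R using loc by (simp add: local_ring_def)

lemma max_ideal_maximal: "maximalideal (max_ideal R) R"
  unfolding max_ideal_def by (rule theI') (use loc in \<open>simp add: local_ring_def\<close>)

lemma max_ideal_unique: "maximalideal I R \<Longrightarrow> I = max_ideal R"
  using loc max_ideal_maximal unfolding local_ring_def by blast

text \<open>A maximal member among the proper ideals containing \<open>a\<close> is a maximal ideal,
  hence the only one. Zorn's lemma applies because in a Noetherian ring the union of a chain of
  ideals belongs to the chain.\<close>

lemma nonunit_in_max_ideal:
  assumes a: "a \<in> carrier R" "a \<notin> Units R" shows "a \<in> max_ideal R"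
proof -
  let ?S = "{I. ideal I R \<and> a \<in> I \<and> \<one> \<notin> I}"
  have "\<exists>M\<in>?S. \<forall>X\<in>?S. M \<subseteq> X \<longrightarrow> X = M"
  proof (rule subset_Zorn_nonempty)
    have "\<one> \<notin> PIdl a"
    proof
      assume "\<one> \<in> PIdl a"
      then obtain r where "r \<in> carrier R" "\<one> = r \<otimes> a" by (auto simp: cgenideal_def)
      then have "a \<in> Units R" using a by (metis Units_one_closed m_comm unit_factor)
      then show False using a by simp
    qed
    then have "PIdl a \<in> ?S" using cgenideal_ideal cgenideal_self a by auto
    then show "?S \<noteq> {}" by blast
  next
    fix C assume C: "C \<noteq> {}" "subset.chain ?S C"
    then have "subset.chain {I. ideal I R} C" unfolding subset_chain_def by auto
    then have "\<Union>C \<in> C" using ideal_chain_is_trivial C by auto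
    then show "\<Union>C \<in> ?S" using C(2) unfolding subset_chain_def by blast
  qed
  then obtain M where M: "ideal M R" "a \<in> M" "\<one> \<notin> M"
    and mx: "\<And>X. ideal X R \<Longrightarrow> a \<in> X \<Longrightarrow> \<one> \<notin> X \<Longrightarrow> M \<subseteq> X \<Longrightarrow> X = M" by blast
  have "maximalideal M R"
  proof (rule maximalidealI)
    show "ideal M R" by fact
    show "carrier R \<noteq> M" using M(3) by auto
    show "J = M \<or> J = carrier R" if "ideal J R" "M \<subseteq> J" "J \<subseteq> carrier R" for J
      using mx[OF that(1)] that M(2) ideal.one_imp_carrier[OF that(1)] by blast
  qed
  then show ?thesis using max_ideal_unique M by auto
qed

lemma local_cring_max_ideal: "local_cring R (max_ideal R)"
proof (intro local_cring.intro local_cring_axioms.intro is_cring)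
  interpret M: maximalideal "max_ideal R" R by (rule max_ideal_maximal)
  show "ideal (max_ideal R) R" by (rule M.is_ideal)
  show "\<one> \<notin> max_ideal R" using M.one_imp_carrier M.I_notcarr by auto
  show "a \<in> Units R" if "a \<in> carrier R" "a \<notin> max_ideal R" for a
    using nonunit_in_max_ideal that by blast
qed

interpretation local_cring R "max_ideal R" by (rule local_cring_max_ideal)

lemma ideal_pow_ideal: "ideal (ideal_pow R (max_ideal R) n) R"
  by (induction n) (auto simp: oneideal ideal_prod_is_ideal m_ideal)

lemma ideal_pow_Suc_subset: "ideal_pow R (max_ideal R) (Suc n) \<subseteq> ideal_pow R (max_ideal R) n"
  using ideal_prod_inter[OF m_ideal ideal_pow_ideal] by auto

lemma graded_basis_iff:
  "graded_basis R n S \<longleftrightarrow> finite S \<and> S \<subseteq> ideal_pow R (max_ideal R) n \<and>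
     (\<forall>a \<in> S \<rightarrow> carrier R. finsum R (\<lambda>x. a x \<otimes> x) S \<in> ideal_pow R (max_ideal R) (Suc n) \<longrightarrow> (\<forall>x\<in>S. a x \<in> max_ideal R)) \<and>
     ideal_pow R (max_ideal R) n \<subseteq> span_mod R (ideal_pow R (max_ideal R) (Suc n)) S"
proof -
  have "y \<in> carrier R" if "y \<in> ideal_pow R (max_ideal R) n" for y
    using ideal_pow_ideal[of n] that by (auto simp: ideal_iff)
  then show ?thesis
    unfolding graded_basis_def Let_def span_mod_def by blast
qed

lemma graded_basis_length:
  assumes "graded_basis R n S" "has_length R (ring_mod R) B (ideal_pow R (max_ideal R) (Suc n)) p"
  shows "has_length R (ring_mod R) B (ideal_pow R (max_ideal R) n) (p + card S)"
  by (rule has_length_graded_basis[OF ideal_pow_ideal ideal_pow_ideal _ _ ideal_pow_Suc_subset _ _ _ assms(2)])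
    (use assms(1) in \<open>auto simp: graded_basis_iff intro: ideal_prod.prod\<close>)

text \<open>\<open>hilbert_coeff\<close> is a definite description, so the size of a graded basis
  has to be shown unique: it is the length of m^n above m^(n+1), an invariant that does not mention
  the basis.\<close>

lemma graded_basis_hilbert_coeff: "\<exists>S. graded_basis R n S \<and> card S = hilbert_coeff R n"
proof -
  let ?I = "ideal_pow R (max_ideal R) n" and ?J = "ideal_pow R (max_ideal R) (Suc n)"
  obtain A where A: "A \<subseteq> carrier R" "finite A" "?I = Idl A" using finetely_gen[OF ideal_pow_ideal] by blast
  obtain S where "finite S" "S \<subseteq> ?I" "?I \<subseteq> span_mod R ?J S"
    "\<And>a. a \<in> S \<rightarrow> carrier R \<Longrightarrow> finsum R (\<lambda>x. a x \<otimes> x) S \<in> ?J \<Longrightarrow> \<forall>x\<in>S. a x \<in> max_ideal R"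
    by (rule basis_exists[OF ideal_pow_ideal ideal_pow_ideal ideal_pow_Suc_subset A(2,3,1)]) (rule that)
  then have S: "graded_basis R n S" unfolding graded_basis_iff by blast
  have uniq: "card S' = card S" if "graded_basis R n S'" for S'
  proof -
    have "has_length R (ring_mod R) ?J ?J 0"
      by (rule has_length_refl) (use ideal_pow_ideal[of "Suc n"] in \<open>simp add: ideal_iff_submodule del: ideal_pow.simps\<close>)
    then show ?thesis
      using graded_basis_length[OF S] graded_basis_length[OF that] has_length_unique by (metis add_0)
  qed
  have "hilbert_coeff R n = card S"
    unfolding hilbert_coeff_def
  proof (rule the_equality)
    show "\<exists>S'. graded_basis R n S' \<and> card S' = card S" using S by blast
    show "r = card S" if "\<exists>S. graded_basis R n S \<and> card S = r" for r using uniq that by blast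
  qed
  then show ?thesis using S by auto
qed

lemma hilbert_length:
  assumes "has_length R (ring_mod R) B (ideal_pow R (max_ideal R) (Suc n)) p"
  shows "has_length R (ring_mod R) B (ideal_pow R (max_ideal R) n) (p + hilbert_coeff R n)"
proof -
  obtain S where "graded_basis R n S" "card S = hilbert_coeff R n" using graded_basis_hilbert_coeff by blast
  then show ?thesis using graded_basis_length[OF _ assms] by metis
qed

text \<open>An empty basis means m^n = m^(n+1), and Nakayama's lemma applies to m^n.\<close>

lemma ideal_pow_eq_zero:
  assumes "hilbert_coeff R n = 0" shows "ideal_pow R (max_ideal R) n = {\<zero>}"
proof -
  obtain S where S: "graded_basis R n S" "card S = 0" using graded_basis_hilbert_coeff[of n] assms by auto
  then have "S = {}" by (simp add: graded_basis_iff)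
  then have sub: "ideal_pow R (max_ideal R) n \<subseteq> ideal_pow R (max_ideal R) (Suc n)"
    using S(1) ideal_pow_ideal[of "Suc n"] span_mod_empty unfolding graded_basis_iff by (metis ideal_iff)
  obtain A where A: "A \<subseteq> carrier R" "finite A" "ideal_pow R (max_ideal R) n = Idl A"
    using finetely_gen[OF ideal_pow_ideal] by blast
  show ?thesis by (rule nakayama[OF ideal_pow_ideal A(2,3,1)]) (use sub in simp)
qed

text \<open>The coefficient of z^3 vanishes, so m^3 = 0. Climbing from there through m^2 and m to R
  adds the coefficients s, e and 1 to the length.\<close>

lemma ring_length:
  assumes "hilbert_series R = 1 + of_nat e * fps_X + of_nat s * fps_X ^ 2"
  shows "has_length R (ring_mod R) {\<zero>} (ideal_prod R (max_ideal R) (max_ideal R)) s"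
    "has_length R (ring_mod R) {\<zero>} (max_ideal R) (s + e)"
    "has_length R (ring_mod R) {\<zero>} (carrier R) (s + e + 1)"
    "x \<in> max_ideal R \<Longrightarrow> y \<in> max_ideal R \<Longrightarrow> z \<in> max_ideal R \<Longrightarrow> x \<otimes> (y \<otimes> z) = \<zero>"
proof -
  have "int (hilbert_coeff R n) = fps_nth (1 + of_nat e * fps_X + of_nat s * fps_X ^ 2) n" for n
    unfolding assms[symmetric] by (simp add: hilbert_series_def)
  then have h: "int (hilbert_coeff R n) = (if n = 0 then 1 else if n = 1 then int e else if n = 2 then int s else 0)" for n
    by (simp add: fps_of_nat[symmetric] fps_X_power_iff del: fps_of_nat)
  have h0: "hilbert_coeff R 0 = 1" "hilbert_coeff R 1 = e" "hilbert_coeff R 2 = s" "hilbert_coeff R 3 = 0"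
    using h[of 0] h[of 1] h[of 2] h[of 3] by auto
  let ?P = "ideal_pow R (max_ideal R)"
  have p1: "?P 1 = max_ideal R"
  proof
    show "?P 1 \<subseteq> max_ideal R" using ideal_prod_inter[OF m_ideal oneideal] by simp
    show "max_ideal R \<subseteq> ?P 1"
    proof
      fix x assume x: "x \<in> max_ideal R"
      then have "x \<otimes> \<one> \<in> ideal_prod R (max_ideal R) (carrier R)" by (intro ideal_prod.prod) auto
      then show "x \<in> ?P 1" using m_carrier x by simp
    qed
  qed
  have p2: "?P 2 = ideal_prod R (max_ideal R) (max_ideal R)"
    using p1 by (simp add: numeral_2_eq_2)
  have p3: "?P 3 = {\<zero>}" using ideal_pow_eq_zero h0 by simp
  have "has_length R (ring_mod R) {\<zero>} (?P 3) 0"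
    unfolding p3 by (rule has_length_refl) (use zeroideal ideal_iff_submodule in blast)
  then have l2: "has_length R (ring_mod R) {\<zero>} (?P 2) s"
    using hilbert_length[of "{\<zero>}" 2 0] h0 by (simp add: numeral_3_eq_3 numeral_2_eq_2)
  then show "has_length R (ring_mod R) {\<zero>} (ideal_prod R (max_ideal R) (max_ideal R)) s" using p2 by simp
  have l1: "has_length R (ring_mod R) {\<zero>} (?P 1) (s + e)"
    using hilbert_length[of "{\<zero>}" 1 s] l2 h0 by (simp add: numeral_2_eq_2)
  then show "has_length R (ring_mod R) {\<zero>} (max_ideal R) (s + e)" using p1 by simp
  show "has_length R (ring_mod R) {\<zero>} (carrier R) (s + e + 1)"
    using hilbert_length[of "{\<zero>}" 0 "s + e"] l1 h0 by simp
  assume x: "x \<in> max_ideal R" "y \<in> max_ideal R" "z \<in> max_ideal R"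
  have "y \<otimes> z \<in> ?P 2" unfolding p2 by (rule ideal_prod.prod) (use x in auto)
  then have "x \<otimes> (y \<otimes> z) \<in> ?P 3" unfolding numeral_3_eq_3 numeral_2_eq_2 
    by (subst ideal_pow.simps(2), intro ideal_prod.prod) (use x in auto)
  then show "x \<otimes> (y \<otimes> z) = \<zero>" using p3 by simp
qed

end

subsection \<open>Modules of sequences\<close>

text \<open>The fields \<open>mult\<close> and \<open>one\<close> carry no meaning.\<close>

definition fun_mod :: "('a, 'c) module \<Rightarrow> ('a, nat \<Rightarrow> 'c) module" where
  "fun_mod M = \<lparr>carrier = {f. \<forall>i. f i \<in> carrier M}, monoid.mult = \<lambda>f g. f, one = \<lambda>_. \<zero>\<^bsub>M\<^esub>,
     zero = \<lambda>_. \<zero>\<^bsub>M\<^esub>, add = \<lambda>f g i. f i \<oplus>\<^bsub>M\<^esub> g i, smult = \<lambda>r f i. r \<odot>\<^bsub>M\<^esub> f i\<rparr>"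

text \<open>The power C^b, kept inside the single module \<open>fun_mod M\<close> of all sequences.
  Matrices of every shape are then linear maps from \<open>fun_mod M\<close> to itself, and domains
  and ranges are just submodules.\<close>

definition vecs_in :: "('a, 'c) module \<Rightarrow> 'c set \<Rightarrow> nat \<Rightarrow> (nat \<Rightarrow> 'c) set" where
  "vecs_in M C b = {y. (\<forall>k<b. y k \<in> C) \<and> (\<forall>k\<ge>b. y k = \<zero>\<^bsub>M\<^esub>)}"

definition single :: "('a, 'c) module \<Rightarrow> nat \<Rightarrow> 'c \<Rightarrow> nat \<Rightarrow> 'c" where
  "single M k x = (\<lambda>j. if j = k then x else \<zero>\<^bsub>M\<^esub>)"

text \<open>The pure tensor x \<otimes> n under the identification of R^q \<otimes> M with
  M^q.\<close>

definition tens :: "('a, 'c) module \<Rightarrow> (nat \<Rightarrow> 'a) \<Rightarrow> 'c \<Rightarrow> nat \<Rightarrow> 'c" where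
  "tens M x n = (\<lambda>j. x j \<odot>\<^bsub>M\<^esub> n)"

lemma fun_mod_simps [simp]:
  "carrier (fun_mod M) = {f. \<forall>i. f i \<in> carrier M}" "zero (fun_mod M) = (\<lambda>_. \<zero>\<^bsub>M\<^esub>)"
  "add (fun_mod M) = (\<lambda>f g i. f i \<oplus>\<^bsub>M\<^esub> g i)" "smult (fun_mod M) = (\<lambda>r f i. r \<odot>\<^bsub>M\<^esub> f i)"
  by (auto simp: fun_mod_def)

lemma vecs_eq: "vecs M b = vecs_in M (carrier M) b"
  by (simp add: vecs_def vecs_in_def)

lemma vecs_ring: "vecs (ring_mod R) b = vecs R b"
  by (simp add: vecs_def)

lemma mat_R_eq: "mat_R R A p q = mat_N (ring_mod R) A p q"
  by (simp add: mat_R_def mat_N_def fun_eq_iff finsum_ring_mod)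

lemma vecs_in_mono: "C \<subseteq> D \<Longrightarrow> vecs_in M C b \<subseteq> vecs_in M D b"
  by (auto simp: vecs_in_def)

abbreviation is_mat where
  "is_mat R A p q \<equiv> \<forall>j<p. \<forall>k<q. A j k \<in> carrier R"

lemma fun_mod_module:
  fixes M :: "('a, 'c) module"
  assumes "module R M" shows "module R (fun_mod M)"
proof (rule moduleI)
  interpret module R M by fact
  show "cring R" by (rule is_cring)
  show "abelian_group (fun_mod M)"
  proof (rule abelian_groupI)
    fix x assume "x \<in> carrier (fun_mod M)"
    then show "\<exists>y\<in>carrier (fun_mod M). y \<oplus>\<^bsub>fun_mod M\<^esub> x = \<zero>\<^bsub>fun_mod M\<^esub>"
      by (intro bexI[of _ "\<lambda>i. \<ominus>\<^bsub>M\<^esub> x i"]) (auto simp: M.l_neg)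
  qed (auto simp: M.a_ac)
qed (use assms in \<open>auto simp: module.smult_l_distr module.smult_r_distr module.smult_assoc1 module.smult_closed module.smult_one\<close>)

locale plain_module = module R M
  for R :: "('a, 'b) ring_scheme" (structure) and M :: "('a, 'c) module" (structure)
begin

lemmas fun_module = fun_mod_module[OF module_axioms]

lemma vecs_in_submodule:
  assumes "submodule C R M" shows "submodule (vecs_in M C b) R (fun_mod M)"
proof -
  have C: "C \<subseteq> carrier M" "\<zero>\<^bsub>M\<^esub> \<in> C" "\<And>x y. x \<in> C \<Longrightarrow> y \<in> C \<Longrightarrow> x \<oplus>\<^bsub>M\<^esub> y \<in> C"
    "\<And>a x. a \<in> carrier R \<Longrightarrow> x \<in> C \<Longrightarrow> a \<odot>\<^bsub>M\<^esub> x \<in> C" using assms by (auto simp: submodule_iff)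
  have "y i \<in> carrier M" if "y \<in> vecs_in M C b" for y i
    using that C(1) by (cases "i < b") (auto simp: vecs_in_def)
  then show ?thesis
    unfolding module.submodule_iff[OF fun_module] using C by (auto simp: vecs_in_def)
qed

lemma vecs_in_carrier: "submodule C R M \<Longrightarrow> y \<in> vecs_in M C b \<Longrightarrow> y i \<in> carrier M"
  using vecs_in_submodule[of C b] unfolding module.submodule_iff[OF fun_module] by auto

lemma vecs_carrier: "y \<in> vecs M b \<Longrightarrow> y i \<in> carrier M"
  unfolding vecs_eq using vecs_in_carrier[OF carrier_is_submodule] .

lemma vecs_submodule: "submodule (vecs M b) R (fun_mod M)"
  unfolding vecs_eq by (rule vecs_in_submodule[OF carrier_is_submodule])

lemma single_closed: "x \<in> carrier M \<Longrightarrow> single M k x \<in> carrier (fun_mod M)"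
  by (auto simp: single_def)

lemma single_vecs_in: "x \<in> C \<Longrightarrow> \<zero>\<^bsub>M\<^esub> \<in> C \<Longrightarrow> k < b \<Longrightarrow> single M k x \<in> vecs_in M C b"
  by (auto simp: single_def vecs_in_def)

lemma single_vecs: "x \<in> carrier M \<Longrightarrow> k < b \<Longrightarrow> single M k x \<in> vecs M b"
  unfolding vecs_eq by (rule single_vecs_in) auto

text \<open>Vectors with one nonzero entry generate C^q: peel off the last coordinate and use
  induction on q.\<close>

lemma vecs_in_subset:
  assumes A: "submodule A R (fun_mod M)" and C: "submodule C R M"
    and s: "\<And>k n. k < q \<Longrightarrow> n \<in> C \<Longrightarrow> single M k n \<in> A"
  shows "vecs_in M C q \<subseteq> A"
  using s
proof (induction q)
  case 0
  have "(\<lambda>_. \<zero>\<^bsub>M\<^esub>) \<in> A" using A unfolding module.submodule_iff[OF fun_module] by simp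
  then show ?case by (auto simp: vecs_in_def fun_eq_iff[symmetric])
next
  case (Suc q)
  show ?case
  proof
    fix y assume y: "y \<in> vecs_in M C (Suc q)"
    define z where "z = y(q := \<zero>\<^bsub>M\<^esub>)"
    have "z \<in> vecs_in M C q" using y by (auto simp: vecs_in_def z_def)
    then have z: "z \<in> A" using Suc by auto
    have yq: "y q \<in> C" using y by (auto simp: vecs_in_def)
    then have "single M q (y q) \<in> A" using Suc.prems by auto
    then have "(\<lambda>i. z i \<oplus>\<^bsub>M\<^esub> single M q (y q) i) \<in> A"
      using z A unfolding module.submodule_iff[OF fun_module] by auto
    moreover have "(\<lambda>i. z i \<oplus>\<^bsub>M\<^esub> single M q (y q) i) = y"
      using vecs_in_carrier[OF C y] by (auto simp: z_def single_def fun_eq_iff)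
    ultimately show "y \<in> A" by simp
  qed
qed

lemma coord_linear: "linear_map R (fun_mod M) M (\<lambda>y. y i)"
  by (intro linear_map.intro linear_map_axioms.intro fun_module module_axioms) auto

lemma mat_N_closed:
  assumes "is_mat R A p q" "\<And>k. k < q \<Longrightarrow> y k \<in> carrier M"
  shows "mat_N M A p q y \<in> vecs M p"
  unfolding mat_N_def vecs_def using assms by (auto intro!: M.finsum_closed)

lemma mat_N_in:
  assumes "submodule C R M" "\<And>j k. j < p \<Longrightarrow> k < q \<Longrightarrow> A j k \<odot>\<^bsub>M\<^esub> y k \<in> C"
  shows "mat_N M A p q y \<in> vecs_in M C p"
  unfolding mat_N_def vecs_in_def using assms by (auto intro!: submodule_finsum)

lemma mat_N_linear:
  assumes A: "is_mat R A p q"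
  shows "linear_map R (fun_mod M) (fun_mod M) (mat_N M A p q)"
proof (intro linear_map.intro linear_map_axioms.intro fun_module)
  show "mat_N M A p q x \<in> carrier (fun_mod M)" if "x \<in> carrier (fun_mod M)" for x
    using mat_N_closed[OF A, of x] vecs_carrier that by auto
next
  fix x y assume xy: "x \<in> carrier (fun_mod M)" "y \<in> carrier (fun_mod M)"
  have "finsum M (\<lambda>k. A j k \<odot>\<^bsub>M\<^esub> (x k \<oplus>\<^bsub>M\<^esub> y k)) {..<q}
      = finsum M (\<lambda>k. A j k \<odot>\<^bsub>M\<^esub> x k) {..<q} \<oplus>\<^bsub>M\<^esub> finsum M (\<lambda>k. A j k \<odot>\<^bsub>M\<^esub> y k) {..<q}" if "j < p" for j
  proof -
    have "finsum M (\<lambda>k. A j k \<odot>\<^bsub>M\<^esub> (x k \<oplus>\<^bsub>M\<^esub> y k)) {..<q} = finsum M (\<lambda>k. A j k \<odot>\<^bsub>M\<^esub> x k \<oplus>\<^bsub>M\<^esub> A j k \<odot>\<^bsub>M\<^esub> y k) {..<q}"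
      by (rule M.finsum_cong') (use A xy that in \<open>auto simp: smult_r_distr\<close>)
    also have "\<dots> = finsum M (\<lambda>k. A j k \<odot>\<^bsub>M\<^esub> x k) {..<q} \<oplus>\<^bsub>M\<^esub> finsum M (\<lambda>k. A j k \<odot>\<^bsub>M\<^esub> y k) {..<q}"
      by (rule M.finsum_addf) (use A xy that in auto)
    finally show ?thesis .
  qed
  then show "mat_N M A p q (x \<oplus>\<^bsub>fun_mod M\<^esub> y) = mat_N M A p q x \<oplus>\<^bsub>fun_mod M\<^esub> mat_N M A p q y"
    by (simp add: mat_N_def fun_eq_iff)
next
  fix r x assume rx: "r \<in> carrier R" "x \<in> carrier (fun_mod M)"
  have "finsum M (\<lambda>k. A j k \<odot>\<^bsub>M\<^esub> (r \<odot>\<^bsub>M\<^esub> x k)) {..<q} = r \<odot>\<^bsub>M\<^esub> finsum M (\<lambda>k. A j k \<odot>\<^bsub>M\<^esub> x k) {..<q}" if "j < p" for j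
  proof -
    have "r \<odot>\<^bsub>M\<^esub> finsum M (\<lambda>k. A j k \<odot>\<^bsub>M\<^esub> x k) {..<q} = finsum M (\<lambda>k. r \<odot>\<^bsub>M\<^esub> (A j k \<odot>\<^bsub>M\<^esub> x k)) {..<q}"
      by (rule finsum_smult_ldistr) (use A rx that in auto)
    also have "\<dots> = finsum M (\<lambda>k. A j k \<odot>\<^bsub>M\<^esub> (r \<odot>\<^bsub>M\<^esub> x k)) {..<q}"
    proof (rule M.finsum_cong')
      fix k assume "k \<in> {..<q}"
      then have "A j k \<in> carrier R" "x k \<in> carrier M" using A rx that by auto
      then show "r \<odot>\<^bsub>M\<^esub> (A j k \<odot>\<^bsub>M\<^esub> x k) = A j k \<odot>\<^bsub>M\<^esub> (r \<odot>\<^bsub>M\<^esub> x k)"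
        using rx by (simp add: smult_assoc1[symmetric] R.m_comm)
    qed (use A rx that in auto)
    finally show ?thesis by simp
  qed
  then show "mat_N M A p q (r \<odot>\<^bsub>fun_mod M\<^esub> x) = r \<odot>\<^bsub>fun_mod M\<^esub> mat_N M A p q x"
    using rx by (simp add: mat_N_def fun_eq_iff)
qed

lemma augment_linear:
  assumes g: "\<And>k. k < b \<Longrightarrow> g k \<in> carrier M"
  shows "linear_map R (fun_mod (ring_mod R)) M (augment M b g)"
proof (intro linear_map.intro linear_map_axioms.intro module_axioms)
  show "module R (fun_mod (ring_mod R))" by (rule fun_mod_module[OF ring_mod_module])
  show "augment M b g x \<in> carrier M" if "x \<in> carrier (fun_mod (ring_mod R))" for x
    using that g unfolding augment_def by (auto intro!: M.finsum_closed)
next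
  fix x y assume xy: "x \<in> carrier (fun_mod (ring_mod R))" "y \<in> carrier (fun_mod (ring_mod R))"
  have "finsum M (\<lambda>k. (x k \<oplus> y k) \<odot>\<^bsub>M\<^esub> g k) {..<b} = finsum M (\<lambda>k. x k \<odot>\<^bsub>M\<^esub> g k \<oplus>\<^bsub>M\<^esub> y k \<odot>\<^bsub>M\<^esub> g k) {..<b}"
    by (rule M.finsum_cong') (use g xy in \<open>auto simp: smult_l_distr\<close>)
  also have "\<dots> = finsum M (\<lambda>k. x k \<odot>\<^bsub>M\<^esub> g k) {..<b} \<oplus>\<^bsub>M\<^esub> finsum M (\<lambda>k. y k \<odot>\<^bsub>M\<^esub> g k) {..<b}"
    by (rule M.finsum_addf) (use g xy in auto)
  finally show "augment M b g (x \<oplus>\<^bsub>fun_mod (ring_mod R)\<^esub> y) = augment M b g x \<oplus>\<^bsub>M\<^esub> augment M b g y"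
    by (simp add: augment_def)
next
  fix r x assume rx: "r \<in> carrier R" "x \<in> carrier (fun_mod (ring_mod R))"
  have "r \<odot>\<^bsub>M\<^esub> finsum M (\<lambda>k. x k \<odot>\<^bsub>M\<^esub> g k) {..<b} = finsum M (\<lambda>k. r \<odot>\<^bsub>M\<^esub> (x k \<odot>\<^bsub>M\<^esub> g k)) {..<b}"
    by (rule finsum_smult_ldistr) (use g rx in auto)
  also have "\<dots> = finsum M (\<lambda>k. (r \<otimes> x k) \<odot>\<^bsub>M\<^esub> g k) {..<b}"
    by (rule M.finsum_cong') (use g rx in \<open>auto simp: smult_assoc1\<close>)
  finally show "augment M b g (r \<odot>\<^bsub>fun_mod (ring_mod R)\<^esub> x) = r \<odot>\<^bsub>M\<^esub> augment M b g x"
    by (simp add: augment_def)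
qed

lemma finsum_only:
  assumes "k < (q::nat)" "f k \<in> carrier M" "\<And>i. i < q \<Longrightarrow> i \<noteq> k \<Longrightarrow> f i = \<zero>\<^bsub>M\<^esub>"
  shows "finsum M f {..<q} = f k"
proof -
  have "f i \<in> carrier M" if "i < q" for i using assms that by (cases "i = k") auto
  then have "finsum M f {..<q} = finsum M f {k}"
    by (intro M.add.finprod_mono_neutral_cong_right) (use assms in auto)
  then show ?thesis using assms by simp
qed

lemma mat_N_single:
  assumes "is_mat R A p q" "k < q" "n \<in> carrier M"
  shows "mat_N M A p q (single M k n) = (\<lambda>j. if j < p then A j k \<odot>\<^bsub>M\<^esub> n else \<zero>\<^bsub>M\<^esub>)"
proof -
  have "finsum M (\<lambda>i. A j i \<odot>\<^bsub>M\<^esub> single M k n i) {..<q} = A j k \<odot>\<^bsub>M\<^esub> single M k n k" if "j < p" for j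
    by (rule finsum_only) (use assms that in \<open>auto simp: single_def\<close>)
  then show ?thesis by (auto simp: mat_N_def single_def)
qed

lemma augment_single:
  assumes "\<And>k. k < b \<Longrightarrow> g k \<in> carrier M" "k < b"
  shows "augment M b g (single (ring_mod R) k \<one>) = g k"
proof -
  have "augment M b g (single (ring_mod R) k \<one>) = single (ring_mod R) k \<one> k \<odot>\<^bsub>M\<^esub> g k"
    unfolding augment_def by (rule finsum_only) (use assms in \<open>auto simp: single_def\<close>)
  then show ?thesis using assms by (simp add: single_def)
qed

lemma smult_linear: "n \<in> carrier M \<Longrightarrow> linear_map R (ring_mod R) M (\<lambda>r. r \<odot>\<^bsub>M\<^esub> n)"
  by (intro linear_map.intro linear_map_axioms.intro module_axioms ring_mod_module)
    (auto simp: smult_l_distr smult_assoc1)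

text \<open>The bridge from R to M: the induced map acts on the first factor of a pure tensor.
  Through it, identities between matrices over R reach M.\<close>

lemma mat_N_tens:
  assumes A: "is_mat R A p q" and x: "\<And>i. x i \<in> carrier R" and n: "n \<in> carrier M"
  shows "mat_N M A p q (tens M x n) = tens M (mat_R R A p q x) n"
proof -
  interpret L: linear_map R "ring_mod R" M "\<lambda>r. r \<odot>\<^bsub>M\<^esub> n" by (rule smult_linear[OF n])
  have "finsum M (\<lambda>k. A j k \<odot>\<^bsub>M\<^esub> (x k \<odot>\<^bsub>M\<^esub> n)) {..<q} = finsum R (\<lambda>k. A j k \<otimes> x k) {..<q} \<odot>\<^bsub>M\<^esub> n" if "j < p" for j
  proof -
    have "finsum R (\<lambda>k. A j k \<otimes> x k) {..<q} \<odot>\<^bsub>M\<^esub> n = finsum M (\<lambda>k. (A j k \<otimes> x k) \<odot>\<^bsub>M\<^esub> n) {..<q}"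
      using L.map_finsum[of "{..<q}" "\<lambda>k. A j k \<otimes> x k"] A x that by (auto simp: finsum_ring_mod)
    also have "\<dots> = finsum M (\<lambda>k. A j k \<odot>\<^bsub>M\<^esub> (x k \<odot>\<^bsub>M\<^esub> n)) {..<q}"
      by (rule M.finsum_cong') (use A x n that in \<open>auto simp: smult_assoc1\<close>)
    finally show ?thesis by simp
  qed
  then show ?thesis using n by (auto simp: mat_N_def mat_R_def tens_def)
qed

lemma single_tens: "n \<in> carrier M \<Longrightarrow> single M k n = tens M (single (ring_mod R) k \<one>) n"
  by (auto simp: single_def tens_def)

end

text \<open>The action of a fixed matrix is natural in the module. It is used for coordinate maps,
  for inclusions of submodules and for the map from a free module onto its quotient.\<close>

lemma (in linear_map) mat_N_natural:
  assumes A: "is_mat R A p q" and y: "\<And>i. y i \<in> carrier V"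
  shows "mat_N W A p q (\<lambda>k. T (y k)) = (\<lambda>j. T (mat_N V A p q y j))"
proof -
  have "T (finsum V (\<lambda>k. A j k \<odot>\<^bsub>V\<^esub> y k) {..<q}) = finsum W (\<lambda>k. A j k \<odot>\<^bsub>W\<^esub> T (y k)) {..<q}" if "j < p" for j
  proof -
    have "T (finsum V (\<lambda>k. A j k \<odot>\<^bsub>V\<^esub> y k) {..<q}) = finsum W (\<lambda>k. T (A j k \<odot>\<^bsub>V\<^esub> y k)) {..<q}"
      by (rule map_finsum) (use A y that in auto)
    also have "\<dots> = finsum W (\<lambda>k. A j k \<odot>\<^bsub>W\<^esub> T (y k)) {..<q}"
      by (rule W.finsum_cong') (use A y that in \<open>auto simp: map_smult\<close>)
    finally show ?thesis .
  qed
  then show ?thesis by (auto simp: mat_N_def map_zero)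
qed

lemma linear_map_eq_submodule:
  assumes "linear_map R V W T" "linear_map R V W U"
  shows "submodule {x \<in> carrier V. T x = U x} R V"
proof -
  interpret T: linear_map R V W T by fact
  interpret U: linear_map R V W U by fact
  show ?thesis unfolding T.V.submodule_iff
    by (auto simp: T.map_zero U.map_zero T.map_add U.map_add T.map_smult U.map_smult)
qed

lemma linear_map_eq_on_vecs:
  assumes M: "module R M" and T: "linear_map R (fun_mod M) W T" and U: "linear_map R (fun_mod M) W U"
    and eq: "\<And>k n. k < q \<Longrightarrow> n \<in> carrier M \<Longrightarrow> T (single M k n) = U (single M k n)"
    and y: "y \<in> vecs M q"
  shows "T y = U y"
proof -
  interpret plain_module R M by (rule plain_module.intro[OF M])
  have "vecs_in M (carrier M) q \<subseteq> {x \<in> carrier (fun_mod M). T x = U x}"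
    by (rule vecs_in_subset[OF linear_map_eq_submodule[OF T U] carrier_is_submodule])
      (use eq single_closed in auto)
  then show ?thesis using y by (auto simp: vecs_eq)
qed

lemma linear_map_comp:
  assumes "linear_map R U V S" "linear_map R V W T" shows "linear_map R U W (\<lambda>x. T (S x))"
proof -
  interpret S: linear_map R U V S by fact
  interpret T: linear_map R V W T by fact
  show ?thesis by unfold_locales (auto simp: S.map_add T.map_add S.map_smult T.map_smult)
qed

lemma linear_map_add:
  assumes "linear_map R V W S" "linear_map R V W T" shows "linear_map R V W (\<lambda>x. S x \<oplus>\<^bsub>W\<^esub> T x)"
proof -
  interpret S: linear_map R V W S by fact
  interpret T: linear_map R V W T by fact
  show ?thesis by unfold_locales
    (auto simp: S.map_add T.map_add S.map_smult T.map_smult S.W.a_ac S.W.smult_r_distr)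
qed

lemma linear_map_id: "module R V \<Longrightarrow> linear_map R V V (\<lambda>x. x)"
  by (intro linear_map.intro linear_map_axioms.intro) auto

lemma (in cring) ring_plain_module: "plain_module R (ring_mod R)"
  by (rule plain_module.intro[OF ring_mod_module])

abbreviation unit_vec where "unit_vec R k \<equiv> single (ring_mod R) k \<one>\<^bsub>R\<^esub>"

lemma linear_map_smult:
  assumes "linear_map R V W T" "r \<in> carrier R" shows "linear_map R V W (\<lambda>x. r \<odot>\<^bsub>W\<^esub> T x)"
proof -
  interpret linear_map R V W T by fact
  show ?thesis
  proof unfold_locales
    fix a x assume "a \<in> carrier R" "x \<in> carrier V"
    then show "r \<odot>\<^bsub>W\<^esub> T (a \<odot>\<^bsub>V\<^esub> x) = a \<odot>\<^bsub>W\<^esub> (r \<odot>\<^bsub>W\<^esub> T x)"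
      using assms(2) by (simp add: map_smult W.smult_assoc1[symmetric] V.R.m_comm)
  qed (use assms(2) in \<open>auto simp: map_add W.smult_r_distr\<close>)
qed

lemma linear_map_zero:
  assumes "module R V" "module R W" shows "linear_map R V W (\<lambda>x. \<zero>\<^bsub>W\<^esub>)"
proof -
  interpret V: module R V by fact
  interpret W: module R W by fact
  show ?thesis by unfold_locales auto
qed

section \<open>Free modules R^q: maps are determined by unit vectors, and maps can be lifted\<close>

context cring
begin

interpretation RM: plain_module R "ring_mod R" by (rule ring_plain_module)

lemma linear_map_eq_on_ring_vecs:
  assumes T: "linear_map R (fun_mod (ring_mod R)) W T" and U: "linear_map R (fun_mod (ring_mod R)) W U"
    and eq: "\<And>k. k < q \<Longrightarrow> T (unit_vec R k) = U (unit_vec R k)"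
    and y: "y \<in> vecs R q"
  shows "T y = U y"
proof (rule linear_map_eq_on_vecs[OF ring_mod_module T U])
  interpret T: linear_map R "fun_mod (ring_mod R)" W T by fact
  interpret U: linear_map R "fun_mod (ring_mod R)" W U by fact
  fix k n assume k: "k < q" and n: "n \<in> carrier (ring_mod R)"
  have "single (ring_mod R) k n = n \<odot>\<^bsub>fun_mod (ring_mod R)\<^esub> unit_vec R k"
    using n by (auto simp: single_def)
  moreover have "unit_vec R k \<in> carrier (fun_mod (ring_mod R))" by (rule RM.single_closed) simp
  ultimately show "T (single (ring_mod R) k n) = U (single (ring_mod R) k n)"
    using eq[OF k] n T.map_smult U.map_smult by simp
qed (use y in \<open>simp add: vecs_ring\<close>)

lemma mat_R_linear:
  assumes "is_mat R A p q"
  shows "linear_map R (fun_mod (ring_mod R)) (fun_mod (ring_mod R)) (mat_R R A p q)"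
  unfolding mat_R_eq by (rule RM.mat_N_linear[OF assms])

lemma mat_R_closed:
  assumes "is_mat R A p q" "\<And>k. x k \<in> carrier R" shows "mat_R R A p q x \<in> vecs R p"
  using RM.mat_N_closed[OF assms(1), of x] assms(2) by (simp add: mat_R_eq vecs_ring)

lemma ring_vecs_carrier: "x \<in> vecs R q \<Longrightarrow> x i \<in> carrier R"
  using RM.vecs_carrier[of x q i] by (simp add: vecs_ring)

lemma unit_vec_vecs: "k < q \<Longrightarrow> unit_vec R k \<in> vecs R q"
  using RM.single_vecs[of \<one> k q] by (simp add: vecs_ring)

text \<open>Projectivity of R^q: chosen preimages of the values on unit vectors are the columns of
  the lift. The target W is arbitrary, so differentials and augmentations are both covered.\<close>

lemma lift_matrix:
  assumes f: "linear_map R (fun_mod (ring_mod R)) W f" and d: "linear_map R (fun_mod (ring_mod R)) W d"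
    and im: "\<And>k. k < q \<Longrightarrow> f (unit_vec R k) \<in> d ` vecs R r"
  obtains A where "is_mat R A r q" "\<And>x. x \<in> vecs R q \<Longrightarrow> d (mat_R R A r q x) = f x"
proof -
  have "\<exists>u. u \<in> vecs R r \<and> d u = f (unit_vec R k)" if "k < q" for k
    using im[OF that] by auto
  then obtain u where u: "\<And>k. k < q \<Longrightarrow> u k \<in> vecs R r" "\<And>k. k < q \<Longrightarrow> d (u k) = f (unit_vec R k)" by metis
  define A where "A j k = u k j" for j k
  have A: "is_mat R A r q" using u(1) ring_vecs_carrier by (auto simp: A_def)
  have "d (mat_R R A r q x) = f x" if x: "x \<in> vecs R q" for x
  proof (rule linear_map_eq_on_ring_vecs[OF linear_map_comp[OF mat_R_linear[OF A] d] f _ x])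
    fix k assume k: "k < q"
    have "mat_R R A r q (unit_vec R k) = u k"
      unfolding mat_R_eq RM.mat_N_single[OF A k, of \<one>, simplified]
      using A k u(1)[OF k] by (auto simp: A_def vecs_def fun_eq_iff)
    then show "d (mat_R R A r q (unit_vec R k)) = f (unit_vec R k)" using u(2)[OF k] by simp
  qed
  then show thesis using that A by blast
qed

end

section \<open>Matrix identities over R carried over to M\<close>

context plain_module
begin

lemma unit_vec_closed: "unit_vec R k i \<in> carrier R"
  by (simp add: single_def)

lemma mat_N_comp_single:
  assumes A: "is_mat R A p r" and B: "is_mat R B r q" and k: "k < q" and n: "n \<in> carrier M"
  shows "mat_N M A p r (mat_N M B r q (single M k n)) = tens M (mat_R R A p r (mat_R R B r q (unit_vec R k))) n"
proof -
  have "mat_R R B r q (unit_vec R k) \<in> vecs R r" by (rule mat_R_closed[OF B unit_vec_closed])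
  note c = ring_vecs_carrier[OF this]
  show ?thesis
    unfolding single_tens[OF n] mat_N_tens[OF B unit_vec_closed n] mat_N_tens[OF A c n] ..
qed

text \<open>A commutative square of matrices over R remains commutative after tensoring with M: it
  suffices to compare both sides on the pure tensors of a unit vector and an element of M.\<close>

lemma mat_N_comp_eq:
  assumes A: "is_mat R A p r" and B: "is_mat R B r q" and C: "is_mat R C p r'" and D: "is_mat R D r' q"
    and eq: "\<And>x. x \<in> vecs R q \<Longrightarrow> mat_R R A p r (mat_R R B r q x) = mat_R R C p r' (mat_R R D r' q x)"
    and y: "y \<in> vecs M q"
  shows "mat_N M A p r (mat_N M B r q y) = mat_N M C p r' (mat_N M D r' q y)"
proof (rule linear_map_eq_on_vecs[OF module_axioms linear_map_comp[OF mat_N_linear[OF B] mat_N_linear[OF A]]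
        linear_map_comp[OF mat_N_linear[OF D] mat_N_linear[OF C]] _ y])
  fix k n assume k: "k < q" and n: "n \<in> carrier M"
  show "mat_N M A p r (mat_N M B r q (single M k n)) = mat_N M C p r' (mat_N M D r' q (single M k n))"
    using mat_N_comp_single[OF A B k n] mat_N_comp_single[OF C D k n] eq[OF unit_vec_vecs[OF k]] by simp
qed

lemma mat_N_comp_zero:
  assumes A: "is_mat R A p r" and B: "is_mat R B r q"
    and eq: "\<And>x. x \<in> vecs R q \<Longrightarrow> mat_R R A p r (mat_R R B r q x) = (\<lambda>_. \<zero>)"
    and y: "y \<in> vecs M q"
  shows "mat_N M A p r (mat_N M B r q y) = (\<lambda>_. \<zero>\<^bsub>M\<^esub>)"
proof -
  have "mat_N M A p r (mat_N M B r q y) = \<zero>\<^bsub>fun_mod M\<^esub>"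
  proof (rule linear_map_eq_on_vecs[OF module_axioms linear_map_comp[OF mat_N_linear[OF B] mat_N_linear[OF A]]
        linear_map_zero[OF fun_module fun_module] _ y])
    fix k n assume k: "k < q" and n: "n \<in> carrier M"
    show "mat_N M A p r (mat_N M B r q (single M k n)) = \<zero>\<^bsub>fun_mod M\<^esub>"
      using mat_N_comp_single[OF A B k n] eq[OF unit_vec_vecs[OF k]] n by (simp add: tens_def)
  qed
  then show ?thesis by simp
qed

text \<open>The shape is that of a chain homotopy, \<psi> \<phi> = 1 + h d + d h, with the factors
  of each product given separately; it too is checked on pure tensors.\<close>

lemma mat_N_homotopy:
  assumes A: "is_mat R A q r" and B: "is_mat R B r q" and C: "is_mat R C q r'" and D: "is_mat R D r' q"
    and E: "is_mat R E q r''" and F: "is_mat R F r'' q"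
    and eq: "\<And>x. x \<in> vecs R q \<Longrightarrow> mat_R R A q r (mat_R R B r q x) =
      (x \<oplus>\<^bsub>fun_mod (ring_mod R)\<^esub> mat_R R C q r' (mat_R R D r' q x)) \<oplus>\<^bsub>fun_mod (ring_mod R)\<^esub> mat_R R E q r'' (mat_R R F r'' q x)"
    and y: "y \<in> vecs M q"
  shows "mat_N M A q r (mat_N M B r q y) =
      (y \<oplus>\<^bsub>fun_mod M\<^esub> mat_N M C q r' (mat_N M D r' q y)) \<oplus>\<^bsub>fun_mod M\<^esub> mat_N M E q r'' (mat_N M F r'' q y)"
proof (rule linear_map_eq_on_vecs[OF module_axioms linear_map_comp[OF mat_N_linear[OF B] mat_N_linear[OF A]]
        linear_map_add[OF linear_map_add[OF linear_map_id[OF fun_module] linear_map_comp[OF mat_N_linear[OF D] mat_N_linear[OF C]]]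
          linear_map_comp[OF mat_N_linear[OF F] mat_N_linear[OF E]]] _ y])
  fix k n assume k: "k < q" and n: "n \<in> carrier M"
  have 1: "single M k n = tens M (unit_vec R k) n" by (rule single_tens[OF n])
  have c: "mat_R R X p' p (mat_R R Y p s (unit_vec R k)) i \<in> carrier R"
    if "is_mat R X p' p" "is_mat R Y p s" for X Y p p' s i
    by (rule ring_vecs_carrier[OF mat_R_closed[OF that(1) ring_vecs_carrier[OF mat_R_closed[OF that(2) unit_vec_closed]]]])
  show "mat_N M A q r (mat_N M B r q (single M k n)) =
      (single M k n \<oplus>\<^bsub>fun_mod M\<^esub> mat_N M C q r' (mat_N M D r' q (single M k n))) \<oplus>\<^bsub>fun_mod M\<^esub>
        mat_N M E q r'' (mat_N M F r'' q (single M k n))"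
    unfolding mat_N_comp_single[OF A B k n] mat_N_comp_single[OF C D k n] mat_N_comp_single[OF E F k n]
      eq[OF unit_vec_vecs[OF k]]
    using c[OF C D] c[OF E F] unit_vec_closed n unfolding 1 by (simp add: tens_def smult_l_distr)
qed

end

subsection \<open>Comparison of resolutions\<close>

text \<open>The part of a free resolution that does not mention the resolved module: exactness in
  positive degrees. Writing degrees as successors avoids the subtraction in
  \<open>free_resolution\<close>.\<close>

locale free_complex = cring R for R :: "('a, 'b) ring_scheme" (structure) +
  fixes b :: "nat \<Rightarrow> nat" and d :: "nat \<Rightarrow> nat \<Rightarrow> nat \<Rightarrow> 'a"
  assumes mats: "is_mat R (d (Suc i)) (b i) (b (Suc i))"
    and exact: "{x \<in> vecs R (b (Suc i)). mat_R R (d (Suc i)) (b i) (b (Suc i)) x = (\<lambda>_. \<zero>)}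
        = mat_R R (d (Suc (Suc i))) (b (Suc i)) (b (Suc (Suc i))) ` vecs R (b (Suc (Suc i)))"

lemma free_resolution_complex:
  assumes "cring R" "free_resolution R M b d g"
  shows "free_complex R b d"
proof (intro free_complex.intro free_complex_axioms.intro assms(1))
  fix i
  note r = assms(2)[unfolded free_resolution_def]
  have 1: "\<forall>i\<ge>1. is_mat R (d i) (b (i - 1)) (b i)" using r by (elim conjE)
  have 2: "\<forall>i\<ge>1. {x \<in> vecs R (b i). mat_R R (d i) (b (i - 1)) (b i) x = (\<lambda>_. \<zero>\<^bsub>R\<^esub>)}
        = mat_R R (d (Suc i)) (b i) (b (Suc i)) ` vecs R (b (Suc i))"
    using r by (elim conjE)
  show "is_mat R (d (Suc i)) (b i) (b (Suc i))"
    using 1[rule_format, of "Suc i"] by simp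
  show "{x \<in> vecs R (b (Suc i)). mat_R R (d (Suc i)) (b i) (b (Suc i)) x = (\<lambda>_. \<zero>\<^bsub>R\<^esub>)}
        = mat_R R (d (Suc (Suc i))) (b (Suc i)) (b (Suc (Suc i))) ` vecs R (b (Suc (Suc i)))"
    using 2[rule_format, of "Suc i"] by simp
qed

context cring
begin

text \<open>The inductive step of the comparison theorem. \<phi> and \<psi> lift one degree up
  because they respect the images of the differentials; the failure of the lifts to be inverse,
  corrected by h d, is killed by d and so lifts through d2. The homotopy identity is assumed on
  boundaries, since it is applied to d x.\<close>

lemma homotopy_step:
  assumes d: "is_mat R d b b1" and d2: "is_mat R d2 b1 b2" and d': "is_mat R d' b' b1'"
    and ex: "{x \<in> vecs R b1. mat_R R d b b1 x = (\<lambda>_. \<zero>)} = mat_R R d2 b1 b2 ` vecs R b2"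
    and phi: "is_mat R \<phi> b' b" and psi: "is_mat R \<psi> b b'" and h: "is_mat R h b1 b"
    and phi_im: "\<And>x. x \<in> vecs R b1 \<Longrightarrow> mat_R R \<phi> b' b (mat_R R d b b1 x) \<in> mat_R R d' b' b1' ` vecs R b1'"
    and psi_im: "\<And>x. x \<in> vecs R b1' \<Longrightarrow> mat_R R \<psi> b b' (mat_R R d' b' b1' x) \<in> mat_R R d b b1 ` vecs R b1"
    and hom: "\<And>x. x \<in> mat_R R d b b1 ` vecs R b1 \<Longrightarrow>
      mat_R R \<psi> b b' (mat_R R \<phi> b' b x) = x \<oplus>\<^bsub>fun_mod (ring_mod R)\<^esub> mat_R R d b b1 (mat_R R h b1 b x)"
  obtains \<phi>1 \<psi>1 h1 where "is_mat R \<phi>1 b1' b1" "is_mat R \<psi>1 b1 b1'" "is_mat R h1 b2 b1"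
    "\<And>x. x \<in> vecs R b1 \<Longrightarrow> mat_R R d' b' b1' (mat_R R \<phi>1 b1' b1 x) = mat_R R \<phi> b' b (mat_R R d b b1 x)"
    "\<And>x. x \<in> vecs R b1' \<Longrightarrow> mat_R R d b b1 (mat_R R \<psi>1 b1 b1' x) = mat_R R \<psi> b b' (mat_R R d' b' b1' x)"
    "\<And>x. x \<in> vecs R b1 \<Longrightarrow> mat_R R \<psi>1 b1 b1' (mat_R R \<phi>1 b1' b1 x) =
       (x \<oplus>\<^bsub>fun_mod (ring_mod R)\<^esub> mat_R R h b1 b (mat_R R d b b1 x)) \<oplus>\<^bsub>fun_mod (ring_mod R)\<^esub> mat_R R d2 b1 b2 (mat_R R h1 b2 b1 x)"
proof -
  let ?V = "fun_mod (ring_mod R)"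
  note lin = mat_R_linear and comp = linear_map_comp
  obtain \<phi>1 where phi1: "is_mat R \<phi>1 b1' b1"
    "\<And>x. x \<in> vecs R b1 \<Longrightarrow> mat_R R d' b' b1' (mat_R R \<phi>1 b1' b1 x) = mat_R R \<phi> b' b (mat_R R d b b1 x)"
    by (rule lift_matrix[OF comp[OF lin[OF d] lin[OF phi]] lin[OF d'], of b1 b1']) (use phi_im[OF unit_vec_vecs] in auto)
  obtain \<psi>1 where psi1: "is_mat R \<psi>1 b1 b1'"
    "\<And>x. x \<in> vecs R b1' \<Longrightarrow> mat_R R d b b1 (mat_R R \<psi>1 b1 b1' x) = mat_R R \<psi> b b' (mat_R R d' b' b1' x)"
    by (rule lift_matrix[OF comp[OF lin[OF d'] lin[OF psi]] lin[OF d], of b1' b1]) (use psi_im[OF unit_vec_vecs] in auto)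
  define P where "P x = mat_R R \<psi>1 b1 b1' (mat_R R \<phi>1 b1' b1 x)" for x
  define C where "C x = x \<oplus>\<^bsub>?V\<^esub> mat_R R h b1 b (mat_R R d b b1 x)" for x
  \<comment> \<open>The defect \<psi>1 \<phi>1 - (1 + h d), with the difference written through the
    scalar -1 so that linearity follows from sums and multiples. The homotopy h1 is its lift through
    d2.\<close>
  define f where "f x = P x \<oplus>\<^bsub>?V\<^esub> (\<ominus> \<one>) \<odot>\<^bsub>?V\<^esub> C x" for x
  have m1: "\<ominus> \<one> \<in> carrier R" by simp
  have P: "linear_map R ?V ?V P" unfolding P_def by (rule comp[OF lin[OF phi1(1)] lin[OF psi1(1)]])
  have C: "linear_map R ?V ?V C" unfolding C_def
    by (rule linear_map_add[OF linear_map_id[OF fun_mod_module[OF ring_mod_module]] comp[OF lin[OF d] lin[OF h]]])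
  have f: "linear_map R ?V ?V f" unfolding f_def by (rule linear_map_add[OF P linear_map_smult[OF C m1]])
  interpret V: module R ?V by (rule fun_mod_module[OF ring_mod_module])
  interpret D: linear_map R ?V ?V "mat_R R d b b1" by (rule lin[OF d])
  have vc: "x \<in> carrier ?V" if "x \<in> vecs R q" for x q using ring_vecs_carrier[OF that] by simp
  have Pc: "P x \<in> vecs R b1" if x: "x \<in> vecs R b1" for x
    unfolding P_def by (intro mat_R_closed[OF psi1(1)] ring_vecs_carrier[OF mat_R_closed[OF phi1(1)]] ring_vecs_carrier[OF x])
  have hdc: "mat_R R h b1 b (mat_R R d b b1 x) \<in> vecs R b1" if x: "x \<in> vecs R b1" for x
    by (intro mat_R_closed[OF h] ring_vecs_carrier[OF mat_R_closed[OF d]] ring_vecs_carrier[OF x])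
  have sv: "submodule (vecs R b1) R ?V"
    using plain_module.vecs_submodule[OF ring_plain_module] by (simp add: vecs_ring)
  have Cc: "C x \<in> vecs R b1" if x: "x \<in> vecs R b1" for x
    unfolding C_def using sv hdc[OF x] x unfolding V.submodule_iff by blast
  have fc: "f x \<in> vecs R b1" if x: "x \<in> vecs R b1" for x
    unfolding f_def using sv Cc[OF x] Pc[OF x] m1 unfolding V.submodule_iff by blast
  have "f x \<in> mat_R R d2 b1 b2 ` vecs R b2" if x: "x \<in> vecs R b1" for x
  proof -
    have dx: "mat_R R d b b1 x \<in> carrier ?V" using D.map_closed vc[OF x] by blast
    have "mat_R R d b b1 (P x) = mat_R R \<psi> b b' (mat_R R \<phi> b' b (mat_R R d b b1 x))"
      unfolding P_def using psi1(2)[OF mat_R_closed[OF phi1(1)]] phi1(2)[OF x] ring_vecs_carrier[OF x] by simp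
    also have "\<dots> = mat_R R d b b1 x \<oplus>\<^bsub>?V\<^esub> mat_R R d b b1 (mat_R R h b1 b (mat_R R d b b1 x))"
      by (rule hom) (use x in auto)
    also have "\<dots> = mat_R R d b b1 (C x)" unfolding C_def
      by (rule D.map_add[symmetric]) (use vc[OF x] vc[OF hdc[OF x]] in auto)
    finally have "mat_R R d b b1 (P x) = mat_R R d b b1 (C x)" .
    moreover have "mat_R R d b b1 (f x) = mat_R R d b b1 (P x) \<oplus>\<^bsub>?V\<^esub> (\<ominus> \<one>) \<odot>\<^bsub>?V\<^esub> mat_R R d b b1 (C x)"
      unfolding f_def using D.map_add D.map_smult vc[OF Pc[OF x]] vc[OF Cc[OF x]] m1 V.smult_closed by metis
    moreover have "u \<oplus>\<^bsub>?V\<^esub> (\<ominus> \<one>) \<odot>\<^bsub>?V\<^esub> u = \<zero>\<^bsub>?V\<^esub>" if "u \<in> carrier ?V" for u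
      using that V.smult_l_minus[OF one_closed that] V.smult_one[OF that] V.r_neg[OF that] by simp
    ultimately have "mat_R R d b b1 (f x) = \<zero>\<^bsub>?V\<^esub>" using D.map_closed vc[OF Cc[OF x]] by metis
    then show ?thesis using ex fc[OF x] by auto
  qed
  then obtain h1 where h1: "is_mat R h1 b2 b1" "\<And>x. x \<in> vecs R b1 \<Longrightarrow> mat_R R d2 b1 b2 (mat_R R h1 b2 b1 x) = f x"
    using lift_matrix[OF f lin[OF d2], of b1 b2 thesis] unit_vec_vecs by blast
  have "P x = C x \<oplus>\<^bsub>?V\<^esub> mat_R R d2 b1 b2 (mat_R R h1 b2 b1 x)" if x: "x \<in> vecs R b1" for x
  proof -
    have *: "u = w \<oplus>\<^bsub>?V\<^esub> (u \<oplus>\<^bsub>?V\<^esub> (\<ominus> \<one>) \<odot>\<^bsub>?V\<^esub> w)" if "u \<in> carrier ?V" "w \<in> carrier ?V" for u w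
      unfolding V.smult_l_minus[OF one_closed that(2)] V.smult_one[OF that(2)]
      using that by (simp only: V.a_comm[of u] V.r_neg2 V.a_inv_closed)
    show ?thesis unfolding h1(2)[OF x] f_def by (rule *[OF vc[OF Pc[OF x]] vc[OF Cc[OF x]]])
  qed
  then show thesis by (intro that[OF phi1(1) psi1(1) h1(1) phi1(2) psi1(2)]) (simp_all only: P_def C_def)
qed

end

context free_complex
begin

abbreviation dR where "dR i \<equiv> mat_R R (d (Suc i)) (b i) (b (Suc i))"

lemma dR_dR: "x \<in> vecs R (b (Suc (Suc i))) \<Longrightarrow> dR i (dR (Suc i) x) = (\<lambda>_. \<zero>)"
  using exact[of i] by blast

lemma dR_image: "dR i x \<in> vecs R (b i)" if "x \<in> vecs R (b (Suc i))"
  by (intro mat_R_closed mats ring_vecs_carrier[OF that])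

end

text \<open>The data of a homotopy equivalence in degree \<open>i\<close>, recorded only on the images of the differentials.
  In this form it makes sense in degree 0, where the preceding term is \<open>M\<close> rather than a free module,
  and passes from each degree to the next, so no infinite chain map has to be chosen.\<close>

definition chain_equiv where
  "chain_equiv R b d b' d' i \<longleftrightarrow> (\<exists>\<phi> \<psi> h. is_mat R \<phi> (b' i) (b i) \<and> is_mat R \<psi> (b i) (b' i) \<and> is_mat R h (b (Suc i)) (b i) \<and>
    (\<forall>x\<in>vecs R (b (Suc i)). mat_R R \<phi> (b' i) (b i) (mat_R R (d (Suc i)) (b i) (b (Suc i)) x)
        \<in> mat_R R (d' (Suc i)) (b' i) (b' (Suc i)) ` vecs R (b' (Suc i))) \<and>
    (\<forall>x\<in>vecs R (b' (Suc i)). mat_R R \<psi> (b i) (b' i) (mat_R R (d' (Suc i)) (b' i) (b' (Suc i)) x)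
        \<in> mat_R R (d (Suc i)) (b i) (b (Suc i)) ` vecs R (b (Suc i))) \<and>
    (\<forall>x\<in>mat_R R (d (Suc i)) (b i) (b (Suc i)) ` vecs R (b (Suc i)).
      mat_R R \<psi> (b i) (b' i) (mat_R R \<phi> (b' i) (b i) x) =
      x \<oplus>\<^bsub>fun_mod (ring_mod R)\<^esub> mat_R R (d (Suc i)) (b i) (b (Suc i)) (mat_R R h (b (Suc i)) (b i) x)))"

text \<open>The augmentations take the place of the differentials: \<phi> and \<psi> lift one
  through the other, and \<psi> \<phi> - 1 is killed by the augmentation, hence lifts to h through
  the first differential.\<close>

lemma chain_equiv_0:
  fixes R :: "('a, 'b) ring_scheme" (structure) and M :: "('a, 'c) module"
  assumes M: "module R M" and res: "free_resolution R M b d g" and res': "free_resolution R M b' d' g'"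
  shows "chain_equiv R b d b' d' 0"
proof -
  interpret plain_module R M by (rule plain_module.intro[OF M])
  let ?V = "fun_mod (ring_mod R)"
  interpret V: module R ?V by (rule fun_mod_module[OF ring_mod_module])
  interpret F: free_complex R b d by (rule free_resolution_complex[OF is_cring res])
  note r = res[unfolded free_resolution_def] and r' = res'[unfolded free_resolution_def]
  let ?a = "augment M (b 0) g" and ?a' = "augment M (b' 0) g'"
  have g: "\<And>k. k < b 0 \<Longrightarrow> g k \<in> carrier M" and g': "\<And>k. k < b' 0 \<Longrightarrow> g' k \<in> carrier M" using r r' by auto
  have sur: "?a ` vecs R (b 0) = carrier M" and sur': "?a' ` vecs R (b' 0) = carrier M" using r r' by auto
  have k: "{x \<in> vecs R (b 0). ?a x = \<zero>\<^bsub>M\<^esub>} = mat_R R (d (Suc 0)) (b 0) (b (Suc 0)) ` vecs R (b (Suc 0))"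
    and k': "{x \<in> vecs R (b' 0). ?a' x = \<zero>\<^bsub>M\<^esub>} = mat_R R (d' (Suc 0)) (b' 0) (b' (Suc 0)) ` vecs R (b' (Suc 0))"
    using r r' by auto
  have a: "linear_map R ?V M ?a" and a': "linear_map R ?V M ?a'" using augment_linear g g' by auto
  interpret A: linear_map R ?V M ?a by (rule a)
  interpret A': linear_map R ?V M ?a' by (rule a')
  have vc: "x \<in> carrier ?V" if "x \<in> vecs R q" for x q using ring_vecs_carrier[OF that] by simp
  have "?a (unit_vec R k) \<in> ?a' ` vecs R (b' 0)" if "k < b 0" for k
    unfolding sur' by (rule A.map_closed[OF vc[OF unit_vec_vecs[OF that]]])
  then obtain \<phi> where phi: "is_mat R \<phi> (b' 0) (b 0)" "\<And>x. x \<in> vecs R (b 0) \<Longrightarrow> ?a' (mat_R R \<phi> (b' 0) (b 0) x) = ?a x"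
    using lift_matrix[OF a a', of "b 0" "b' 0" thesis] by blast
  have "?a' (unit_vec R k) \<in> ?a ` vecs R (b 0)" if "k < b' 0" for k
    unfolding sur by (rule A'.map_closed[OF vc[OF unit_vec_vecs[OF that]]])
  then obtain \<psi> where psi: "is_mat R \<psi> (b 0) (b' 0)" "\<And>x. x \<in> vecs R (b' 0) \<Longrightarrow> ?a (mat_R R \<psi> (b 0) (b' 0) x) = ?a' x"
    using lift_matrix[OF a' a, of "b' 0" "b 0" thesis] by blast
  define f where "f x = mat_R R \<psi> (b 0) (b' 0) (mat_R R \<phi> (b' 0) (b 0) x) \<oplus>\<^bsub>?V\<^esub> (\<ominus> \<one>) \<odot>\<^bsub>?V\<^esub> x" for x
  have m1: "\<ominus> \<one> \<in> carrier R" by simp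
  have f: "linear_map R ?V ?V f" unfolding f_def
    by (rule linear_map_add[OF linear_map_comp[OF mat_R_linear[OF phi(1)] mat_R_linear[OF psi(1)]]
        linear_map_smult[OF linear_map_id[OF V.module_axioms] m1]])
  have sv: "submodule (vecs R (b 0)) R ?V"
    using plain_module.vecs_submodule[OF ring_plain_module] by (simp add: vecs_ring)
  have pc: "mat_R R \<phi> (b' 0) (b 0) x \<in> vecs R (b' 0)" if "x \<in> vecs R (b 0)" for x
    by (intro mat_R_closed phi ring_vecs_carrier[OF that])
  have qc: "mat_R R \<psi> (b 0) (b' 0) x \<in> vecs R (b 0)" if "x \<in> vecs R (b' 0)" for x
    by (intro mat_R_closed psi ring_vecs_carrier[OF that])
  have "f x \<in> mat_R R (d (Suc 0)) (b 0) (b (Suc 0)) ` vecs R (b (Suc 0))" if x: "x \<in> vecs R (b 0)" for x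
  proof -
    have fx: "f x \<in> vecs R (b 0)" unfolding f_def
      using sv qc[OF pc[OF x]] x m1 unfolding V.submodule_iff by blast
    have "?a (f x) = ?a x \<oplus>\<^bsub>M\<^esub> (\<ominus> \<one>) \<odot>\<^bsub>M\<^esub> ?a x"
      unfolding f_def A.map_add[OF vc[OF qc[OF pc[OF x]]] V.smult_closed[OF m1 vc[OF x]]] A.map_smult[OF m1 vc[OF x]]
        psi(2)[OF pc[OF x]] phi(2)[OF x] ..
    also have "\<dots> = \<zero>\<^bsub>M\<^esub>" using A.map_closed[OF vc[OF x]] by (simp add: smult_l_minus M.r_neg)
    finally show ?thesis using k fx by auto
  qed
  then obtain h where h: "is_mat R h (b (Suc 0)) (b 0)"
    "\<And>x. x \<in> vecs R (b 0) \<Longrightarrow> mat_R R (d (Suc 0)) (b 0) (b (Suc 0)) (mat_R R h (b (Suc 0)) (b 0) x) = f x"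
    using lift_matrix[OF f mat_R_linear[OF F.mats[of 0]], of "b 0" "b (Suc 0)" thesis] unit_vec_vecs by blast
  have *: "u = w \<oplus>\<^bsub>?V\<^esub> (u \<oplus>\<^bsub>?V\<^esub> (\<ominus> \<one>) \<odot>\<^bsub>?V\<^esub> w)" if "u \<in> carrier ?V" "w \<in> carrier ?V" for u w
    unfolding V.smult_l_minus[OF one_closed that(2)] V.smult_one[OF that(2)]
    using that by (simp only: V.a_comm[of u] V.r_neg2 V.a_inv_closed)
  show ?thesis unfolding chain_equiv_def
  proof (intro exI conjI ballI)
    show "is_mat R \<phi> (b' 0) (b 0)" "is_mat R \<psi> (b 0) (b' 0)" "is_mat R h (b (Suc 0)) (b 0)" by fact+
    show "mat_R R \<phi> (b' 0) (b 0) (F.dR 0 x) \<in> mat_R R (d' (Suc 0)) (b' 0) (b' (Suc 0)) ` vecs R (b' (Suc 0))"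
      if "x \<in> vecs R (b (Suc 0))" for x
    proof -
      have "F.dR 0 x \<in> {x \<in> vecs R (b 0). ?a x = \<zero>\<^bsub>M\<^esub>}" unfolding k using that by auto
      then show ?thesis unfolding k'[symmetric] using phi pc by auto
    qed
    show "mat_R R \<psi> (b 0) (b' 0) (mat_R R (d' (Suc 0)) (b' 0) (b' (Suc 0)) x) \<in> F.dR 0 ` vecs R (b (Suc 0))"
      if "x \<in> vecs R (b' (Suc 0))" for x
    proof -
      have "mat_R R (d' (Suc 0)) (b' 0) (b' (Suc 0)) x \<in> {x \<in> vecs R (b' 0). ?a' x = \<zero>\<^bsub>M\<^esub>}" unfolding k' using that by auto
      then show ?thesis unfolding k[symmetric] using psi qc by auto
    qed
    fix x assume "x \<in> F.dR 0 ` vecs R (b (Suc 0))"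
    then have x: "x \<in> vecs R (b 0)" unfolding k[symmetric] by auto
    show "mat_R R \<psi> (b 0) (b' 0) (mat_R R \<phi> (b' 0) (b 0) x) = x \<oplus>\<^bsub>?V\<^esub> F.dR 0 (mat_R R h (b (Suc 0)) (b 0) x)"
      unfolding h(2)[OF x] f_def by (rule *[OF vc[OF qc[OF pc[OF x]]] vc[OF x]])
  qed
qed

text \<open>Besides the equivalence in the next degree it returns the matrices of both degrees and
  the identities linking them, because Tor in degree \<open>Suc i\<close> is transported through
  that square.\<close>

lemma chain_equiv_step:
  assumes F: "free_complex R b d" and F': "free_complex R b' d'" and ce: "chain_equiv R b d b' d' i"
  obtains \<phi> \<psi> h \<phi>1 \<psi>1 h1 where "is_mat R \<phi> (b' i) (b i)" "is_mat R \<psi> (b i) (b' i)" "is_mat R h (b (Suc i)) (b i)"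
    "is_mat R \<phi>1 (b' (Suc i)) (b (Suc i))" "is_mat R \<psi>1 (b (Suc i)) (b' (Suc i))" "is_mat R h1 (b (Suc (Suc i))) (b (Suc i))"
    "\<And>x. x \<in> vecs R (b (Suc i)) \<Longrightarrow> mat_R R (d' (Suc i)) (b' i) (b' (Suc i)) (mat_R R \<phi>1 (b' (Suc i)) (b (Suc i)) x)
      = mat_R R \<phi> (b' i) (b i) (mat_R R (d (Suc i)) (b i) (b (Suc i)) x)"
    "\<And>x. x \<in> vecs R (b' (Suc i)) \<Longrightarrow> mat_R R (d (Suc i)) (b i) (b (Suc i)) (mat_R R \<psi>1 (b (Suc i)) (b' (Suc i)) x)
      = mat_R R \<psi> (b i) (b' i) (mat_R R (d' (Suc i)) (b' i) (b' (Suc i)) x)"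
    "\<And>x. x \<in> vecs R (b (Suc i)) \<Longrightarrow> mat_R R \<psi>1 (b (Suc i)) (b' (Suc i)) (mat_R R \<phi>1 (b' (Suc i)) (b (Suc i)) x) =
      (x \<oplus>\<^bsub>fun_mod (ring_mod R)\<^esub> mat_R R h (b (Suc i)) (b i) (mat_R R (d (Suc i)) (b i) (b (Suc i)) x)) \<oplus>\<^bsub>fun_mod (ring_mod R)\<^esub>
        mat_R R (d (Suc (Suc i))) (b (Suc i)) (b (Suc (Suc i))) (mat_R R h1 (b (Suc (Suc i))) (b (Suc i)) x)"
    "\<And>x. x \<in> vecs R (b' (Suc (Suc i))) \<Longrightarrow> mat_R R \<psi>1 (b (Suc i)) (b' (Suc i)) (mat_R R (d' (Suc (Suc i))) (b' (Suc i)) (b' (Suc (Suc i))) x)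
      \<in> mat_R R (d (Suc (Suc i))) (b (Suc i)) (b (Suc (Suc i))) ` vecs R (b (Suc (Suc i)))"
    "chain_equiv R b d b' d' (Suc i)"
proof -
  interpret F: free_complex R b d by fact
  interpret F': free_complex R b' d' by fact
  let ?V = "fun_mod (ring_mod R)"
  interpret V: module R ?V by (rule fun_mod_module[OF F.ring_mod_module])
  obtain \<phi> \<psi> h where c0: "is_mat R \<phi> (b' i) (b i)" "is_mat R \<psi> (b i) (b' i)" "is_mat R h (b (Suc i)) (b i)"
    "\<forall>x \<in> vecs R (b (Suc i)). mat_R R \<phi> (b' i) (b i) (F.dR i x) \<in> F'.dR i ` vecs R (b' (Suc i))"
    "\<forall>x \<in> vecs R (b' (Suc i)). mat_R R \<psi> (b i) (b' i) (F'.dR i x) \<in> F.dR i ` vecs R (b (Suc i))"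
    "\<forall>x \<in> F.dR i ` vecs R (b (Suc i)). mat_R R \<psi> (b i) (b' i) (mat_R R \<phi> (b' i) (b i) x) =
      x \<oplus>\<^bsub>?V\<^esub> F.dR i (mat_R R h (b (Suc i)) (b i) x)"
    using ce unfolding chain_equiv_def by (elim exE conjE) (rule that)
  note c = c0(1-3) c0(4-6)[THEN bspec]
  obtain \<phi>1 \<psi>1 h1 where e: "is_mat R \<phi>1 (b' (Suc i)) (b (Suc i))" "is_mat R \<psi>1 (b (Suc i)) (b' (Suc i))" "is_mat R h1 (b (Suc (Suc i))) (b (Suc i))"
    "\<And>x. x \<in> vecs R (b (Suc i)) \<Longrightarrow> F'.dR i (mat_R R \<phi>1 (b' (Suc i)) (b (Suc i)) x) = mat_R R \<phi> (b' i) (b i) (F.dR i x)"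
    "\<And>x. x \<in> vecs R (b' (Suc i)) \<Longrightarrow> F.dR i (mat_R R \<psi>1 (b (Suc i)) (b' (Suc i)) x) = mat_R R \<psi> (b i) (b' i) (F'.dR i x)"
    "\<And>x. x \<in> vecs R (b (Suc i)) \<Longrightarrow> mat_R R \<psi>1 (b (Suc i)) (b' (Suc i)) (mat_R R \<phi>1 (b' (Suc i)) (b (Suc i)) x) =
      (x \<oplus>\<^bsub>?V\<^esub> mat_R R h (b (Suc i)) (b i) (F.dR i x)) \<oplus>\<^bsub>?V\<^esub> F.dR (Suc i) (mat_R R h1 (b (Suc (Suc i))) (b (Suc i)) x)"
    by (rule F.homotopy_step[OF F.mats[of i] F.mats[of "Suc i"] F'.mats[of i] F.exact[of i] c]) (assumption | rule that)+
  have z: "mat_R R A p q (\<lambda>_. \<zero>\<^bsub>R\<^esub>) = (\<lambda>_. \<zero>\<^bsub>R\<^esub>)" if "is_mat R A p q" for A p q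
    using linear_map.map_zero[OF F.mat_R_linear[OF that]] by simp
  have p1: "mat_R R \<psi>1 (b (Suc i)) (b' (Suc i)) (F'.dR (Suc i) x) \<in> F.dR (Suc i) ` vecs R (b (Suc (Suc i)))"
    if x: "x \<in> vecs R (b' (Suc (Suc i)))" for x
  proof -
    have "F.dR i (mat_R R \<psi>1 (b (Suc i)) (b' (Suc i)) (F'.dR (Suc i) x)) = (\<lambda>_. \<zero>\<^bsub>R\<^esub>)"
      unfolding e(5)[OF F'.dR_image[OF x]] F'.dR_dR[OF x] by (rule z[OF c(2)])
    moreover have "mat_R R \<psi>1 (b (Suc i)) (b' (Suc i)) (F'.dR (Suc i) x) \<in> vecs R (b (Suc i))"
      by (intro F.mat_R_closed e F.ring_vecs_carrier[OF F'.dR_image[OF x]])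
    ultimately show ?thesis unfolding F.exact[of i, symmetric] by blast
  qed
  have "chain_equiv R b d b' d' (Suc i)" unfolding chain_equiv_def
  proof (intro exI conjI ballI)
    show "is_mat R \<phi>1 (b' (Suc i)) (b (Suc i))" "is_mat R \<psi>1 (b (Suc i)) (b' (Suc i))" "is_mat R h1 (b (Suc (Suc i))) (b (Suc i))" by fact+
    show "mat_R R \<phi>1 (b' (Suc i)) (b (Suc i)) (F.dR (Suc i) x) \<in> F'.dR (Suc i) ` vecs R (b' (Suc (Suc i)))"
      if x: "x \<in> vecs R (b (Suc (Suc i)))" for x
    proof -
      have "F'.dR i (mat_R R \<phi>1 (b' (Suc i)) (b (Suc i)) (F.dR (Suc i) x)) = (\<lambda>_. \<zero>\<^bsub>R\<^esub>)"
        unfolding e(4)[OF F.dR_image[OF x]] F.dR_dR[OF x] by (rule z[OF c(1)])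
      moreover have "mat_R R \<phi>1 (b' (Suc i)) (b (Suc i)) (F.dR (Suc i) x) \<in> vecs R (b' (Suc i))"
        by (intro F.mat_R_closed e F.ring_vecs_carrier[OF F.dR_image[OF x]])
      ultimately show ?thesis unfolding F'.exact[of i, symmetric] by blast
    qed
    show "mat_R R \<psi>1 (b (Suc i)) (b' (Suc i)) (F'.dR (Suc i) x) \<in> F.dR (Suc i) ` vecs R (b (Suc (Suc i)))"
      if x: "x \<in> vecs R (b' (Suc (Suc i)))" for x by (rule p1[OF x])
    fix x assume "x \<in> F.dR (Suc i) ` vecs R (b (Suc (Suc i)))"
    then have x: "x \<in> vecs R (b (Suc i))" "F.dR i x = (\<lambda>_. \<zero>\<^bsub>R\<^esub>)" unfolding F.exact[of i, symmetric] by auto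
    have "x \<oplus>\<^bsub>?V\<^esub> (\<lambda>_. \<zero>\<^bsub>R\<^esub>) = x" using F.ring_vecs_carrier[OF x(1)] by simp
    then show "mat_R R \<psi>1 (b (Suc i)) (b' (Suc i)) (mat_R R \<phi>1 (b' (Suc i)) (b (Suc i)) x) =
        x \<oplus>\<^bsub>?V\<^esub> F.dR (Suc i) (mat_R R h1 (b (Suc (Suc i))) (b (Suc i)) x)"
      unfolding e(6)[OF x(1)] x(2) z[OF c(3)] by metis
  qed
  from that[OF c(1-3) e p1 this] show thesis .
qed

text \<open>A cycle y for d is sent to a cycle for d', which is a boundary by assumption; coming
  back, \<psi> \<phi> y is a boundary, and by the homotopy it differs from y by a boundary.\<close>

lemma tor_zero_resolution_independent:
  fixes M :: "('a, 'c) module" and N :: "('a, 'e) module"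
  assumes M: "module R M" and N: "module R N"
    and res: "free_resolution R M b d g" and res': "free_resolution R M b' d' g'"
    and tor: "tor_zero N b' d' (Suc i)"
  shows "tor_zero N b d (Suc i)"
proof -
  interpret N: plain_module R N by (rule plain_module.intro[OF N])
  interpret F: free_complex R b d by (rule free_resolution_complex[OF N.is_cring res])
  interpret F': free_complex R b' d' by (rule free_resolution_complex[OF N.is_cring res'])
  let ?V = "fun_mod N"
  interpret V: module R ?V by (rule N.fun_module)
  have ce: "chain_equiv R b d b' d' j" for j
  proof (induction j)
    case 0 show ?case by (rule chain_equiv_0[OF M res res'])
  next
    case (Suc j) show ?case
      by (rule chain_equiv_step[OF F.free_complex_axioms F'.free_complex_axioms Suc.IH])
  qed
  obtain \<phi> \<psi> h \<phi>1 \<psi>1 h1 where c: "is_mat R \<phi> (b' i) (b i)" "is_mat R \<psi> (b i) (b' i)" "is_mat R h (b (Suc i)) (b i)"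
    and e: "is_mat R \<phi>1 (b' (Suc i)) (b (Suc i))" "is_mat R \<psi>1 (b (Suc i)) (b' (Suc i))" "is_mat R h1 (b (Suc (Suc i))) (b (Suc i))"
    and p: "\<And>x. x \<in> vecs R (b (Suc i)) \<Longrightarrow> F'.dR i (mat_R R \<phi>1 (b' (Suc i)) (b (Suc i)) x) = mat_R R \<phi> (b' i) (b i) (F.dR i x)"
    and hom: "\<And>x. x \<in> vecs R (b (Suc i)) \<Longrightarrow> mat_R R \<psi>1 (b (Suc i)) (b' (Suc i)) (mat_R R \<phi>1 (b' (Suc i)) (b (Suc i)) x) =
      (x \<oplus>\<^bsub>fun_mod (ring_mod R)\<^esub> mat_R R h (b (Suc i)) (b i) (F.dR i x)) \<oplus>\<^bsub>fun_mod (ring_mod R)\<^esub>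
        F.dR (Suc i) (mat_R R h1 (b (Suc (Suc i))) (b (Suc i)) x)"
    and im: "\<And>x. x \<in> vecs R (b' (Suc (Suc i))) \<Longrightarrow> mat_R R \<psi>1 (b (Suc i)) (b' (Suc i)) (F'.dR (Suc i) x) \<in> F.dR (Suc i) ` vecs R (b (Suc (Suc i)))"
    by (rule chain_equiv_step[OF F.free_complex_axioms F'.free_complex_axioms ce[of i]]) (rule that)
  \<comment> \<open>A third matrix, one degree higher, is what shows after tensoring that \<psi>1
    maps boundaries to boundaries: over R this is a statement about images, and a matrix is required
    to carry it to N.\<close>
  obtain \<psi>2 where psi2: "is_mat R \<psi>2 (b (Suc (Suc i))) (b' (Suc (Suc i)))"
    "\<And>x. x \<in> vecs R (b' (Suc (Suc i))) \<Longrightarrow> F.dR (Suc i) (mat_R R \<psi>2 (b (Suc (Suc i))) (b' (Suc (Suc i))) x) = mat_R R \<psi>1 (b (Suc i)) (b' (Suc i)) (F'.dR (Suc i) x)"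
    using N.lift_matrix[OF linear_map_comp[OF N.mat_R_linear[OF F'.mats[of "Suc i"]] N.mat_R_linear[OF e(2)]]
        N.mat_R_linear[OF F.mats[of "Suc i"]], of "b' (Suc (Suc i))" "b (Suc (Suc i))" thesis] im N.unit_vec_vecs by blast
  let ?D = "\<lambda>i. mat_N N (d (Suc i)) (b i) (b (Suc i))" and ?D' = "\<lambda>i. mat_N N (d' (Suc i)) (b' i) (b' (Suc i))"
  have z: "mat_N N A p q (\<lambda>_. \<zero>\<^bsub>N\<^esub>) = (\<lambda>_. \<zero>\<^bsub>N\<^esub>)" if "is_mat R A p q" for A p q
    using linear_map.map_zero[OF N.mat_N_linear[OF that]] by simp
  show ?thesis unfolding tor_zero_def
  proof
    fix y assume "y \<in> {y \<in> vecs N (b (Suc i)). Suc i = 0 \<or> mat_N N (d (Suc i)) (b (Suc i - 1)) (b (Suc i)) y = (\<lambda>_. \<zero>\<^bsub>N\<^esub>)}"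
    then have y: "y \<in> vecs N (b (Suc i))" and dy: "?D i y = (\<lambda>_. \<zero>\<^bsub>N\<^esub>)" by auto
    let ?y = "mat_N N \<phi>1 (b' (Suc i)) (b (Suc i)) y"
    have vc: "v \<in> carrier ?V" if "v \<in> vecs N q" for v q using N.vecs_carrier[OF that] by simp
    have yc: "?y \<in> vecs N (b' (Suc i))" by (intro N.mat_N_closed e N.vecs_carrier[OF y])
    have "?D' i ?y = mat_N N \<phi> (b' i) (b i) (?D i y)"
      by (rule N.mat_N_comp_eq[OF F'.mats e(1) c(1) F.mats p y])
    then have "?D' i ?y = (\<lambda>_. \<zero>\<^bsub>N\<^esub>)" unfolding dy z[OF c(1)] .
    then obtain w where w: "w \<in> vecs N (b' (Suc (Suc i)))" "?y = ?D' (Suc i) w"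
      using tor yc unfolding tor_zero_def by auto
    let ?w = "mat_N N \<psi>2 (b (Suc (Suc i))) (b' (Suc (Suc i))) w"
    let ?h = "mat_N N h1 (b (Suc (Suc i))) (b (Suc i)) y"
    have wc: "?w \<in> vecs N (b (Suc (Suc i)))" by (intro N.mat_N_closed psi2 N.vecs_carrier[OF w(1)])
    have hc: "?h \<in> vecs N (b (Suc (Suc i)))" by (intro N.mat_N_closed e N.vecs_carrier[OF y])
    have 1: "mat_N N \<psi>1 (b (Suc i)) (b' (Suc i)) ?y = (y \<oplus>\<^bsub>?V\<^esub> mat_N N h (b (Suc i)) (b i) (?D i y)) \<oplus>\<^bsub>?V\<^esub> ?D (Suc i) ?h"
      by (rule N.mat_N_homotopy[OF e(2) e(1) c(3) F.mats F.mats e(3) hom y])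
    have 2: "mat_N N \<psi>1 (b (Suc i)) (b' (Suc i)) ?y = ?D (Suc i) ?w" unfolding w(2)
      by (rule N.mat_N_comp_eq[OF F.mats psi2(1) e(2) F'.mats psi2(2) w(1), symmetric])
    have y0: "y \<oplus>\<^bsub>?V\<^esub> (\<lambda>_. \<zero>\<^bsub>N\<^esub>) = y" using N.vecs_carrier[OF y] by simp
    interpret D: linear_map R ?V ?V "?D (Suc i)" by (rule N.mat_N_linear[OF F.mats])
    \<comment> \<open>The term h d y drops out since y is a cycle, leaving y as a difference of two
      boundaries.\<close>
    have eq: "?D (Suc i) ?w = y \<oplus>\<^bsub>?V\<^esub> ?D (Suc i) ?h" using 1 unfolding 2 dy z[OF c(3)] y0 .
    have "?D (Suc i) (?w \<ominus>\<^bsub>?V\<^esub> ?h) = ?D (Suc i) ?w \<ominus>\<^bsub>?V\<^esub> ?D (Suc i) ?h"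
      by (rule D.map_minus[OF vc[OF wc] vc[OF hc]])
    also have "\<dots> = y" unfolding eq
      using vc[OF y] D.map_closed[OF vc[OF hc]] by (simp only: a_minus_def V.a_assoc V.r_neg V.r_zero V.a_inv_closed)
    finally have "y = ?D (Suc i) (?w \<ominus>\<^bsub>?V\<^esub> ?h)" by simp
    moreover have "?w \<ominus>\<^bsub>?V\<^esub> ?h \<in> vecs N (b (Suc (Suc i)))"
      by (rule V.submodule_minus[OF N.vecs_submodule wc hc])
    ultimately show "y \<in> mat_N N (d (Suc (Suc i))) (b (Suc i)) (b (Suc (Suc i))) ` vecs N (b (Suc (Suc i)))" by blast
  qed
qed

abbreviation seqs where "seqs R \<equiv> fun_mod (ring_mod R)"

subsection \<open>Dimension shifting\<close>

lemma submodule_inclusion_linear: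
  fixes V :: "('a, 'c) module"
  assumes "module R V" "submodule A R V"
  shows "linear_map R (V\<lparr>carrier := A\<rparr>) V (\<lambda>x. x)"
proof -
  interpret V: module R V by fact
  have "A \<subseteq> carrier V" using assms(2) by (simp add: V.submodule_iff)
  then show ?thesis
    by (intro linear_map.intro linear_map_axioms.intro submodule.submodule_is_module assms) auto
qed

context free_complex
begin

text \<open>Tensoring with R^c gives c copies of the complex: fix a coordinate t of all entries of
  y, solve in the complex over R, and reassemble.\<close>

lemma tensor_free_exact:
  assumes y: "y \<in> vecs_in (seqs R) (vecs R c) (b (Suc i))"
    and dy: "mat_N (seqs R) (d (Suc i)) (b i) (b (Suc i)) y = (\<lambda>_. \<zero>\<^bsub>seqs R\<^esub>)"
  obtains z where "z \<in> vecs_in (seqs R) (vecs R c) (b (Suc (Suc i)))"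
    "mat_N (seqs R) (d (Suc (Suc i))) (b (Suc i)) (b (Suc (Suc i))) z = y"
proof -
  interpret RM: plain_module R "ring_mod R" by (rule ring_plain_module)
  have nat: "mat_R R A p q (\<lambda>k. w k t) = (\<lambda>j. mat_N (seqs R) A p q w j t)"
    if "is_mat R A p q" "\<And>k. w k \<in> carrier (seqs R)" for A p q w t
    unfolding mat_R_eq by (rule linear_map.mat_N_natural[OF RM.coord_linear that])
  have yc: "y k \<in> vecs R c" for k
    using y by (cases "k < b (Suc i)") (auto simp: vecs_in_def vecs_def)
  have yc': "y k \<in> carrier (seqs R)" for k using ring_vecs_carrier[OF yc] by simp
  have xt: "(\<lambda>k. y k t) \<in> vecs R (b (Suc i))" for t
    using y ring_vecs_carrier[OF yc] by (auto simp: vecs_in_def vecs_def)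
  have "\<exists>u. u \<in> vecs R (b (Suc (Suc i))) \<and> dR (Suc i) u = (\<lambda>k. y k t)" for t
  proof -
    have "dR i (\<lambda>k. y k t) = (\<lambda>_. \<zero>)" unfolding nat[OF mats yc'] dy by simp
    then have "(\<lambda>k. y k t) \<in> dR (Suc i) ` vecs R (b (Suc (Suc i)))" unfolding exact[of i, symmetric] using xt by blast
    then show ?thesis by auto
  qed
  then obtain u where u: "\<And>t. u t \<in> vecs R (b (Suc (Suc i)))" "\<And>t. dR (Suc i) (u t) = (\<lambda>k. y k t)" by metis
  \<comment> \<open>The solutions were chosen for every t; cutting them off at c keeps the entries
    of z in R^c.\<close>
  define z where "z k t = (if t < c then u t k else \<zero>)" for k t
  have zc: "z k \<in> carrier (seqs R)" for k using ring_vecs_carrier[OF u(1)] by (auto simp: z_def)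
  have "z \<in> vecs_in (seqs R) (vecs R c) (b (Suc (Suc i)))"
    using u(1) ring_vecs_carrier[OF u(1)] by (auto simp: vecs_in_def vecs_def z_def)
  moreover have "mat_N (seqs R) (d (Suc (Suc i))) (b (Suc i)) (b (Suc (Suc i))) z = y"
  proof (intro ext)
    fix j t
    have "mat_N (seqs R) (d (Suc (Suc i))) (b (Suc i)) (b (Suc (Suc i))) z j t = dR (Suc i) (\<lambda>k. z k t) j"
      unfolding nat[OF mats zc] ..
    also have "\<dots> = y j t"
    proof (cases "t < c")
      case True
      then have "(\<lambda>k. z k t) = u t" by (auto simp: z_def)
      then show ?thesis using u(2) by simp
    next
      case False
      then have "(\<lambda>k. z k t) = (\<lambda>_. \<zero>)" by (auto simp: z_def)
      moreover have "dR (Suc i) (\<lambda>_. \<zero>) = (\<lambda>_. \<zero>)" using linear_map.map_zero[OF mat_R_linear[OF mats]] by simp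
      moreover have "y j t = \<zero>" using yc False by (auto simp: vecs_def)
      ultimately show ?thesis by simp
    qed
    finally show "mat_N (seqs R) (d (Suc (Suc i))) (b (Suc i)) (b (Suc (Suc i))) z j t = y j t" .
  qed
  ultimately show thesis using that by blast
qed

text \<open>The connecting map for 0 -> K -> R^c -> Q -> 0 by a diagram chase: since R^c has no
  higher Tor, vanishing for Q in one degree gives vanishing for K in the degree below.\<close>

lemma tor_zero_shift:
  fixes Q :: "('a, 'e) module"
  assumes q: "linear_map R (seqs R) Q q" and sur: "carrier Q \<subseteq> q ` vecs R c"
    and K: "K = {x \<in> vecs R c. q x = \<zero>\<^bsub>Q\<^esub>}"
    and tor: "tor_zero Q b d (Suc (Suc i))"
  shows "tor_zero ((seqs R)\<lparr>carrier := K\<rparr>) b d (Suc i)"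
proof -
  let ?V = "seqs R" and ?K = "(seqs R)\<lparr>carrier := K\<rparr>"
  interpret q: linear_map R ?V Q q by fact
  interpret V: plain_module R ?V by (rule plain_module.intro[OF q.V.module_axioms])
  interpret FV: module R "fun_mod ?V" by (rule V.fun_module)
  have sv: "submodule (vecs R c) R ?V"
    using plain_module.vecs_submodule[OF ring_plain_module] by (simp add: vecs_ring)
  have sK: "submodule K R ?V" unfolding K by (rule q.submodule_kernel[OF sv])
  interpret I: linear_map R ?K ?V "\<lambda>x. x" by (rule submodule_inclusion_linear[OF q.V.module_axioms sK])
  have Kv: "K \<subseteq> vecs R c" unfolding K by auto
  have zK: "\<zero>\<^bsub>?V\<^esub> \<in> K" using sK by (simp add: q.V.submodule_iff)
  have vK: "vecs ?K q = vecs_in ?V K q" for q by (simp add: vecs_def vecs_in_def)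
  have KN: "mat_N ?K A p r w = mat_N ?V A p r w" if "is_mat R A p r" "w \<in> vecs_in ?V K r" for A p r w
  proof -
    have "w k \<in> K" for k using that(2) zK by (cases "k < r") (auto simp: vecs_in_def)
    then show ?thesis using I.mat_N_natural[OF that(1), of w] by simp
  qed
  let ?D = "\<lambda>i. mat_N ?V (d (Suc i)) (b i) (b (Suc i))" and ?DQ = "\<lambda>i. mat_N Q (d (Suc i)) (b i) (b (Suc i))"
  show ?thesis unfolding tor_zero_def
  proof
    fix y assume y0: "y \<in> {y \<in> vecs ?K (b (Suc i)). Suc i = 0 \<or> mat_N ?K (d (Suc i)) (b (Suc i - 1)) (b (Suc i)) y = (\<lambda>_. \<zero>\<^bsub>?K\<^esub>)}"
    then have yK: "y \<in> vecs_in ?V K (b (Suc i))" unfolding vK by auto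
    then have y: "y \<in> vecs_in ?V (vecs R c) (b (Suc i))" using vecs_in_mono[OF Kv] by blast
    have "mat_N ?K (d (Suc i)) (b i) (b (Suc i)) y = (\<lambda>_. \<zero>\<^bsub>?K\<^esub>)" using y0 by auto
    then have "?D i y = (\<lambda>_. \<zero>\<^bsub>?V\<^esub>)" unfolding KN[OF mats yK] by simp
    then obtain z where z: "z \<in> vecs_in ?V (vecs R c) (b (Suc (Suc i)))" "?D (Suc i) z = y"
      by (rule tensor_free_exact[OF y])
    have zc: "z k \<in> carrier ?V" for k by (rule V.vecs_in_carrier[OF sv z(1)])
    have qy: "q (y k) = \<zero>\<^bsub>Q\<^esub>" for k
      using yK q.map_zero unfolding K vecs_in_def by (cases "k < b (Suc i)") auto
    \<comment> \<open>The preimage z of y need not have entries in K, but its image in Q is a cycle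
      because q kills y; the hypothesis on Q makes it a boundary.\<close>
    have "?DQ (Suc i) (\<lambda>k. q (z k)) = (\<lambda>_. \<zero>\<^bsub>Q\<^esub>)"
      unfolding q.mat_N_natural[OF mats zc] z(2) qy ..
    moreover have "(\<lambda>k. q (z k)) \<in> vecs Q (b (Suc (Suc i)))"
      using z(1) q.map_closed[OF zc] q.map_zero by (auto simp: vecs_def vecs_in_def)
    ultimately obtain w where w: "w \<in> vecs Q (b (Suc (Suc (Suc i))))" "(\<lambda>k. q (z k)) = ?DQ (Suc (Suc i)) w"
      using tor unfolding tor_zero_def by auto
    have "\<exists>u. u \<in> vecs R c \<and> q u = w k" if "k < b (Suc (Suc (Suc i)))" for k
    proof -
      have "w k \<in> carrier Q" using w(1) that by (auto simp: vecs_def)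
      then have "w k \<in> q ` vecs R c" using sur by blast
      then show ?thesis by auto
    qed
    then obtain u where u: "\<And>k. k < b (Suc (Suc (Suc i))) \<Longrightarrow> u k \<in> vecs R c \<and> q (u k) = w k" by metis
    define v where "v k = (if k < b (Suc (Suc (Suc i))) then u k else \<zero>\<^bsub>?V\<^esub>)" for k
    have v: "v \<in> vecs_in ?V (vecs R c) (b (Suc (Suc (Suc i))))" using u by (auto simp: vecs_in_def v_def)
    have vc: "v k \<in> carrier ?V" for k by (rule V.vecs_in_carrier[OF sv v])
    have qv: "(\<lambda>k. q (v k)) = w" using u w(1) q.map_zero by (auto simp: v_def vecs_def fun_eq_iff)
    let ?v = "?D (Suc (Suc i)) v"
    have dv: "?v \<in> vecs_in ?V (vecs R c) (b (Suc (Suc i)))"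
    proof (rule V.mat_N_in[OF sv])
      fix j k assume jk: "j < b (Suc (Suc i))" "k < b (Suc (Suc (Suc i)))"
      have "v k \<in> vecs R c" using v jk by (auto simp: vecs_in_def)
      then show "d (Suc (Suc (Suc i))) j k \<odot>\<^bsub>?V\<^esub> v k \<in> vecs R c"
        using sv mats jk unfolding q.V.submodule_iff by blast
    qed
    have dvc: "?v k \<in> carrier ?V" for k by (rule V.vecs_in_carrier[OF sv dv])
    have "?DQ (Suc (Suc i)) (\<lambda>k. q (v k)) = (\<lambda>j. q (?v j))" by (rule q.mat_N_natural[OF mats vc])
    then have qdv: "q (?v k) = q (z k)" for k
      unfolding qv w(2)[symmetric] by metis
    \<comment> \<open>Subtracting the boundary of the lift v moves z into K without changing its
      differential, which is still y.\<close>
    define z' where "z' = z \<ominus>\<^bsub>fun_mod ?V\<^esub> ?v"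
    have zF: "z \<in> carrier (fun_mod ?V)" "?v \<in> carrier (fun_mod ?V)" using zc dvc by auto
    have z': "z' \<in> vecs_in ?V (vecs R c) (b (Suc (Suc i)))"
      unfolding z'_def by (rule FV.submodule_minus[OF V.vecs_in_submodule[OF sv] z(1) dv])
    have z'k: "z' k = z k \<ominus>\<^bsub>?V\<^esub> ?v k" for k
      unfolding z'_def by (rule linear_map.map_minus[OF V.coord_linear zF])
    have "z' k \<in> K" if "k < b (Suc (Suc i))" for k
    proof -
      have "q (z' k) = \<zero>\<^bsub>Q\<^esub>" unfolding z'k using q.map_minus[OF zc dvc] qdv q.W.minus_self[OF q.map_closed[OF zc]] by simp
      then show ?thesis unfolding K using z' that by (auto simp: vecs_in_def)
    qed
    then have z'K: "z' \<in> vecs_in ?V K (b (Suc (Suc i)))" using z' by (auto simp: vecs_in_def)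
    have vV: "v \<in> vecs ?V (b (Suc (Suc (Suc i))))" using v vc by (auto simp: vecs_def vecs_in_def)
    have "?D (Suc i) z' = ?D (Suc i) z \<ominus>\<^bsub>fun_mod ?V\<^esub> ?D (Suc i) ?v"
      unfolding z'_def by (rule linear_map.map_minus[OF V.mat_N_linear[OF mats] zF])
    also have "?D (Suc i) ?v = \<zero>\<^bsub>fun_mod ?V\<^esub>"
      using V.mat_N_comp_zero[OF mats mats dR_dR vV] by simp
    also have "?D (Suc i) z = y" by (rule z(2))
    also have "y \<ominus>\<^bsub>fun_mod ?V\<^esub> \<zero>\<^bsub>fun_mod ?V\<^esub> = y"
    proof -
      have "y \<in> carrier (fun_mod ?V)" using V.vecs_in_carrier[OF sv y] by simp
      then show ?thesis unfolding a_minus_def using FV.add.inv_one FV.r_zero by (simp add: a_inv_def)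
    qed
    finally have "y = mat_N ?K (d (Suc (Suc i))) (b (Suc i)) (b (Suc (Suc i))) z'" unfolding KN[OF mats z'K] by simp
    then show "y \<in> mat_N ?K (d (Suc (Suc i))) (b (Suc i)) (b (Suc (Suc i))) ` vecs ?K (b (Suc (Suc i)))"
      unfolding vK using z'K by blast
  qed
qed

end

subsection \<open>Multiples by an ideal\<close>

text \<open>The submodule IC. Closure under scalars is derived: a scalar is absorbed by the factor
  from the ideal I.\<close>

inductive_set ideal_smul :: "'a set \<Rightarrow> ('a, 'c) module \<Rightarrow> 'c set \<Rightarrow> 'c set"
  for I and V (structure) and C where
  zero: "\<zero> \<in> ideal_smul I V C"
| gen: "r \<in> I \<Longrightarrow> x \<in> C \<Longrightarrow> r \<odot> x \<in> ideal_smul I V C"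
| add: "u \<in> ideal_smul I V C \<Longrightarrow> w \<in> ideal_smul I V C \<Longrightarrow> u \<oplus> w \<in> ideal_smul I V C"

context plain_module
begin

lemma ideal_smul_least:
  assumes "submodule A R M" "\<And>r x. r \<in> I \<Longrightarrow> x \<in> C \<Longrightarrow> r \<odot>\<^bsub>M\<^esub> x \<in> A"
  shows "ideal_smul I M C \<subseteq> A"
proof
  fix x assume "x \<in> ideal_smul I M C"
  then show "x \<in> A" by induction (use assms in \<open>auto simp: submodule_iff\<close>)
qed

lemma ideal_smul_submodule:
  assumes I: "ideal I R" and C: "submodule C R M"
  shows "submodule (ideal_smul I M C) R M" "ideal_smul I M C \<subseteq> C"
proof -
  have Ic: "I \<subseteq> carrier R" using I by (simp add: ideal_iff)
  show sub: "ideal_smul I M C \<subseteq> C"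
    by (rule ideal_smul_least[OF C]) (use C Ic in \<open>auto simp: submodule_iff\<close>)
  have Cc: "C \<subseteq> carrier M" using C by (auto simp: submodule_iff)
  have "a \<odot>\<^bsub>M\<^esub> x \<in> ideal_smul I M C" if a: "a \<in> carrier R" and x: "x \<in> ideal_smul I M C" for a x
    using x
  proof induction
    case zero then show ?case using a by (simp add: ideal_smul.zero)
  next
    case (gen r x)
    have "r \<in> carrier R" "x \<in> carrier M" using gen Ic Cc by auto
    then have "a \<odot>\<^bsub>M\<^esub> (r \<odot>\<^bsub>M\<^esub> x) = (a \<otimes> r) \<odot>\<^bsub>M\<^esub> x" using a by (simp add: smult_assoc1)
    moreover have "a \<otimes> r \<in> I" using I a gen by (simp add: ideal_iff)
    ultimately show ?case using gen ideal_smul.gen by metis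
  next
    case (add u w)
    have "u \<in> carrier M" "w \<in> carrier M" using add sub Cc by auto
    then show ?case using add a by (simp add: smult_r_distr ideal_smul.add)
  qed
  then show "submodule (ideal_smul I M C) R M"
    unfolding submodule_iff using sub Cc by (auto intro: ideal_smul.intros)
qed

lemma ideal_smul_vecs_in:
  assumes I: "ideal I R" and C: "submodule C R M"
  shows "ideal_smul I (fun_mod M) (vecs_in M C q) = vecs_in M (ideal_smul I M C) q"
proof
  interpret F: plain_module R "fun_mod M" by (rule plain_module.intro[OF fun_module])
  note sC = vecs_in_submodule[OF C, of q]
  have Ic: "\<And>r. r \<in> I \<Longrightarrow> r \<in> carrier R" using I by (auto simp: ideal_iff)
  show "ideal_smul I (fun_mod M) (vecs_in M C q) \<subseteq> vecs_in M (ideal_smul I M C) q"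
    by (rule F.ideal_smul_least[OF vecs_in_submodule[OF ideal_smul_submodule(1)[OF I C]]])
      (use Ic in \<open>auto simp: vecs_in_def intro: ideal_smul.gen\<close>)
  show "vecs_in M (ideal_smul I M C) q \<subseteq> ideal_smul I (fun_mod M) (vecs_in M C q)"
  proof (rule vecs_in_subset[OF F.ideal_smul_submodule(1)[OF I sC] ideal_smul_submodule(1)[OF I C]])
    fix k n assume k: "k < q" and n: "n \<in> ideal_smul I M C"
    have CM: "C \<subseteq> carrier M" "\<zero>\<^bsub>M\<^esub> \<in> C" using C by (auto simp: submodule_iff)
    from n show "single M k n \<in> ideal_smul I (fun_mod M) (vecs_in M C q)"
    proof induction
      case zero
      have "single M k \<zero>\<^bsub>M\<^esub> = \<zero>\<^bsub>fun_mod M\<^esub>" by (auto simp: single_def)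
      then show ?case using ideal_smul.zero[of "fun_mod M"] by metis
    next
      case (gen r x)
      have "single M k (r \<odot>\<^bsub>M\<^esub> x) = r \<odot>\<^bsub>fun_mod M\<^esub> single M k x" using gen Ic by (auto simp: single_def)
      moreover have "single M k x \<in> vecs_in M C q" by (rule single_vecs_in) (use gen k CM in auto)
      ultimately show ?case using ideal_smul.gen[OF gen(1)] by metis
    next
      case (add u w)
      have "single M k (u \<oplus>\<^bsub>M\<^esub> w) = single M k u \<oplus>\<^bsub>fun_mod M\<^esub> single M k w"
        by (auto simp: single_def)
      then show ?case using ideal_smul.add[OF add.IH] by metis
    qed
  qed
qed

end

lemma (in linear_map) ideal_smul_image:
  assumes I: "I \<subseteq> carrier R" and C: "submodule C R V"
  shows "T ` ideal_smul I V C = ideal_smul I W (T ` C)"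
proof
  have Cc: "C \<subseteq> carrier V" using C by (simp add: V.submodule_iff)
  have sub: "u \<in> carrier V \<and> T u \<in> ideal_smul I W (T ` C)" if "u \<in> ideal_smul I V C" for u
    using that
  proof induction
    case zero then show ?case using map_zero ideal_smul.zero by (metis V.zero_closed)
  next
    case (gen r x)
    then have "r \<in> carrier R" "x \<in> carrier V" using I Cc by auto
    then show ?case using gen by (auto simp: map_smult intro: ideal_smul.gen)
  qed (auto simp: map_add intro: ideal_smul.add)
  then show "T ` ideal_smul I V C \<subseteq> ideal_smul I W (T ` C)" by blast
  show "ideal_smul I W (T ` C) \<subseteq> T ` ideal_smul I V C"
  proof
    fix w assume "w \<in> ideal_smul I W (T ` C)"
    then show "w \<in> T ` ideal_smul I V C"
    proof induction
      case zero
      then show ?case using map_zero ideal_smul.zero by (metis imageI)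
    next
      case (gen r x)
      then obtain u where u: "u \<in> C" "x = T u" by blast
      then have "r \<odot>\<^bsub>W\<^esub> x = T (r \<odot>\<^bsub>V\<^esub> u)" using gen I Cc by (auto simp: map_smult subset_iff)
      then show ?case using gen u ideal_smul.gen by (metis imageI)
    next
      case (add u w)
      then obtain x y where "x \<in> ideal_smul I V C" "y \<in> ideal_smul I V C" "u = T x" "w = T y" by blast
      moreover from this have "u \<oplus>\<^bsub>W\<^esub> w = T (x \<oplus>\<^bsub>V\<^esub> y)" using sub by (simp add: map_add)
      ultimately show ?case using ideal_smul.add by (metis imageI)
    qed
  qed
qed

text \<open>The last coordinate maps C^(q+1) onto C with kernel C^q; additivity of length and
  induction do the rest.\<close>

lemma (in plain_module) has_length_vecs_in:
  assumes "has_length R M {\<zero>\<^bsub>M\<^esub>} C p"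
  shows "has_length R (fun_mod M) {\<zero>\<^bsub>fun_mod M\<^esub>} (vecs_in M C q) (q * p)"
proof (induction q)
  case 0
  interpret F: module R "fun_mod M" by (rule fun_module)
  have "vecs_in M C 0 = {\<zero>\<^bsub>fun_mod M\<^esub>}" by (auto simp: vecs_in_def)
  then show ?case using has_length_refl[OF F.submodule_zero] by simp
next
  case (Suc q)
  have C: "submodule C R M" by (rule has_lengthD(1)[OF assms])
  then have zC: "\<zero>\<^bsub>M\<^esub> \<in> C" by (simp add: submodule_iff)
  interpret c: linear_map R "fun_mod M" M "\<lambda>y. y q" by (rule coord_linear)
  have "{x \<in> vecs_in M C (Suc q). x q = \<zero>\<^bsub>M\<^esub>} = vecs_in M C q"
    using zC by (auto simp: vecs_in_def less_Suc_eq) (metis le_neq_implies_less Suc_leI)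
  moreover have "(\<lambda>y. y q) ` vecs_in M C (Suc q) = C"
  proof
    show "(\<lambda>y. y q) ` vecs_in M C (Suc q) \<subseteq> C" by (auto simp: vecs_in_def)
    show "C \<subseteq> (\<lambda>y. y q) ` vecs_in M C (Suc q)"
    proof
      fix x assume "x \<in> C"
      then have "single M q x \<in> vecs_in M C (Suc q)" using single_vecs_in zC by auto
      moreover have "single M q x q = x" by (simp add: single_def)
      ultimately show "x \<in> (\<lambda>y. y q) ` vecs_in M C (Suc q)" by (metis imageI)
    qed
  qed
  ultimately have "has_length R (fun_mod M) {\<zero>\<^bsub>fun_mod M\<^esub>} (vecs_in M C (Suc q)) (q * p + p)"
    using c.has_length_exact[OF vecs_in_submodule[OF C, of "Suc q"], of "q * p" p] Suc.IH assms by simp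
  then show ?case by (simp add: add.commute)
qed

subsection \<open>Minimal resolutions\<close>

lemma (in module) has_length_submodule:
  assumes "has_length R M {\<zero>\<^bsub>M\<^esub>} A n" "submodule A' R M" "A' \<subseteq> A"
  obtains p where "p \<le> n" "has_length R M {\<zero>\<^bsub>M\<^esub>} A' p"
proof -
  have "{\<zero>\<^bsub>M\<^esub>} \<subseteq> A'" using assms(2) by (simp add: submodule_iff)
  from has_length_mono[OF assms this] show thesis using that by blast
qed

text \<open>Adjoining an element outside the current span raises the length of the span, and this
  can happen at most n times.\<close>

lemma (in plain_module) finite_length_generated:
  assumes len: "has_length R M {\<zero>\<^bsub>M\<^esub>} A n"
  obtains k g where "\<And>i. i < k \<Longrightarrow> g i \<in> A" "augment M k g ` vecs R k = A"
proof (rule ccontr)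
  assume no: "\<not> thesis"
  have A: "submodule A R M" by (rule has_lengthD(1)[OF len])
  have Ac: "A \<subseteq> carrier M" using A by (simp add: submodule_iff)
  have vR: "submodule (vecs R k) R (fun_mod (ring_mod R))" for k
    using plain_module.vecs_submodule[OF ring_plain_module] by (simp add: vecs_ring)
  let ?S = "\<lambda>k g. augment M k g ` vecs R k"
  have S: "submodule (?S k g) R M" "?S k g \<subseteq> A" if g: "\<And>i. i < k \<Longrightarrow> g i \<in> A" for k g
  proof -
    have "linear_map R (fun_mod (ring_mod R)) M (augment M k g)" by (rule augment_linear) (use g Ac in auto)
    then show "submodule (?S k g) R M" by (rule linear_map.submodule_image[OF _ vR])
    show "?S k g \<subseteq> A"
    proof
      fix y assume "y \<in> ?S k g"
      then obtain x where x: "x \<in> vecs R k" "y = augment M k g x" by blast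
      show "y \<in> A" unfolding x(2) augment_def
        by (rule submodule_finsum[OF A]) (use g A ring_vecs_carrier[OF x(1)] in \<open>auto simp: submodule_iff\<close>)
    qed
  qed
  have "\<exists>k g p. (\<forall>i<k. g i \<in> A) \<and> has_length R M {\<zero>\<^bsub>M\<^esub>} (?S k g) p \<and> j \<le> p" for j
  proof (induction j)
    case 0
    have "submodule (?S 0 undefined) R M" "?S 0 undefined \<subseteq> A" using S[of 0 undefined] by auto
    then obtain p where "has_length R M {\<zero>\<^bsub>M\<^esub>} (?S 0 undefined) p"
      by (rule has_length_submodule[OF len])
    then show ?case by (intro exI[of _ 0] exI[of _ undefined] exI[of _ p]) auto
  next
    case (Suc j)
    then obtain k g p where h: "\<And>i. i < k \<Longrightarrow> g i \<in> A" "has_length R M {\<zero>\<^bsub>M\<^esub>} (?S k g) p" "j \<le> p" by blast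
    have "?S k g \<noteq> A" using no that[of k g] h(1) by blast
    then obtain x where x: "x \<in> A" "x \<notin> ?S k g" using S(2)[OF h(1)] by (meson subsetI subset_antisym)
    define g' where "g' = g(k := x)"
    have g': "g' i \<in> A" if "i < Suc k" for i using that h(1) x by (auto simp: g'_def less_Suc_eq)
    have g'c: "g' i \<in> carrier M" if "i < Suc k" for i using g'[OF that] Ac by blast
    have gc: "g i \<in> carrier M" if "i < k" for i using h(1)[OF that] Ac by blast
    have S': "submodule (?S (Suc k) g') R M" "?S (Suc k) g' \<subseteq> A" using S[of "Suc k" g'] g' by auto
    have "?S k g \<subseteq> ?S (Suc k) g'"
    proof
      fix y assume "y \<in> ?S k g"
      then obtain u where u: "u \<in> vecs R k" "y = augment M k g u" by blast
      have uc: "u i \<in> carrier R" for i by (rule ring_vecs_carrier[OF u(1)])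
      have u': "u \<in> vecs R (Suc k)" using u(1) uc by (auto simp: vecs_def)
      have "augment M (Suc k) g' u = u k \<odot>\<^bsub>M\<^esub> g' k \<oplus>\<^bsub>M\<^esub> finsum M (\<lambda>i. u i \<odot>\<^bsub>M\<^esub> g' i) {..<k}"
        unfolding augment_def lessThan_Suc by (rule M.finsum_insert) (use uc g'c in auto)
      also have "u k = \<zero>" using u(1) by (simp add: vecs_def)
      also have "finsum M (\<lambda>i. u i \<odot>\<^bsub>M\<^esub> g' i) {..<k} = y" unfolding u(2) augment_def
        by (rule M.finsum_cong') (use uc gc in \<open>auto simp: g'_def\<close>)
      also have "\<zero> \<odot>\<^bsub>M\<^esub> g' k \<oplus>\<^bsub>M\<^esub> y = y"
      proof -
        have "y \<in> carrier M" by (rule subsetD[OF Ac subsetD[OF S(2)[OF h(1)] \<open>y \<in> ?S k g\<close>]])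
        then show ?thesis using g'c[of k] by simp
      qed
      finally show "y \<in> ?S (Suc k) g'" using u' by (metis imageI)
    qed
    moreover have "x \<in> ?S (Suc k) g'"
    proof -
      have "augment M (Suc k) g' (unit_vec R k) = g' k"
        by (rule augment_single) (use g'c in auto)
      then have "augment M (Suc k) g' (unit_vec R k) = x" by (simp add: g'_def)
      then show ?thesis using unit_vec_vecs[of k "Suc k"] by (metis imageI lessI)
    qed
    ultimately have ps: "?S k g \<subset> ?S (Suc k) g'" using x by blast
    obtain p' where p': "has_length R M {\<zero>\<^bsub>M\<^esub>} (?S (Suc k) g') p'"
      by (rule has_length_submodule[OF len S'])
    have "p < p'" by (rule has_length_psubset[OF p' h(2) ps])
    then show ?case using g' p' h(3) by (intro exI[of _ "Suc k"] exI[of _ g'] exI[of _ p']) auto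
  qed
  then obtain k g p where h: "\<And>i. i < k \<Longrightarrow> g i \<in> A" "has_length R M {\<zero>\<^bsub>M\<^esub>} (?S k g) p" "Suc n \<le> p" by blast
  have "submodule_chain R M {\<zero>\<^bsub>M\<^esub>} p A"
    by (rule submodule_chain_mono[OF has_lengthD(3)[OF h(2)] S(2)[OF h(1)] A])
  then show False using len h(3) unfolding has_length_def by auto
qed

context local_cring
begin

interpretation RM: plain_module R "ring_mod R" by (rule ring_plain_module)

text \<open>With the least number of generators, a relation having a coefficient outside m would
  express one generator through the others.\<close>

lemma minimal_cover:
  fixes M :: "('a, 'c) module"
  assumes M: "module R M" and g0: "\<And>k. k < n0 \<Longrightarrow> g0 k \<in> carrier M" "augment M n0 g0 ` vecs R n0 = carrier M"
  obtains n g where "\<And>k. k < n \<Longrightarrow> g k \<in> carrier M" "augment M n g ` vecs R n = carrier M"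
    "{x \<in> vecs R n. augment M n g x = \<zero>\<^bsub>M\<^esub>} \<subseteq> vecs_in (ring_mod R) m n"
proof -
  interpret M: plain_module R M by (rule plain_module.intro[OF M])
  let ?P = "\<lambda>n. \<exists>g. (\<forall>k<n. g k \<in> carrier M) \<and> augment M n g ` vecs R n = carrier M"
  define n where "n = (LEAST n. ?P n)"
  have "?P n0" using g0 by blast
  then have "?P n" unfolding n_def by (rule LeastI)
  then obtain g where g: "\<And>k. k < n \<Longrightarrow> g k \<in> carrier M" "augment M n g ` vecs R n = carrier M" by blast
  have least: "\<not> ?P l" if "l < n" for l using not_less_Least[of l ?P] that unfolding n_def by blast
  have "x \<in> vecs_in (ring_mod R) m n" if x: "x \<in> vecs R n" "augment M n g x = \<zero>\<^bsub>M\<^esub>" for x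
  proof (rule ccontr)
    assume "x \<notin> vecs_in (ring_mod R) m n"
    then obtain k where k: "k < n" "x k \<notin> m" using x(1) by (auto simp: vecs_in_def vecs_def)
    have xc: "x i \<in> carrier R" for i by (rule ring_vecs_carrier[OF x(1)])
    have U: "x k \<in> Units R" using unitI k xc by blast
    obtain l where l: "n = Suc l" using k by (cases n) auto
    \<comment> \<open>The redundant generator k is overwritten by the last one, so that the
      remaining l generators are again indexed by an initial segment.\<close>
    define g' where "g' = g(k := g l)"
    have g': "g' i \<in> carrier M" if "i < l" for i using that g(1) l k by (auto simp: g'_def)
    let ?A = "augment M l g' ` vecs R l"
    have A: "submodule ?A R M"
      using linear_map.submodule_image[OF M.augment_linear[of l g'] RM.vecs_submodule[of l]] g' by (simp add: vecs_ring)
    have single: "g' i \<in> ?A" if "i < l" for i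
      using M.augment_single[of l g' i] g' that unit_vec_vecs[OF that] by (metis imageI)
    have other: "g i \<in> ?A" if "i < n" "i \<noteq> k" for i
    proof (cases "i = l")
      case True
      then have "k < l" using k that l by auto
      then show ?thesis using single[of k] True by (simp add: g'_def)
    next
      case False
      then show ?thesis using single[of i] that l by (simp add: g'_def)
    qed
    let ?s = "finsum M (\<lambda>i. x i \<odot>\<^bsub>M\<^esub> g i) ({..<n} - {k})"
    have "x i \<odot>\<^bsub>M\<^esub> g i \<in> ?A" if "i < n" "i \<noteq> k" for i
      by (rule M.submoduleE(4)[OF A xc other[OF that]])
    then have s: "?s \<in> ?A"
      by (intro M.submodule_finsum[OF A]) auto
    have ins: "{..<n} = insert k ({..<n} - {k})" using k by auto
    have "augment M n g x = x k \<odot>\<^bsub>M\<^esub> g k \<oplus>\<^bsub>M\<^esub> ?s"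
      unfolding augment_def by (subst ins, rule M.M.finsum_insert) (use xc g k in auto)
    then have eq: "x k \<odot>\<^bsub>M\<^esub> g k \<oplus>\<^bsub>M\<^esub> ?s = \<zero>\<^bsub>M\<^esub>" using x(2) by simp
    have sc: "?s \<in> carrier M" using s A by (auto simp: M.submodule_iff)
    have "\<ominus>\<^bsub>M\<^esub> ?s = x k \<odot>\<^bsub>M\<^esub> g k" by (rule M.M.minus_equality[OF eq sc]) (use xc g k in auto)
    then have "x k \<odot>\<^bsub>M\<^esub> g k \<in> ?A" using M.submoduleE(3)[OF A s] by simp
    then have "inv (x k) \<odot>\<^bsub>M\<^esub> (x k \<odot>\<^bsub>M\<^esub> g k) \<in> ?A" using M.submoduleE(4)[OF A] U by blast
    then have gk: "g k \<in> ?A" using U xc g k by (simp add: M.smult_assoc1[symmetric])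
    have "carrier M \<subseteq> ?A"
    proof
      fix y assume "y \<in> carrier M"
      then obtain u where u: "u \<in> vecs R n" "y = augment M n g u" using g(2) by blast
      have y: "y = finsum M (\<lambda>i. u i \<odot>\<^bsub>M\<^esub> g i) {..<n}" unfolding u(2) by (simp add: augment_def)
      show "y \<in> ?A" unfolding y
      proof (rule M.submodule_finsum[OF A])
        fix i assume "i \<in> {..<n}"
        then have "g i \<in> ?A" using gk other by (cases "i = k") auto
        then show "u i \<odot>\<^bsub>M\<^esub> g i \<in> ?A" using A ring_vecs_carrier[OF u(1)] unfolding M.submodule_iff by blast
      qed simp
    qed
    then have "?A = carrier M" using A by (auto simp: M.submodule_iff)
    then have "?P l" using g' by blast
    then show False using least l by blast
  qed
  then show thesis using that[OF g] by blast
qed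

text \<open>Over a local ring this says that the columns of A minimally generate its image. It is
  stated for the kernel because the next matrix of a resolution has that kernel as its
  image.\<close>

definition minimal_kernel where
  "minimal_kernel A p q \<longleftrightarrow> is_mat R A p q \<and>
     {x \<in> vecs R q. mat_R R A p q x = (\<lambda>_. \<zero>)} \<subseteq> vecs_in (ring_mod R) m q"

text \<open>K has finite length inside R^c, so it is finitely generated; a minimal cover of K,
  viewed as a module of its own, supplies the columns of B.\<close>

lemma minimal_matrix_cover:
  assumes len: "has_length R (ring_mod R) {\<zero>} (carrier R) L"
    and K: "submodule K R (seqs R)" "K \<subseteq> vecs R c"
  obtains r B where "minimal_kernel B c r" "mat_R R B c r ` vecs R r = K"
proof -
  interpret V: plain_module R "seqs R" by (rule plain_module.intro[OF RM.fun_module])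
  have "has_length R (seqs R) {\<zero>\<^bsub>seqs R\<^esub>} (vecs R c) (c * L)"
    using RM.has_length_vecs_in[of "carrier R" L c] len by (simp add: vecs_eq[of "ring_mod R", symmetric, simplified] vecs_ring)
  then obtain n where n: "has_length R (seqs R) {\<zero>\<^bsub>seqs R\<^esub>} K n"
    by (rule V.has_length_submodule[OF _ K])
  obtain n0 g0 where g0: "\<And>i. i < n0 \<Longrightarrow> g0 i \<in> K" "augment (seqs R) n0 g0 ` vecs R n0 = K"
    by (rule V.finite_length_generated[OF n]) (rule that)
  let ?K = "(seqs R)\<lparr>carrier := K\<rparr>"
  interpret I: linear_map R ?K "seqs R" "\<lambda>x. x" by (rule submodule_inclusion_linear[OF V.module_axioms K(1)])
  have aug: "augment ?K n g x = augment (seqs R) n g x" if "\<And>i. i < n \<Longrightarrow> g i \<in> K" "x \<in> vecs R n" for n g x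
  proof -
    have "(\<lambda>k. x k \<odot>\<^bsub>?K\<^esub> g k) \<in> {..<n} \<rightarrow> carrier ?K"
      using that(1) ring_vecs_carrier[OF that(2)] K(1) by (auto simp: V.submodule_iff)
    from I.map_finsum[OF _ this] show ?thesis by (simp add: augment_def)
  qed
  have "augment ?K n0 g0 ` vecs R n0 = carrier ?K"
    using g0(2) aug[OF g0(1)] by (auto simp: image_iff)
  then obtain r g where g: "\<And>k. k < r \<Longrightarrow> g k \<in> K" "augment ?K r g ` vecs R r = K"
    and ker: "{x \<in> vecs R r. augment ?K r g x = \<zero>\<^bsub>?K\<^esub>} \<subseteq> vecs_in (ring_mod R) m r"
    using minimal_cover[OF I.V.module_axioms, of n0 g0 thesis] g0(1) by auto
  define B where "B j k = g k j" for j k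
  have gv: "g k \<in> vecs R c" if "k < r" for k using g(1)[OF that] K(2) by auto
  have B: "is_mat R B c r" using ring_vecs_carrier[OF gv] by (auto simp: B_def)
  have gV: "g k \<in> carrier (seqs R)" if "k < r" for k using ring_vecs_carrier[OF gv[OF that]] by simp
  have eq0: "mat_R R B c r x = augment (seqs R) r g x" if x: "x \<in> vecs R r" for x
  proof (rule linear_map_eq_on_ring_vecs[OF mat_R_linear[OF B] V.augment_linear[OF gV] _ x])
    fix k assume k: "k < r"
    have "mat_R R B c r (unit_vec R k) = g k"
      unfolding mat_R_eq RM.mat_N_single[OF B k, of \<one>, simplified]
      using B k gv[OF k] by (auto simp: B_def vecs_def fun_eq_iff)
    then show "mat_R R B c r (unit_vec R k) = augment (seqs R) r g (unit_vec R k)"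
      using V.augment_single[OF gV k] by simp
  qed auto
  have eq: "mat_R R B c r x = augment ?K r g x" if x: "x \<in> vecs R r" for x
    by (rule trans[OF eq0[OF x] aug[OF g(1) x, symmetric]])
  have "{x \<in> vecs R r. mat_R R B c r x = (\<lambda>_. \<zero>)} \<subseteq> vecs_in (ring_mod R) m r"
    using ker eq by auto
  moreover have "mat_R R B c r ` vecs R r = K" using g(2) eq by auto
  ultimately show thesis using that B unfolding minimal_kernel_def by blast
qed

text \<open>Kernels are covered minimally again and again, by dependent choice; finite length of R
  provides the generators at each stage.\<close>

lemma minimal_resolution:
  fixes M :: "('a, 'c) module"
  assumes len: "has_length R (ring_mod R) {\<zero>} (carrier R) L" and fg: "fin_gen_module R M"
  obtains b d g where "free_resolution R M b d g" "\<And>i j k. j < b i \<Longrightarrow> k < b (Suc i) \<Longrightarrow> d (Suc i) j k \<in> m"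
proof -
  have M: "module R M" using fg by (simp add: fin_gen_module_def)
  interpret M: plain_module R M by (rule plain_module.intro[OF M])
  let ?V = "seqs R"
  have vR: "submodule (vecs R k) R ?V" for k using RM.vecs_submodule[of k] by (simp add: vecs_ring)
  obtain n0 :: nat and g0 where g0': "\<forall>k<n0. g0 k \<in> carrier M"
    and sp: "\<forall>y\<in>carrier M. \<exists>a. (\<forall>k<n0. a k \<in> carrier R) \<and> y = finsum M (\<lambda>k. a k \<odot>\<^bsub>M\<^esub> g0 k) {..<n0}"
    using fg unfolding fin_gen_module_def by (elim conjE exE) (rule that; assumption)
  note g0 = g0'[rule_format]
  have "augment M n0 g0 ` vecs R n0 = carrier M"
  proof
    show "augment M n0 g0 ` vecs R n0 \<subseteq> carrier M"
      using linear_map.map_closed[OF M.augment_linear[OF g0]] ring_vecs_carrier by auto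
    show "carrier M \<subseteq> augment M n0 g0 ` vecs R n0"
    proof
      fix y assume "y \<in> carrier M"
      then obtain a where a: "\<And>k. k < n0 \<Longrightarrow> a k \<in> carrier R" "y = finsum M (\<lambda>k. a k \<odot>\<^bsub>M\<^esub> g0 k) {..<n0}" using sp by blast
      define a' where "a' k = (if k < n0 then a k else \<zero>)" for k
      have "a' \<in> vecs R n0" using a by (auto simp: vecs_def a'_def)
      moreover have "y = augment M n0 g0 a'" unfolding a(2) augment_def
        by (rule M.M.finsum_cong') (use a g0 in \<open>auto simp: a'_def\<close>)
      ultimately show "y \<in> augment M n0 g0 ` vecs R n0" by blast
    qed
  qed
  then obtain b0 g where g: "\<And>k. k < b0 \<Longrightarrow> g k \<in> carrier M" "augment M b0 g ` vecs R b0 = carrier M"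
    and ker: "{x \<in> vecs R b0. augment M b0 g x = \<zero>\<^bsub>M\<^esub>} \<subseteq> vecs_in (ring_mod R) m b0"
    using minimal_cover[OF M, of n0 g0 thesis] g0 by blast
  interpret a: linear_map R ?V M "augment M b0 g" by (rule M.augment_linear[OF g(1)])
  obtain r B where B: "minimal_kernel B b0 r" "mat_R R B b0 r ` vecs R r = {x \<in> vecs R b0. augment M b0 g x = \<zero>\<^bsub>M\<^esub>}"
    by (rule minimal_matrix_cover[OF len a.submodule_kernel[OF vR[of b0]]]) auto
  \<comment> \<open>A state is a matrix with its two sizes. The clause for n = 0 ties the sequence
    to the matrix already covering the kernel of the augmentation.\<close>
  define P where "P n X = (case X of (p, q, A) \<Rightarrow> minimal_kernel A p q \<and> (n = (0::nat) \<longrightarrow> X = (b0, r, B)))" for n X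
  define Q where "Q n X Y = (case X of (p, q, A) \<Rightarrow> case Y of (p', q', A') \<Rightarrow> p' = q \<and>
     {x \<in> vecs R q. mat_R R A p q x = (\<lambda>_. \<zero>)} = mat_R R A' q q' ` vecs R q')" for n :: nat and X Y
  have "\<exists>f. \<forall>n. P n (f n) \<and> Q n (f n) (f (Suc n))"
  proof (rule dependent_nat_choice)
    show "\<exists>X. P 0 X" using B by (auto simp: P_def)
    fix X n assume P: "P n X"
    obtain p q A where X: "X = (p, q, A)" by (cases X)
    have A: "is_mat R A p q" using P by (auto simp: P_def X minimal_kernel_def)
    interpret A: linear_map R ?V ?V "mat_R R A p q" by (rule mat_R_linear[OF A])
    have "submodule {x \<in> vecs R q. mat_R R A p q x = (\<lambda>_. \<zero>)} R ?V" using A.submodule_kernel[OF vR[of q]] by simp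
    then obtain q' A' where "minimal_kernel A' q q'" "mat_R R A' q q' ` vecs R q' = {x \<in> vecs R q. mat_R R A p q x = (\<lambda>_. \<zero>)}"
      by (rule minimal_matrix_cover[OF len]) auto
    then show "\<exists>Y. P (Suc n) Y \<and> Q n X Y" by (intro exI[of _ "(q, q', A')"]) (auto simp: P_def Q_def X)
  qed
  then obtain f where f: "\<And>n. P n (f n)" "\<And>n. Q n (f n) (f (Suc n))" by blast
  define b where "b i = fst (f i)" for i
  define d where "d i = snd (snd (f (i - 1)))" for i
  have Qb: "fst (snd (f i)) = b (Suc i)" for i using f(2)[of i] unfolding Q_def b_def by (auto split: prod.splits)
  have fi: "f i = (b i, b (Suc i), d (Suc i))" for i using Qb[of i] by (simp add: b_def d_def prod_eq_iff)
  have mk: "minimal_kernel (d (Suc i)) (b i) (b (Suc i))" for i using f(1)[of i] unfolding P_def fi by simp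
  have ex: "{x \<in> vecs R (b (Suc i)). mat_R R (d (Suc i)) (b i) (b (Suc i)) x = (\<lambda>_. \<zero>)}
      = mat_R R (d (Suc (Suc i))) (b (Suc i)) (b (Suc (Suc i))) ` vecs R (b (Suc (Suc i)))" for i
    using f(2)[of i] unfolding Q_def fi by simp
  have f0: "b 0 = b0" "b 1 = r" "d 1 = B" using f(1)[of 0] unfolding P_def fi by auto
  have res: "free_resolution R M b d g"
    unfolding free_resolution_def
  proof (intro conjI allI impI)
    show "g k \<in> carrier M" if "k < b 0" for k using g that f0 by simp
    show "d i j k \<in> carrier R" if "1 \<le> i" "j < b (i - 1)" "k < b i" for i j k
      using mk[of "i - 1"] that unfolding minimal_kernel_def by auto
    show "augment M (b 0) g ` vecs R (b 0) = carrier M" using g f0 by simp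
    show "{x \<in> vecs R (b 0). augment M (b 0) g x = \<zero>\<^bsub>M\<^esub>} = mat_R R (d 1) (b 0) (b 1) ` vecs R (b 1)"
      using B(2) f0 by simp
    show "{x \<in> vecs R (b i). mat_R R (d i) (b (i - 1)) (b i) x = (\<lambda>_. \<zero>)} = mat_R R (d (Suc i)) (b i) (b (Suc i)) ` vecs R (b (Suc i))"
      if "1 \<le> i" for i using ex[of "i - 1"] that by simp
  qed
  \<comment> \<open>Each image is the kernel of a minimal cover: of the augmentation for i = 0, of
    the preceding matrix otherwise. Unit vectors then show that all matrix entries lie in m.\<close>
  have im: "mat_R R (d (Suc i)) (b i) (b (Suc i)) ` vecs R (b (Suc i)) \<subseteq> vecs_in (ring_mod R) m (b i)" for i
  proof (cases i)
    case 0
    then show ?thesis using B(2) ker f0 by simp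
  next
    case (Suc j)
    then show ?thesis using ex[of j] mk[of j] unfolding minimal_kernel_def by simp
  qed
  have "d (Suc i) j k \<in> m" if jk: "j < b i" "k < b (Suc i)" for i j k
  proof -
    have A: "is_mat R (d (Suc i)) (b i) (b (Suc i))" using mk unfolding minimal_kernel_def by blast
    have "mat_R R (d (Suc i)) (b i) (b (Suc i)) (unit_vec R k) \<in> vecs_in (ring_mod R) m (b i)"
      using im unit_vec_vecs[OF jk(2)] by blast
    then show ?thesis
      unfolding mat_R_eq RM.mat_N_single[OF A jk(2), of \<one>, simplified] using jk A by (auto simp: vecs_in_def)
  qed
  then show thesis using that res by blast
qed

text \<open>If the target is zero, a unit vector of the source is a cycle, hence a boundary; but
  boundaries have entries in m.\<close>

lemma minimal_resolution_zero:
  assumes F: "free_complex R b d" and min: "\<And>i j k. j < b i \<Longrightarrow> k < b (Suc i) \<Longrightarrow> d (Suc i) j k \<in> m"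
    and b: "b i = 0"
  shows "b (Suc i) = 0"
proof (rule ccontr)
  assume nz: "b (Suc i) \<noteq> 0"
  interpret F: free_complex R b d by fact
  have "unit_vec R 0 \<in> vecs R (b (Suc i))" using unit_vec_vecs nz by simp
  moreover have "F.dR i (unit_vec R 0) = (\<lambda>_. \<zero>)" using b by (simp add: mat_R_def)
  ultimately obtain x where x: "x \<in> vecs R (b (Suc (Suc i)))" "unit_vec R 0 = F.dR (Suc i) x"
    using F.exact[of i] by blast
  have "F.dR (Suc i) x \<in> vecs_in (ring_mod R) m (b (Suc i))"
    unfolding mat_R_eq
  proof (rule RM.mat_N_in)
    show "submodule m R (ring_mod R)" using m_ideal ideal_iff_submodule by blast
    show "d (Suc (Suc i)) j k \<odot>\<^bsub>ring_mod R\<^esub> x k \<in> m" if "j < b (Suc i)" "k < b (Suc (Suc i))" for j k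
      using ideal.I_r_closed[OF m_ideal min[OF that] ring_vecs_carrier[OF x(1)]] by simp
  qed
  then have "unit_vec R 0 0 \<in> m" unfolding x(2)[symmetric] using nz by (auto simp: vecs_in_def)
  then show False using one_notin by (simp add: single_def)
qed

text \<open>Used in contrapositive form: infinite projective dimension makes all Betti numbers
  nonzero, which permits division by them.\<close>

lemma minimal_resolution_finite:
  assumes res: "free_resolution R M b d g" and min: "\<And>i j k. j < b i \<Longrightarrow> k < b (Suc i) \<Longrightarrow> d (Suc i) j k \<in> m"
    and b: "b i = 0"
  shows "finite_proj_dim R M"
proof -
  have "b j = 0" if "i \<le> j" for j
    using that by (induction rule: dec_induct) (use b minimal_resolution_zero[OF free_resolution_complex[OF is_cring res] min] in auto)
  then show ?thesis using res unfolding finite_proj_dim_def by (meson less_imp_le)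
qed

end

subsection \<open>Growth of Betti numbers\<close>

lemma (in module) submodule_carrier_update:
  assumes "submodule A R M"
  shows "submodule C R (M\<lparr>carrier := A\<rparr>) \<longleftrightarrow> submodule C R M \<and> C \<subseteq> A"
  unfolding module.submodule_iff[OF submodule.submodule_is_module[OF assms module_axioms]] submodule_iff
  using assms by (auto simp: submodule_iff)

lemma (in module) submodule_chain_carrier_update:
  assumes A: "submodule A R M" and C: "C \<subseteq> A"
  shows "submodule_chain R (M\<lparr>carrier := A\<rparr>) B n C \<longleftrightarrow> submodule_chain R M B n C"
  using C
proof (induction n arbitrary: C)
  case 0
  then show ?case by (simp add: submodule_carrier_update[OF A])
next
  case (Suc n)
  have "(submodule_chain R (M\<lparr>carrier := A\<rparr>) B n C' \<and> C' \<subset> C) = (submodule_chain R M B n C' \<and> C' \<subset> C)" for C'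
    using Suc.IH[of C'] Suc.prems by blast
  then show ?case using Suc.prems by (simp add: submodule_carrier_update[OF A])
qed

text \<open>A syzygy appears both as a submodule of a free module and as a module in its own right;
  lengths below it agree.\<close>

lemma (in module) has_length_carrier_update:
  assumes "submodule A R M" "C \<subseteq> A"
  shows "has_length R (M\<lparr>carrier := A\<rparr>) B C n \<longleftrightarrow> has_length R M B C n"
  unfolding has_length_def submodule_chain_carrier_update[OF assms] ..

lemma linear_map_restrict:
  assumes T: "linear_map R V W T" and A: "submodule A R W" and TA: "\<And>x. x \<in> carrier V \<Longrightarrow> T x \<in> A"
  shows "linear_map R V (W\<lparr>carrier := A\<rparr>) T"
proof -
  interpret linear_map R V W T by fact
  show ?thesis
    by (intro linear_map.intro linear_map_axioms.intro V.module_axioms submodule.submodule_is_module[OF A W.module_axioms])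
      (auto simp: TA map_add map_smult)
qed

section \<open>Vanishing Tor over a minimal complex, and lengths of its syzygies\<close>

locale minimal_complex = local_cring R m + free_complex R b d
  for R :: "('a, 'b) ring_scheme" (structure) and m and b and d +
  assumes minimal: "j < b i \<Longrightarrow> k < b (Suc i) \<Longrightarrow> d (Suc i) j k \<in> m"
begin

lemma mat_N_minimal:
  fixes N :: "('a, 'e) module"
  assumes N: "module R N" and y: "\<And>k. k < b (Suc i) \<Longrightarrow> y k \<in> carrier N"
  shows "mat_N N (d (Suc i)) (b i) (b (Suc i)) y \<in> vecs_in N (ideal_smul m N (carrier N)) (b i)"
proof -
  interpret N: plain_module R N by (rule plain_module.intro[OF N])
  show ?thesis
    by (rule N.mat_N_in[OF N.ideal_smul_submodule(1)[OF m_ideal N.carrier_is_submodule]])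
      (auto intro!: ideal_smul.gen minimal y)
qed

text \<open>If \<open>x\<close> is killed by \<open>m\<close>, then \<open>e\<^sub>0 \<otimes> x\<close> is a cycle, hence a boundary, and boundaries lie in \<open>mN\<close>.\<close>

lemma tor_zero_socle:
  fixes N :: "('a, 'e) module"
  assumes N: "module R N" and tor: "tor_zero N b d (Suc i)" and b: "b (Suc i) \<noteq> 0"
    and x: "x \<in> carrier N" "\<And>r. r \<in> m \<Longrightarrow> r \<odot>\<^bsub>N\<^esub> x = \<zero>\<^bsub>N\<^esub>"
  shows "x \<in> ideal_smul m N (carrier N)"
proof -
  interpret N: plain_module R N by (rule plain_module.intro[OF N])
  have b0: "0 < b (Suc i)" using b by simp
  have "mat_N N (d (Suc i)) (b i) (b (Suc i)) (single N 0 x) = (\<lambda>_. \<zero>\<^bsub>N\<^esub>)"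
    unfolding N.mat_N_single[OF mats b0 x(1)] using minimal b0 x(2) by auto
  moreover have "single N 0 x \<in> vecs N (b (Suc i))" by (rule N.single_vecs[OF x(1) b0])
  ultimately obtain w where w: "w \<in> vecs N (b (Suc (Suc i)))"
    "single N 0 x = mat_N N (d (Suc (Suc i))) (b (Suc i)) (b (Suc (Suc i))) w"
    using tor unfolding tor_zero_def by auto
  have "single N 0 x \<in> vecs_in N (ideal_smul m N (carrier N)) (b (Suc i))"
    unfolding w(2) by (rule mat_N_minimal[OF N N.vecs_carrier[OF w(1)]])
  then have "single N 0 x 0 \<in> ideal_smul m N (carrier N)" using b0 by (auto simp: vecs_in_def)
  then show ?thesis by (simp add: single_def)
qed

text \<open>Both kernel and image of the differential on N^b are powers of mN, so additivity of
  length gives the relation. The two vanishing degrees identify the image and the kernel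
  respectively.\<close>

lemma tor_zero_length:
  fixes N :: "('a, 'e) module"
  assumes N: "module R N" and tor: "tor_zero N b d (Suc i)" "tor_zero N b d (Suc (Suc i))"
    and m2: "\<And>r x. r \<in> m \<Longrightarrow> x \<in> ideal_smul m N (carrier N) \<Longrightarrow> r \<odot>\<^bsub>N\<^esub> x = \<zero>\<^bsub>N\<^esub>"
    and n: "has_length R N {\<zero>\<^bsub>N\<^esub>} (carrier N) n" and p: "has_length R N {\<zero>\<^bsub>N\<^esub>} (ideal_smul m N (carrier N)) p"
  shows "b (Suc (Suc i)) * n = b (Suc (Suc i)) * p + b (Suc i) * p"
proof -
  interpret N: plain_module R N by (rule plain_module.intro[OF N])
  let ?I = "ideal_smul m N (carrier N)"
  have sI: "submodule ?I R N" "?I \<subseteq> carrier N" using N.ideal_smul_submodule[OF m_ideal N.carrier_is_submodule] by auto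
  let ?D = "\<lambda>i. mat_N N (d (Suc i)) (b i) (b (Suc i))"
  have killed: "?D i y = (\<lambda>_. \<zero>\<^bsub>N\<^esub>)" if y: "y \<in> vecs_in N ?I (b (Suc i))" for i y
  proof -
    have "?D i y \<in> vecs_in N {\<zero>\<^bsub>N\<^esub>} (b i)"
      by (rule N.mat_N_in[OF N.submodule_zero]) (use y m2 minimal in \<open>auto simp: vecs_in_def\<close>)
    then show ?thesis by (auto simp: vecs_in_def fun_eq_iff) (metis not_le)
  qed
  \<comment> \<open>Boundaries have entries in mN by minimality, vectors over mN are cycles because
    m kills mN, and vanishing Tor turns cycles into boundaries.\<close>
  have cyc: "vecs_in N ?I (b (Suc i)) = ?D (Suc i) ` vecs N (b (Suc (Suc i)))"
    if tor: "tor_zero N b d (Suc i)" for i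
  proof
    have "vecs_in N ?I (b (Suc i)) \<subseteq> {y \<in> vecs N (b (Suc i)). ?D i y = (\<lambda>_. \<zero>\<^bsub>N\<^esub>)}"
      using killed vecs_in_mono[OF sI(2), of N "b (Suc i)"] unfolding vecs_eq by blast
    then show "vecs_in N ?I (b (Suc i)) \<subseteq> ?D (Suc i) ` vecs N (b (Suc (Suc i)))"
      using tor unfolding tor_zero_def by auto
    show "?D (Suc i) ` vecs N (b (Suc (Suc i))) \<subseteq> vecs_in N ?I (b (Suc i))"
      using mat_N_minimal[OF N N.vecs_carrier] by auto
  qed
  interpret T: linear_map R "fun_mod N" "fun_mod N" "?D (Suc i)" by (rule N.mat_N_linear[OF mats])
  have ker: "{y \<in> vecs N (b (Suc (Suc i))). ?D (Suc i) y = \<zero>\<^bsub>fun_mod N\<^esub>} = vecs_in N ?I (b (Suc (Suc i)))"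
  proof
    show "{y \<in> vecs N (b (Suc (Suc i))). ?D (Suc i) y = \<zero>\<^bsub>fun_mod N\<^esub>} \<subseteq> vecs_in N ?I (b (Suc (Suc i)))"
      unfolding cyc[OF tor(2)] using tor(2) unfolding tor_zero_def by auto
    show "vecs_in N ?I (b (Suc (Suc i))) \<subseteq> {y \<in> vecs N (b (Suc (Suc i))). ?D (Suc i) y = \<zero>\<^bsub>fun_mod N\<^esub>}"
      using killed vecs_in_mono[OF sI(2), of N "b (Suc (Suc i))"] unfolding vecs_eq by auto
  qed
  have "has_length R (fun_mod N) {\<zero>\<^bsub>fun_mod N\<^esub>} (vecs N (b (Suc (Suc i)))) (b (Suc (Suc i)) * p + b (Suc i) * p)"
    by (rule T.has_length_exact[OF N.vecs_submodule]) (simp_all only: ker cyc[OF tor(1), symmetric] N.has_length_vecs_in[OF p])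
  moreover have "has_length R (fun_mod N) {\<zero>\<^bsub>fun_mod N\<^esub>} (vecs N (b (Suc (Suc i)))) (b (Suc (Suc i)) * n)"
    unfolding vecs_eq by (rule N.has_length_vecs_in[OF n])
  ultimately show ?thesis by (rule has_length_unique[symmetric])
qed

text \<open>Off by one from the usual numbering: this is the (j+1)-st syzygy, placed inside R^(b
  j).\<close>

definition syz where "syz j = dR j ` vecs R (b (Suc j))"

lemma seqs_module: "module R (seqs R)"
  by (rule fun_mod_module[OF ring_mod_module])

lemma ring_vecs_submodule: "submodule (vecs R q) R (seqs R)"
  using plain_module.vecs_submodule[OF ring_plain_module, of q] by (simp add: vecs_ring)

lemma syz_submodule: "submodule (syz j) R (seqs R)"
  unfolding syz_def by (rule linear_map.submodule_image[OF mat_R_linear[OF mats] ring_vecs_submodule])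

lemma syz_kernel: "syz (Suc j) = {x \<in> vecs R (b (Suc j)). dR j x = \<zero>\<^bsub>seqs R\<^esub>}"
  unfolding syz_def using exact[of j] by simp

lemma ideal_smul_carrier: "ideal_smul m (ring_mod R) (carrier R) = m"
proof
  interpret RM: plain_module R "ring_mod R" by (rule ring_plain_module)
  show "ideal_smul m (ring_mod R) (carrier R) \<subseteq> m"
    by (rule RM.ideal_smul_least) (use m_ideal in \<open>auto simp: ideal_iff_submodule intro: ideal.I_r_closed\<close>)
  show "m \<subseteq> ideal_smul m (ring_mod R) (carrier R)"
  proof
    fix r assume r: "r \<in> m"
    have "r \<odot>\<^bsub>ring_mod R\<^esub> \<one> \<in> ideal_smul m (ring_mod R) (carrier R)" by (rule ideal_smul.gen[OF r]) simp
    then show "r \<in> ideal_smul m (ring_mod R) (carrier R)" using m_carrier[OF r] by simp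
  qed
qed

lemma syz_minimal: "syz j \<subseteq> vecs_in (ring_mod R) m (b j)"
proof
  fix x assume "x \<in> syz j"
  then obtain u where u: "u \<in> vecs R (b (Suc j))" "x = dR j u" unfolding syz_def by blast
  have "mat_N (ring_mod R) (d (Suc j)) (b j) (b (Suc j)) u \<in> vecs_in (ring_mod R) (ideal_smul m (ring_mod R) (carrier (ring_mod R))) (b j)"
    by (rule mat_N_minimal[OF ring_mod_module]) (use ring_vecs_carrier[OF u(1)] in simp)
  then show "x \<in> vecs_in (ring_mod R) m (b j)" unfolding u(2) mat_R_eq by (simp add: ideal_smul_carrier)
qed

text \<open>A matrix reads only the first entries of a sequence. Hence it is a linear map into
  \<open>syz j\<close> on all of \<open>seqs R\<close>, the form in which
  \<open>tor_zero_shift\<close> takes its surjection.\<close>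

lemma dR_range: "x \<in> carrier (seqs R) \<Longrightarrow> dR j x \<in> syz j"
proof -
  assume x: "x \<in> carrier (seqs R)"
  let ?x = "\<lambda>k. if k < b (Suc j) then x k else \<zero>"
  have xv: "?x \<in> vecs R (b (Suc j))" using x by (auto simp: vecs_def)
  have "finsum R (\<lambda>k. d (Suc j) l k \<otimes> x k) {..<b (Suc j)} = finsum R (\<lambda>k. d (Suc j) l k \<otimes> ?x k) {..<b (Suc j)}" if "l < b j" for l
    by (rule finsum_cong') (use mats[of j] x that in auto)
  then have "dR j x = dR j ?x" by (auto simp: mat_R_def)
  then show ?thesis unfolding syz_def using xv by blast
qed

lemma ideal_smul_vecs:
  "ideal J R \<Longrightarrow> ideal_smul m (seqs R) (vecs_in (ring_mod R) J q) = vecs_in (ring_mod R) (ideal_smul m (ring_mod R) J) q"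
  by (rule plain_module.ideal_smul_vecs_in[OF ring_plain_module m_ideal]) (simp add: ideal_iff_submodule)

lemma ring_vecs_eq: "vecs R q = vecs_in (ring_mod R) (carrier R) q"
  using vecs_eq[of "ring_mod R" q] by (simp add: vecs_ring)

text \<open>Two exact sequences with the same left end: \<open>syz (Suc j)\<close> is the kernel of
  R^b -> \<open>syz j\<close>, and, being contained in mR^b by minimality, also the kernel of mR^b
  -> m \<open>syz j\<close>.\<close>

lemma syz_lengths:
  assumes l1: "has_length R (ring_mod R) {\<zero>} m l" and l0: "has_length R (ring_mod R) {\<zero>} (carrier R) (l + 1)"
  obtains n p where
    "\<And>j. has_length R (seqs R) {\<zero>\<^bsub>seqs R\<^esub>} (syz j) (n j)"
    "\<And>j. has_length R (seqs R) {\<zero>\<^bsub>seqs R\<^esub>} (ideal_smul m (seqs R) (syz j)) (p j)"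
    "\<And>j. b (Suc j) * (l + 1) = n (Suc j) + n j"
    "\<And>j. b (Suc j) * l = n (Suc j) + p j"
proof -
  interpret RM: plain_module R "ring_mod R" by (rule ring_plain_module)
  let ?z = "{\<zero>\<^bsub>seqs R\<^esub>}"
  have "\<exists>n n' p. has_length R (seqs R) ?z (syz (Suc j)) n' \<and> has_length R (seqs R) ?z (syz j) n \<and>
     has_length R (seqs R) ?z (ideal_smul m (seqs R) (syz j)) p \<and> b (Suc j) * (l + 1) = n' + n \<and> b (Suc j) * l = n' + p" for j
  proof -
    interpret T: linear_map R "seqs R" "seqs R" "dR j" by (rule mat_R_linear[OF mats])
    have "has_length R (seqs R) ?z (vecs R (b (Suc j))) (b (Suc j) * (l + 1))"
      unfolding ring_vecs_eq using RM.has_length_vecs_in[of "carrier R" "l + 1"] l0 by simp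
    then obtain n' n where n: "b (Suc j) * (l + 1) = n' + n" "has_length R (seqs R) ?z (syz (Suc j)) n'"
      "has_length R (seqs R) ?z (syz j) n"
      unfolding syz_kernel[of j] syz_def[of j] by (rule T.has_length_exactE)
    have ker: "{x \<in> vecs_in (ring_mod R) m (b (Suc j)). dR j x = \<zero>\<^bsub>seqs R\<^esub>} = syz (Suc j)"
      using syz_minimal[of "Suc j"] vecs_in_mono[of m "carrier R" "ring_mod R" "b (Suc j)"] m_carrier
      unfolding syz_kernel ring_vecs_eq by auto
    have img: "dR j ` vecs_in (ring_mod R) m (b (Suc j)) = ideal_smul m (seqs R) (syz j)"
      using T.ideal_smul_image[of m "vecs R (b (Suc j))"] m_carrier ring_vecs_submodule ideal_smul_vecs[OF oneideal]
      unfolding syz_def ring_vecs_eq ideal_smul_carrier by auto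
    have "has_length R (seqs R) ?z (vecs_in (ring_mod R) m (b (Suc j))) (b (Suc j) * l)"
      using RM.has_length_vecs_in[of m l] l1 by simp
    then obtain n'' p where p: "b (Suc j) * l = n'' + p" "has_length R (seqs R) ?z (syz (Suc j)) n''"
      "has_length R (seqs R) ?z (ideal_smul m (seqs R) (syz j)) p"
      unfolding ker[symmetric] img[symmetric] by (rule T.has_length_exactE)
    have "n'' = n'" by (rule has_length_unique[OF p(2) n(2)])
    then show ?thesis using n p by blast
  qed
  then obtain n n' p where h: "\<And>j. has_length R (seqs R) ?z (syz (Suc j)) (n' j)" "\<And>j. has_length R (seqs R) ?z (syz j) (n j)"
    "\<And>j. has_length R (seqs R) ?z (ideal_smul m (seqs R) (syz j)) (p j)"
    "\<And>j. b (Suc j) * (l + 1) = n' j + n j" "\<And>j. b (Suc j) * l = n' j + p j" by metis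
  have "n' j = n (Suc j)" for j by (rule has_length_unique[OF h(1,2)])
  then show thesis using that[of n p] h by simp
qed

end

text \<open>Both relations come from knowing the length of mZ for a syzygy Z of \<open>N\<close>.
  The equality mZ = m^2 R^c is proved for \<open>syz (Suc j)\<close>, the kernel of a matrix; this
  is why \<open>c\<close> enters from index 1 on.\<close>

theorem (in local_cring) betti_growth:
  fixes N :: "('a, 'e) module"
  assumes B: "minimal_complex R m b d" and C: "minimal_complex R m c d'"
    and N: "module R N" and res: "free_resolution R N c d' g"
    and l2: "has_length R (ring_mod R) {\<zero>} (ideal_prod R m m) s"
    and l1: "has_length R (ring_mod R) {\<zero>} m (s + e)"
    and l0: "has_length R (ring_mod R) {\<zero>} (carrier R) (s + e + 1)"
    and cube: "\<And>x y z. x \<in> m \<Longrightarrow> y \<in> m \<Longrightarrow> z \<in> m \<Longrightarrow> x \<otimes> (y \<otimes> z) = \<zero>"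
    and tor: "\<And>i. n0 \<le> i \<Longrightarrow> tor_zero N b d i"
    and b: "\<And>i. b i \<noteq> 0"
  shows "c (Suc (Suc (Suc j))) + s * c (Suc j) = e * c (Suc (Suc j))"
    and "n0 \<le> i \<Longrightarrow> b (Suc (Suc i)) * c (Suc (Suc j)) = s * b (Suc i) * c (Suc j)"
proof -
  interpret B: minimal_complex R m b d by (rule B)
  interpret C: minimal_complex R m c d' by (rule C)
  interpret N: plain_module R N by (rule plain_module.intro[OF N])
  interpret RM: plain_module R "ring_mod R" by (rule ring_plain_module)
  interpret V: plain_module R "seqs R" by (rule plain_module.intro[OF C.seqs_module])
  let ?Z = "\<lambda>j. (seqs R)\<lparr>carrier := C.syz j\<rparr>" and ?mm = "ideal_prod R m m"
  have Zm: "module R (?Z j)" for j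
    by (rule submodule.submodule_is_module[OF C.syz_submodule V.module_axioms])
  \<comment> \<open>the vanishing range does not shrink with \<open>j\<close>, since shifting lowers the degree by one\<close>
  have torZ: "tor_zero (?Z j) b d (Suc i)" if "n0 \<le> i" for i j
    using that
  proof (induction j arbitrary: i)
    case 0
    note r = res[unfolded free_resolution_def]
    have g: "\<And>k. k < c 0 \<Longrightarrow> g k \<in> carrier N" and sur: "carrier N \<subseteq> augment N (c 0) g ` vecs R (c 0)"
      using r by auto
    have ker: "C.syz 0 = {x \<in> vecs R (c 0). augment N (c 0) g x = \<zero>\<^bsub>N\<^esub>}" using r unfolding C.syz_def by auto
    show ?case by (rule B.tor_zero_shift[OF N.augment_linear[OF g] sur ker tor]) (use 0 in auto)
  next
    case (Suc j)
    have lin: "linear_map R (seqs R) (?Z j) (C.dR j)"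
      by (rule linear_map_restrict[OF mat_R_linear[OF C.mats] C.syz_submodule C.dR_range])
    show ?case
      by (rule B.tor_zero_shift[OF lin, of "c (Suc j)"]) (use Suc C.syz_kernel[of j] in \<open>auto simp: C.syz_def\<close>)
  qed
  have smul: "ideal_smul m (?Z j) (C.syz j) = ideal_smul m (seqs R) (C.syz j)" for j
  proof -
    interpret I: linear_map R "?Z j" "seqs R" "\<lambda>x. x"
      by (rule submodule_inclusion_linear[OF V.module_axioms C.syz_submodule])
    have "submodule (C.syz j) R (?Z j)"
      using V.submodule_carrier_update[OF C.syz_submodule] C.syz_submodule by blast
    then show ?thesis using I.ideal_smul_image[of m "C.syz j"] m_carrier by auto
  qed
  have mm: "ideal ?mm R" by (rule ideal_prod_is_ideal[OF m_ideal m_ideal])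
  have kill: "r \<otimes> y = \<zero>" if r: "r \<in> m" and y: "y \<in> ?mm" for r y
  proof -
    have "y \<in> carrier R \<and> r \<otimes> y = \<zero>" using y
    proof induction
      case (prod x z)
      then show ?case using cube[OF r] m_carrier by auto
    next
      case (sum x z)
      then show ?case using m_carrier[OF r] by (simp add: r_distr)
    qed
    then show ?thesis by simp
  qed
  have kill_vec: "r \<odot>\<^bsub>seqs R\<^esub> x = \<zero>\<^bsub>seqs R\<^esub>" if "r \<in> m" "x \<in> vecs_in (ring_mod R) ?mm q" for r x q
  proof
    show "(r \<odot>\<^bsub>seqs R\<^esub> x) k = \<zero>\<^bsub>seqs R\<^esub> k" for k
      using that kill m_carrier by (cases "k < q") (auto simp: vecs_in_def)
  qed
  have smm: "submodule (vecs_in (ring_mod R) ?mm q) R (seqs R)" for q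
    by (rule RM.vecs_in_submodule) (use mm ideal_iff_submodule in blast)
  have mZ: "ideal_smul m (seqs R) (C.syz j) \<subseteq> vecs_in (ring_mod R) ?mm (c j)" for j
  proof (rule V.ideal_smul_least[OF smm])
    fix r x assume "r \<in> m" "x \<in> C.syz j"
    then show "r \<odot>\<^bsub>seqs R\<^esub> x \<in> vecs_in (ring_mod R) ?mm (c j)"
      using C.syz_minimal[of j] m_carrier by (auto simp: vecs_in_def intro: ideal_prod.prod)
  qed
  \<comment> \<open>A vector over m^2 is killed by the differential, whose entries lie in m, and so
    belongs to the syzygy. It is also killed by m, and \<open>tor_zero_socle\<close> places it in
    mZ.\<close>
  have mZ_eq: "ideal_smul m (seqs R) (C.syz (Suc j)) = vecs_in (ring_mod R) ?mm (c (Suc j))" for j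
  proof
    show "vecs_in (ring_mod R) ?mm (c (Suc j)) \<subseteq> ideal_smul m (seqs R) (C.syz (Suc j))"
    proof
      fix x assume x: "x \<in> vecs_in (ring_mod R) ?mm (c (Suc j))"
      have "C.dR j x \<in> vecs_in (ring_mod R) {\<zero>} (c j)"
        unfolding mat_R_eq
        by (rule RM.mat_N_in) (use RM.submodule_zero x kill C.minimal in \<open>auto simp: vecs_in_def\<close>)
      then have "C.dR j x = \<zero>\<^bsub>seqs R\<^esub>" by (auto simp: vecs_in_def fun_eq_iff) (metis not_le)
      moreover have "x \<in> vecs R (c (Suc j))"
        using x vecs_in_mono[of ?mm "carrier R"] mm unfolding C.ring_vecs_eq by (auto simp: ideal_iff)
      ultimately have xZ: "x \<in> C.syz (Suc j)" unfolding C.syz_kernel by blast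
      have "x \<in> ideal_smul m (?Z (Suc j)) (carrier (?Z (Suc j)))"
        by (rule B.tor_zero_socle[OF Zm torZ[OF order_refl] b]) (use xZ kill_vec[OF _ x] in auto)
      then show "x \<in> ideal_smul m (seqs R) (C.syz (Suc j))" using smul by simp
    qed
  qed (rule mZ)
  obtain n p where n: "\<And>j. has_length R (seqs R) {\<zero>\<^bsub>seqs R\<^esub>} (C.syz j) (n j)"
    and p: "\<And>j. has_length R (seqs R) {\<zero>\<^bsub>seqs R\<^esub>} (ideal_smul m (seqs R) (C.syz j)) (p j)"
    and I: "\<And>j. c (Suc j) * (s + e + 1) = n (Suc j) + n j" and II: "\<And>j. c (Suc j) * (s + e) = n (Suc j) + p j"
    by (rule C.syz_lengths[OF l1 l0]) (rule that)
  have III: "p (Suc j) = c (Suc j) * s" for j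
  proof -
    have "has_length R (seqs R) {\<zero>\<^bsub>seqs R\<^esub>} (ideal_smul m (seqs R) (C.syz (Suc j))) (c (Suc j) * s)"
      unfolding mZ_eq using RM.has_length_vecs_in[of ?mm s] l2 by simp
    then show ?thesis by (rule has_length_unique[OF p])
  qed
  \<comment> \<open>The difference of the two length counts: Z/mZ has as its length the number of
    minimal generators of Z.\<close>
  have IV: "n j = c (Suc j) + p j" for j using I[of j] II[of j] by (simp add: algebra_simps)
  \<comment> \<open>In II at \<open>Suc j\<close>, the length of the next syzygy is replaced by IV
    and both lengths of the form mZ by III; then s c (j+2) cancels on the two sides.\<close>
  show "c (Suc (Suc (Suc j))) + s * c (Suc j) = e * c (Suc (Suc j))"
    using II[of "Suc j"] III[of j] III[of "Suc j"] IV[of "Suc (Suc j)"] by (simp add: algebra_simps)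
  assume i: "n0 \<le> i"
  \<comment> \<open>The length identity for Z = \<open>syz (Suc j)\<close>. Here n - p is c (j+2) by
    IV, and p is s c (j+1) by III, which gives the product relation.\<close>
  have "b (Suc (Suc i)) * n (Suc j) = b (Suc (Suc i)) * p (Suc j) + b (Suc i) * p (Suc j)"
  proof (rule B.tor_zero_length[OF Zm torZ[OF i] torZ])
    let ?K = "?Z (Suc j)"
    have sub: "ideal_smul m (seqs R) (C.syz (Suc j)) \<subseteq> C.syz (Suc j)"
      by (rule V.ideal_smul_submodule(2)[OF m_ideal C.syz_submodule])
    show "r \<odot>\<^bsub>?K\<^esub> x = \<zero>\<^bsub>?K\<^esub>" if "r \<in> m" "x \<in> ideal_smul m ?K (carrier ?K)" for r x
      using kill_vec[OF that(1), of x] that(2) mZ[of "Suc j"] by (auto simp: smul)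
    show "has_length R ?K {\<zero>\<^bsub>?K\<^esub>} (carrier ?K) (n (Suc j))"
      using V.has_length_carrier_update[OF C.syz_submodule order_refl] n by simp
    show "has_length R ?K {\<zero>\<^bsub>?K\<^esub>} (ideal_smul m ?K (carrier ?K)) (p (Suc j))"
      using V.has_length_carrier_update[OF C.syz_submodule sub] p by (simp add: smul)
  qed (use i in simp)
  then show "b (Suc (Suc i)) * c (Suc (Suc j)) = s * b (Suc i) * c (Suc j)"
    unfolding IV III by (simp add: algebra_simps)
qed

section \<open>Arithmetic of the Betti numbers\<close>

lemma growth_quadratic:
  fixes c :: "nat \<Rightarrow> nat"
  assumes rec: "\<And>j. c (Suc (Suc (Suc j))) + s * c (Suc j) = e * c (Suc (Suc j))"
    and mul: "\<And>j. b2 * c (Suc (Suc j)) = s * b1 * c (Suc j)" and pos: "b2 \<noteq> 0"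
  shows "int (c (Suc (Suc j))) ^ 2 = int e * int (c (Suc j)) * int (c (Suc (Suc j))) - int s * int (c (Suc j)) ^ 2"
proof -
  define x y z B A where "x = int (c (Suc j))" "y = int (c (Suc (Suc j)))" "z = int (c (Suc (Suc (Suc j))))"
    "B = int b2" "A = int s * int b1"
  \<comment> \<open>The ratio A/B does not depend on j, so x, y, z are consecutive terms of a
    geometric sequence and y^2 = x z; eliminating z by the recurrence leaves a quadratic form in x
    and y. Cross-multiplying keeps all of this in the integers.\<close>
  have 1: "B * y = A * x" "B * z = A * y"
    using mul[of j] mul[of "Suc j"] unfolding x_y_z_B_A_def by (metis of_nat_mult)+
  have 2: "z = int e * y - int s * x" using rec[of j] unfolding x_y_z_B_A_def
    by (metis add_diff_cancel_right' of_nat_add of_nat_mult)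
  have "B * (y * y) = B * (x * z)" using 1 by (metis mult.assoc mult.left_commute)
  then have "y * y = x * z" using pos by (simp add: x_y_z_B_A_def)
  then show ?thesis unfolding 2 by (simp add: x_y_z_B_A_def power2_eq_square algebra_simps)
qed

text \<open>The rational y/x is a root of t^2 - e t + s. Completing the square exhibits the
  discriminant times x^2 as a square, and x divides its root; the quotient is the difference of the
  two roots up to sign.\<close>

lemma discriminant_square:
  fixes x y e s :: int
  assumes "y ^ 2 = e * x * y - s * x ^ 2" "x \<noteq> 0"
  shows "\<exists>t. t ^ 2 = e ^ 2 - 4 * s"
proof -
  have eq: "(2 * y - e * x) ^ 2 = (e ^ 2 - 4 * s) * x ^ 2"
    using assms(1) by (simp add: power2_eq_square algebra_simps)
  then have "x ^ 2 dvd (2 * y - e * x) ^ 2" by simp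
  then have "x dvd 2 * y - e * x" by (simp add: pow_divides_pow_iff)
  then obtain t where "2 * y - e * x = x * t" by blast
  then have "(t ^ 2) * x ^ 2 = (e ^ 2 - 4 * s) * x ^ 2" using eq by (simp add: power_mult_distrib mult.commute)
  then show ?thesis using assms(2) by auto
qed

text \<open>Connects the definition of vanishing Tor, which speaks of some resolution of M, with
  \<open>betti_growth\<close>, which needs a minimal one.\<close>

lemma (in local_cring) growth_of_infinite_proj_dim:
  fixes M :: "('a, 'c) module" and N :: "('a, 'e) module"
  assumes l2: "has_length R (ring_mod R) {\<zero>} (ideal_prod R m m) s"
    and l1: "has_length R (ring_mod R) {\<zero>} m (s + e)"
    and l0: "has_length R (ring_mod R) {\<zero>} (carrier R) (s + e + 1)"
    and cube: "\<And>x y z. x \<in> m \<Longrightarrow> y \<in> m \<Longrightarrow> z \<in> m \<Longrightarrow> x \<otimes> (y \<otimes> z) = \<zero>"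
    and M: "module R M" and N: "module R N"
    and b: "free_resolution R M b d g" "\<And>i j k. j < b i \<Longrightarrow> k < b (Suc i) \<Longrightarrow> d (Suc i) j k \<in> m"
    and c: "free_resolution R N c d' g'" "\<And>i j k. j < c i \<Longrightarrow> k < c (Suc i) \<Longrightarrow> d' (Suc i) j k \<in> m"
    and inf: "\<not> finite_proj_dim R M"
    and tor: "tor_eventually_zero R M N"
  obtains n0 where "\<And>j. c (Suc (Suc (Suc j))) + s * c (Suc j) = e * c (Suc (Suc j))"
    "\<And>i j. n0 \<le> i \<Longrightarrow> b (Suc (Suc i)) * c (Suc (Suc j)) = s * b (Suc i) * c (Suc j)"
proof -
  have B: "minimal_complex R m b d"
    by (intro minimal_complex.intro minimal_complex_axioms.intro local_cring_axioms b(2)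
        free_resolution_complex[OF is_cring b(1)])
  have C: "minimal_complex R m c d'"
    by (intro minimal_complex.intro minimal_complex_axioms.intro local_cring_axioms c(2)
        free_resolution_complex[OF is_cring c(1)])
  have nz: "b i \<noteq> 0" for i using minimal_resolution_finite[OF b] inf by blast
  obtain b' h g'' n0 where r: "free_resolution R M b' h g''" and t: "\<forall>i\<ge>n0. tor_zero N b' h i"
    using tor unfolding tor_eventually_zero_def by blast
  \<comment> \<open>The comparison covers positive degrees, hence the threshold
    \<open>Suc n0\<close>.\<close>
  have t': "tor_zero N b d i" if i: "Suc n0 \<le> i" for i
  proof -
    obtain i' where i': "i = Suc i'" using i by (metis Suc_le_D)
    have "tor_zero N b' h (Suc i')" using t i i' by auto
    then show ?thesis unfolding i' by (rule tor_zero_resolution_independent[OF M N b(1) r])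
  qed
  note growth = betti_growth[OF B C N c(1) l2 l1 l0 cube t' nz]
  show thesis by (rule that[of "Suc n0"]) (use growth in auto)
qed

theorem theorem4p5:
  fixes R :: "('a, 'b) ring_scheme" and e s :: nat
  assumes "local_ring R"
    and "hilbert_series R = 1 + of_nat e * fps_X + of_nat s * fps_X ^ 2"
  shows "((s = 0 \<or> \<not> (\<exists>t::int. t ^ 2 = int e ^ 2 - 4 * int s))
           \<longrightarrow> tor_friendly R TYPE('c) TYPE('e)) \<and>
         ((s = 0 \<or> int e ^ 2 - 4 * int s \<noteq> 0) \<longrightarrow> tor_persistent R TYPE('c))"
proof -
  interpret L: local_cring R "max_ideal R" by (rule local_cring_max_ideal[OF assms(1)])
  note len = ring_length[OF assms]
  show ?thesis
  proof (intro conjI impI)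
    assume H: "s = 0 \<or> \<not> (\<exists>t::int. t ^ 2 = int e ^ 2 - 4 * int s)"
    show "tor_friendly R TYPE('c) TYPE('e)"
      unfolding tor_friendly_def
    proof (intro allI impI, elim conjE)
      fix M :: "('a, 'c) module" and N :: "('a, 'e) module"
      assume fg: "fin_gen_module R M" "fin_gen_module R N" and tor: "tor_eventually_zero R M N"
      show "finite_proj_dim R M \<or> finite_proj_dim R N"
      proof (rule ccontr)
        assume "\<not> (finite_proj_dim R M \<or> finite_proj_dim R N)"
        then have inf: "\<not> finite_proj_dim R M" "\<not> finite_proj_dim R N" by auto
        have mods: "module R M" "module R N" using fg by (auto simp: fin_gen_module_def)
        obtain b d g where b: "free_resolution R M b d g"
          "\<And>i j k. j < b i \<Longrightarrow> k < b (Suc i) \<Longrightarrow> d (Suc i) j k \<in> max_ideal R"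
          by (rule L.minimal_resolution[OF len(3) fg(1)]) (rule that)
        obtain c d' g' where c: "free_resolution R N c d' g'"
          "\<And>i j k. j < c i \<Longrightarrow> k < c (Suc i) \<Longrightarrow> d' (Suc i) j k \<in> max_ideal R"
          by (rule L.minimal_resolution[OF len(3) fg(2)]) (rule that)
        have pos: "b i \<noteq> 0" "c i \<noteq> 0" for i
          using L.minimal_resolution_finite[OF b] L.minimal_resolution_finite[OF c] inf by blast+
        obtain n0 where rec: "\<And>j. c (Suc (Suc (Suc j))) + s * c (Suc j) = e * c (Suc (Suc j))"
          and mul: "\<And>i j. n0 \<le> i \<Longrightarrow> b (Suc (Suc i)) * c (Suc (Suc j)) = s * b (Suc i) * c (Suc j)"
          by (rule L.growth_of_infinite_proj_dim[OF len mods b c inf(1) tor]) (assumption | rule that)+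
        \<comment> \<open>For s = 0 the product relation would make a product of nonzero Betti
          numbers vanish.\<close>
        have "s \<noteq> 0" using mul[of n0 0] pos by (metis le_refl mult_is_0)
        moreover have "\<exists>t::int. t ^ 2 = int e ^ 2 - 4 * int s"
          using discriminant_square[OF growth_quadratic[where c = c, OF rec mul[OF order_refl] pos(1), of 0]] pos by simp
        ultimately show False using H by blast
      qed
    qed
  next
    assume H: "s = 0 \<or> int e ^ 2 - 4 * int s \<noteq> 0"
    show "tor_persistent R TYPE('c)"
      unfolding tor_persistent_def
    proof (intro allI impI, elim conjE)
      fix M :: "('a, 'c) module"
      assume fg: "fin_gen_module R M" and tor: "tor_eventually_zero R M M"
      show "finite_proj_dim R M"
      proof (rule ccontr)
        assume inf: "\<not> finite_proj_dim R M"
        have M: "module R M" using fg by (auto simp: fin_gen_module_def)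
        obtain b d g where b: "free_resolution R M b d g"
          "\<And>i j k. j < b i \<Longrightarrow> k < b (Suc i) \<Longrightarrow> d (Suc i) j k \<in> max_ideal R"
          by (rule L.minimal_resolution[OF len(3) fg]) (rule that)
        have pos: "b i \<noteq> 0" for i
          using L.minimal_resolution_finite[OF b] inf by blast
        obtain n0 where rec: "\<And>j. b (Suc (Suc (Suc j))) + s * b (Suc j) = e * b (Suc (Suc j))"
          and mul: "\<And>i j. n0 \<le> i \<Longrightarrow> b (Suc (Suc i)) * b (Suc (Suc j)) = s * b (Suc i) * b (Suc j)"
          by (rule L.growth_of_infinite_proj_dim[OF len M M b b inf tor]) (assumption | rule that)+
        have s: "s \<noteq> 0" using mul[of n0 0] pos by (metis le_refl mult_is_0)
        \<comment> \<open>With M = N both indices of the product relation can be taken equal to n0,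
          so a single pair x, y satisfies y^2 = s x^2 as well as the quadratic equation.\<close>
        define x y where "x = int (b (Suc n0))" and "y = int (b (Suc (Suc n0)))"
        have x: "x \<noteq> 0" "y \<noteq> 0" using pos by (auto simp: x_def y_def)
        have 1: "y ^ 2 = int e * x * y - int s * x ^ 2"
          unfolding x_def y_def by (rule growth_quadratic[where c = b, OF rec mul[OF order_refl] pos])
        have 2: "y ^ 2 = int s * x ^ 2" using mul[of n0 n0] unfolding x_def y_def power2_eq_square
          by (metis le_refl mult.assoc of_nat_mult)
        \<comment> \<open>Adding s x^2 to y^2 gives e x y = 2 s x^2. Cancelling x, squaring and
          substituting y^2 = s x^2 once more yields 4 s = e^2.\<close>
        have "x * (2 * int s * x) = x * (int e * y)" using 1 2 by (simp add: power2_eq_square algebra_simps)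
        then have "2 * int s * x = int e * y" using x by simp
        then have "(2 * int s * x) ^ 2 = int e ^ 2 * (int s * x ^ 2)" using 2 by (simp add: power_mult_distrib)
        then have "(int s * x ^ 2) * (4 * int s) = (int s * x ^ 2) * int e ^ 2" by (simp add: power2_eq_square algebra_simps)
        then have "int e ^ 2 - 4 * int s = 0" using s x by simp
        then show False using H s by blast
      qed
    qed
  qed
qed

end
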